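(* Let $N\ge2$, $\Omega=\mathbb{R}^{N-1}\times(0,\infty)$, fix $\delta>0$, $k>0$, and let $(\phi,\psi)\in L^\infty(\Omega)\times L^\infty(\partial\Omega)$. For $\epsilon>0$ let $u^{\epsilon}_{k}$ and $u^{\epsilon}_0$ be the solutions (defined in the context) of the heat problem with dynamical boundary condition with parameters $(\epsilon,\delta,k)$ and $(\epsilon,\delta,0)$. Define \[\Phi_k(x,y,t):=-2\int_0^\infty\Gamma_{N-1}\!\left(x'-y',\frac k\delta t+\tau\right)\partial_\xi\Gamma_1\!\left(x_N+y_N+\frac t\delta,\tau\right)d\tau,\qquad v_k(x,t):=\int_{\partial\Omega}\Phi_k(x,y,t)\psi(y)\,d\sigma(y),\] and $v_0(x,t):=\int_{\partial\Omega}P(x'-y',x_N+t/\delta)\psi(y)\,d\sigma(y)$, $(x,t)\in\overline\Omega\times(0,\infty)$. Then for every $L>0$ and every compact $I\subset(0,\infty)$, \[\sup_{(x,t)\in\Omega_L\times I}|u^\epsilon_k(x,t)-v_k(x,t)|=O(\epsilon^{1/2}),\qquad\sup_{(x,t)\in\Omega_L\times I}|u^\epsilon_0(x,t)-v_0(x,t)|=O(\epsilon^{1/2})\] as $\epsilon\to0^+$, where $\Omega_L=\{x\in\overline\Omega:0\le x_N\le L\}$. If moreover $\psi\in BC(\partial\Omega)$, then $v_k\in C(Q)$ and $v_k$ is a bounded classical solution of problem (LDD). Furthermore, for every $T>0$ and $R>0$, $|v_k(x,t)-v_0(x,t)|=O(k)$ as $k\to0^+$, uniformly for $(x,t)\in\overline\Omega\times(0,T]$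 with $x_N+t/\delta\ge R$.
   Context: $x=(x',x_N)$; $\partial\Omega\cong\mathbb{R}^{N-1}$ with surface measure $d\sigma$; $\Delta'$ is the Laplacian in $x'$. $\Gamma_d(x,t)=(4\pi t)^{-d/2}e^{-|x|^2/(4t)}$; $\partial_\xi\Gamma_1$ denotes the spatial derivative of $\Gamma_1$. $P(x)=c_Nx_N|x|^{-N}$ with $c_N=\pi^{-N/2}\Gamma(N/2)$ (Gamma function) is the Poisson kernel of $\Omega$. $y^*=(y',-y_N)$, $G_0(x,y,s)=\Gamma_N(x-y,s)-\Gamma_N(x-y^*,s)$. For $\kappa\ge0$: $H(x,y,t)=-2\int_0^t\Gamma_{N-1}(x'-y',\frac{t-\tau}\epsilon+\frac\kappa\delta\tau)\partial_\xi\Gamma_1(x_N+y_N+\frac\tau\delta,\frac{t-\tau}\epsilon)d\tau$, $G=G_0(x,y,t/\epsilon)+\delta^{-1}H$, and the solution with parameters $(\epsilon,\delta,\kappa)$ and data $(\phi,\psi)$ is $u(x,t)=\int_\Omega G(x,y,t)\phi(y)dy+\frac\delta\epsilon\int_{\partial\Omega}G(x,y,t)\psi(y)d\sigma(y)$ (solution of $\epsilon\partial_tu=\Delta u$ in $\Omega$, $\delta\partial_tu-\kappa\Delta'u-\partial_{x_N}u=0$ on $\partial\Omega$, $u(0)=\phi$ in $\Omega$, $u(0)=\psi$ on $\partial\Omega$). Problem (LDD): $-\Delta u=0$ in $\Omega\times(0,\infty)$, $\delta\partial_tu-k\Delta'u-\partial_{x_N}u=0$ on $\partial\Omega\times(0,\infty)$,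 $u=\psi$ on $\partial\Omega\times\{0\}$. $Q:=(\overline\Omega\times[0,\infty))\setminus(\Omega\times\{0\})$. A classical solution of (LDD) is $u$ on $\overline\Omega\times[0,\infty)$ with $u\in C^{2;1}(\overline\Omega\times(0,\infty))\cap C(Q)$ satisfying the equations pointwise. *)

theory Defs
  imports "HOL-Analysis.Analysis"
begin

text \<open>Points of R^N are pairs (x', x_N) with x' in real^'n, so N = CARD('n) + 1 >= 2.
  The boundary of the half space is identified with real^'n (surface measure = Lebesgue measure).\<close>

definition Omega :: "((real^'n) \<times> real) set" where
  "Omega = {p. 0 < snd p}"

definition OmegaL :: "real \<Rightarrow> ((real^'n) \<times> real) set" where
  "OmegaL L = {p \<in> closure Omega. 0 \<le> snd p \<and> snd p \<le> L}"

definition Qset :: "(((real^'n) \<times> real) \<times> real) set" where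
  "Qset = (closure Omega \<times> {0..}) - (Omega \<times> {0})"

definition heat_kernel :: "nat \<Rightarrow> 'a::real_normed_vector \<Rightarrow> real \<Rightarrow> real" where
  "heat_kernel d x t = (4 * pi * t) powr (- (real d / 2)) * exp (- (norm x)\<^sup>2 / (4 * t))"

definition dGamma1 :: "real \<Rightarrow> real \<Rightarrow> real" where
  "dGamma1 \<xi> \<tau> = deriv (\<lambda>z::real. heat_kernel 1 z \<tau>) \<xi>"

definition reflect :: "(real^'n) \<times> real \<Rightarrow> (real^'n) \<times> real" where
  "reflect y = (fst y, - snd y)"

definition G0 :: "(real^'n) \<times> real \<Rightarrow> (real^'n) \<times> real \<Rightarrow> real \<Rightarrow> real" where
  "G0 x y s = heat_kernel (CARD('n) + 1) (x - y) s - heat_kernel (CARD('n) + 1) (x - reflect y) s"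

definition Hker :: "real \<Rightarrow> real \<Rightarrow> real \<Rightarrow> (real^'n) \<times> real \<Rightarrow> (real^'n) \<times> real \<Rightarrow> real \<Rightarrow> real" where
  "Hker \<epsilon> \<delta> \<kappa> x y t = - 2 * (LBINT \<tau>=0..t.
      heat_kernel CARD('n) (fst x - fst y) ((t - \<tau>) / \<epsilon> + \<kappa> / \<delta> * \<tau>)
      * dGamma1 (snd x + snd y + \<tau> / \<delta>) ((t - \<tau>) / \<epsilon>))"

definition Gker :: "real \<Rightarrow> real \<Rightarrow> real \<Rightarrow> (real^'n) \<times> real \<Rightarrow> (real^'n) \<times> real \<Rightarrow> real \<Rightarrow> real" where
  "Gker \<epsilon> \<delta> \<kappa> x y t = G0 x y (t / \<epsilon>) + Hker \<epsilon> \<delta> \<kappa> x y t / \<delta>"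

definition sol :: "real \<Rightarrow> real \<Rightarrow> real \<Rightarrow> ((real^'n) \<times> real \<Rightarrow> real) \<Rightarrow> (real^'n \<Rightarrow> real)
    \<Rightarrow> (real^'n) \<times> real \<Rightarrow> real \<Rightarrow> real" where
  "sol \<epsilon> \<delta> \<kappa> \<phi> \<psi> x t =
     (LINT y:Omega|lebesgue. Gker \<epsilon> \<delta> \<kappa> x y t * \<phi> y)
     + \<delta> / \<epsilon> * (LINT y'|lebesgue. Gker \<epsilon> \<delta> \<kappa> x (y', 0) t * \<psi> y')"

definition Phi :: "real \<Rightarrow> real \<Rightarrow> (real^'n) \<times> real \<Rightarrow> (real^'n) \<times> real \<Rightarrow> real \<Rightarrow> real" where
  "Phi \<delta> k x y t = - 2 * (LBINT \<tau>:{0<..}.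
      heat_kernel CARD('n) (fst x - fst y) (k / \<delta> * t + \<tau>)
      * dGamma1 (snd x + snd y + t / \<delta>) \<tau>)"

definition vk :: "real \<Rightarrow> real \<Rightarrow> (real^'n \<Rightarrow> real) \<Rightarrow> (real^'n) \<times> real \<Rightarrow> real \<Rightarrow> real" where
  "vk \<delta> k \<psi> x t = (LINT y'|lebesgue. Phi \<delta> k x (y', 0) t * \<psi> y')"

definition poisson :: "(real^'n) \<times> real \<Rightarrow> real" where
  "poisson z = (let N = real (CARD('n) + 1) in
      pi powr (- N / 2) * Gamma (N / 2) * snd z / norm z powr N)"

definition v0 :: "real \<Rightarrow> (real^'n \<Rightarrow> real) \<Rightarrow> (real^'n) \<times> real \<Rightarrow> real \<Rightarrow> real" where
  "v0 \<delta> \<psi> x t = (LINT y'|lebesgue. poisson (fst x - y', snd x + t / \<delta>) * \<psi> y')"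

text \<open>v_k extended to t = 0 by the initial datum psi (only its values on the boundary matter for C(Q)).\<close>
definition vk_ext :: "real \<Rightarrow> real \<Rightarrow> (real^'n \<Rightarrow> real) \<Rightarrow> (real^'n) \<times> real \<Rightarrow> real \<Rightarrow> real" where
  "vk_ext \<delta> k \<psi> x t = (if 0 < t then vk \<delta> k \<psi> x t else \<psi> (fst x))"

definition classical_sol_LDD :: "real \<Rightarrow> real \<Rightarrow> (real^'n \<Rightarrow> real) \<Rightarrow> ((real^'n) \<times> real \<Rightarrow> real \<Rightarrow> real) \<Rightarrow> bool" where
  "classical_sol_LDD \<delta> k \<psi> u \<longleftrightarrow>
    (\<exists>(Du :: (real^'n) \<times> real \<Rightarrow> real \<Rightarrow> ((real^'n) \<times> real) \<Rightarrow>\<^sub>L real)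
      (D2u :: (real^'n) \<times> real \<Rightarrow> real \<Rightarrow> ((real^'n) \<times> real) \<Rightarrow>\<^sub>L (((real^'n) \<times> real) \<Rightarrow>\<^sub>L real))
      (ut :: (real^'n) \<times> real \<Rightarrow> real \<Rightarrow> real).
       (\<forall>x\<in>closure Omega. \<forall>t>0.
          ((\<lambda>y. u y t) has_derivative blinfun_apply (Du x t)) (at x within closure Omega)
        \<and> ((\<lambda>y. Du y t) has_derivative blinfun_apply (D2u x t)) (at x within closure Omega)
        \<and> ((\<lambda>s. u x s) has_real_derivative ut x t) (at t))
     \<and> continuous_on (closure Omega \<times> {0<..}) (\<lambda>p. u (fst p) (snd p))
     \<and> continuous_on (closure Omega \<times> {0<..}) (\<lambda>p. Du (fst p) (snd p))
     \<and> continuous_on (closure Omega \<times> {0<..}) (\<lambda>p. D2u (fst p) (snd p))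
     \<and> continuous_on (closure Omega \<times> {0<..}) (\<lambda>p. ut (fst p) (snd p))
     \<and> continuous_on Qset (\<lambda>p. u (fst p) (snd p))
     \<and> (\<forall>x\<in>Omega. \<forall>t>0. - (\<Sum>b\<in>Basis. D2u x t b b) = 0)
     \<and> (\<forall>y'. \<forall>t>0. \<delta> * ut (y', 0) t
            - k * (\<Sum>b\<in>(Basis :: (real^'n) set). D2u (y', 0) t (b, 0) (b, 0))
            - Du (y', 0) t (0, 1) = 0)
     \<and> (\<forall>y'. u (y', 0) 0 = \<psi> y'))"

end

theory Submission
  imports Defs "HOL-Probability.Distributions"
begin

text \<open>
  The kernel \<open>- 2 \<partial>\<^sub>\<xi> \<Gamma>\<^sub>1(\<xi>, \<tau>)\<close>, called \<open>lev \<xi> \<tau>\<close> below, is for \<open>\<xi> > 0\<close> a probability density in \<open>\<tau>\<close>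
  (a Levy distribution), so \<open>\<Phi>\<^sub>k\<close> is a heat kernel subordinated to it; for k = 0 a Gamma integral gives the
  Poisson kernel. After the substitution \<open>\<tau> = t - \<epsilon> s\<close> the boundary part of u has the same form, with
  the heat time and the distance perturbed by \<open>\<epsilon> s\<close> and the integral cut off at \<open>s = t / \<epsilon>\<close>. The
  estimates \<open>\<parallel>\<Gamma>(s\<^sub>1) - \<Gamma>(s\<^sub>2)\<parallel> \<le> 2 d (s\<^sub>2 - s\<^sub>1) / s\<^sub>2\<close> in \<open>L\<^sup>1\<close> and
  \<open>\<bar>lev \<xi>\<^sub>1 s - lev \<xi>\<^sub>2 s\<bar> \<le> s powr (-3/2) \<bar>\<xi>\<^sub>1 - \<xi>\<^sub>2\<bar>\<close> then bound the difference by \<open>O(\<epsilon> powr (1/2))\<close>, and the interior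
  part has mass of the same order; the first estimate also compares \<open>v\<^sub>k\<close> with \<open>v\<^sub>0\<close>.

  For the classical solution, \<open>v\<^sub>k(x, t) = V(x', k t / \<delta>, x\<^sub>N + t / \<delta>)\<close>, where V (x', a, \<open>\<xi>\<close>) averages the caloric extension
  of \<open>\<psi>\<close> at time \<open>a + \<tau>\<close> against \<open>lev \<xi> \<tau>\<close>. Differentiating under the integral gives \<open>\<partial>\<^sub>a V = \<Delta>' V\<close>, and since lev solves the
  heat equation, \<open>\<Delta>' V + \<partial>\<^sub>\<xi> \<partial>\<^sub>\<xi> V\<close> is the integral of a \<open>\<tau>\<close>-derivative, hence 0; the two equations together are (LDD).
\<close>

section \<open>The heat kernel and the Levy density\<close>

text \<open>The data are merely bounded, so every rate has to come from the L^1 norm in y of a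
  difference of kernels. In the double integrals y is therefore integrated before the subordination
  variable s: heat kernels count as mass one and scalar integrals in s remain. The exponent 1/2 is
  the index of the Levy law. Its density decays like \<open>s powr (-3/2)\<close>, so the mass cut
  off at s = t / \<epsilon> is of order sqrt (\<epsilon> / t); displacing the distance by \<epsilon>
  s / \<delta> costs \<epsilon> times the integral of \<open>s powr (-1/2)\<close> up to t /
  \<epsilon>, which is of order sqrt (\<epsilon> t). In the interior part the image term of
  \<open>G0\<close> leaves a mass of order x_N sqrt (\<epsilon> / t), one reason for the bound x_N
  \<le> L. Two obstacles shape the regularity proof. Each derivative of the kernel needs an
  integrable majorant, locally uniform in the parameters; an inductively defined family of kernels
  supplies all of them at once. These majorants degenerate as \<xi> tends to 0, that is on approach
  to the boundary at time 0, so continuity there needs another representation of v_k.\<close>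

lemma heat_kernel_nonneg [simp]: "0 \<le> heat_kernel d x t"
  by (simp add: heat_kernel_def)

lemma heat_kernel_minus [simp]: "heat_kernel d (- x) t = heat_kernel d x t"
  by (simp add: heat_kernel_def)

lemma borel_measurable_heat_kernel [measurable (raw)]:
  fixes f :: "'c \<Rightarrow> 'a::euclidean_space"
  assumes [measurable]: "f \<in> borel_measurable M" "g \<in> borel_measurable M"
  shows "(\<lambda>x. heat_kernel d (f x) (g x)) \<in> borel_measurable M"
  unfolding heat_kernel_def by measurable

lemma normal_density_heat_scale:
  assumes "s > 0"
  shows "normal_density 0 (sqrt (2 * s)) u = (4 * pi * s) powr (-1/2) * exp (- u\<^sup>2 / (4 * s))"
  using assms by (simp add: normal_density_def powr_minus_divide powr_half_sqrt mult.commute mult.left_commute)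

text \<open>In each coordinate the kernel is a centred normal density of variance 2 s; total mass
  one then follows coordinate by coordinate from the normal distribution.\<close>

lemma heat_kernel_eq_prod:
  fixes x :: "'a::euclidean_space"
  assumes "s > 0"
  shows "heat_kernel DIM('a) x s = (\<Prod>b\<in>Basis. normal_density 0 (sqrt (2 * s)) (x \<bullet> b))"
proof -
  have "(\<Prod>b\<in>Basis. normal_density 0 (sqrt (2 * s)) (x \<bullet> b))
      = ((4 * pi * s) powr (-1/2)) ^ DIM('a) * exp (\<Sum>b\<in>Basis. - (x \<bullet> b)\<^sup>2 / (4 * s))"
    using assms by (simp add: normal_density_heat_scale prod.distrib exp_sum)
  also have "((4 * pi * s) powr (-1/2)) ^ DIM('a) = (4 * pi * s) powr (- (real DIM('a) / 2))"
    using assms by (simp add: powr_powr powr_realpow [symmetric])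
  also have "(\<Sum>b\<in>Basis. - (x \<bullet> b)\<^sup>2 / (4 * s)) = - (norm x)\<^sup>2 / (4 * s)"
    using power2_norm_eq_inner[of x]
    by (simp add: sum_negf sum_divide_distrib[symmetric] euclidean_inner[of x x] flip: power2_eq_square)
  finally show ?thesis by (simp add: heat_kernel_def)
qed

lemma nn_integral_heat_kernel_centered:
  assumes "s > 0"
  shows "(\<integral>\<^sup>+x. heat_kernel DIM('a) (x::'a::euclidean_space) s \<partial>lborel) = 1"
proof -
  have 1: "(\<integral>\<^sup>+x. ennreal (normal_density 0 (sqrt (2 * s)) x) \<partial>lborel) = 1"
    using assms by (subst nn_integral_eq_integral) auto
  have "(\<integral>\<^sup>+x. heat_kernel DIM('a) (x::'a) s \<partial>lborel)
      = (\<integral>\<^sup>+x. (\<Prod>b\<in>Basis. ennreal (normal_density 0 (sqrt (2 * s)) ((x::'a) \<bullet> b))) \<partial>lborel)"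
    using assms by (simp add: heat_kernel_eq_prod prod_ennreal)
  also have "\<dots> = 1"
    by (subst nn_integral_lborel_prod) (auto simp: 1)
  finally show ?thesis .
qed

lemma nn_integral_lborel_affine:
  fixes t :: "'a::euclidean_space" and f :: "'a \<Rightarrow> ennreal"
  assumes [measurable]: "f \<in> borel_measurable borel" and "c \<noteq> 0"
  shows "(\<integral>\<^sup>+x. f x \<partial>lborel) = ennreal \<bar>c\<bar> ^ DIM('a) * (\<integral>\<^sup>+x. f (t + c *\<^sub>R x) \<partial>lborel)"
  by (subst lborel_affine[OF \<open>c \<noteq> 0\<close>, of t])
     (simp add: nn_integral_density nn_integral_distr nn_integral_cmult ennreal_power)

lemma nn_integral_heat_kernel:
  assumes "s > 0"
  shows "(\<integral>\<^sup>+y. heat_kernel DIM('a) (x - y :: 'a::euclidean_space) s \<partial>lborel) = 1"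
  using nn_integral_lborel_affine[of "\<lambda>y. heat_kernel DIM('a) (y::'a) s" "-1" x]
    nn_integral_heat_kernel_centered[OF assms, where 'a='a] by simp

lemma integral_heat_kernel:
  assumes "s > 0"
  shows "integrable lborel (\<lambda>y. heat_kernel DIM('a) (x - y :: 'a::euclidean_space) s)"
    and "(\<integral>y. heat_kernel DIM('a) (x - y :: 'a::euclidean_space) s \<partial>lborel) = 1"
proof -
  show I: "integrable lborel (\<lambda>y. heat_kernel DIM('a) (x - y :: 'a::euclidean_space) s)"
    by (rule integrableI_nonneg) (auto simp: nn_integral_heat_kernel[OF assms])
  show "(\<integral>y. heat_kernel DIM('a) (x - y :: 'a::euclidean_space) s \<partial>lborel) = 1"
    using nn_integral_heat_kernel[OF assms, of x] nn_integral_eq_integral[OF I] by simp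
qed

text \<open>The Gaussian factor increases with time and only the normalising power decreases, so the
  loss is at most the ratio of the two normalisations.\<close>

lemma heat_kernel_time_mono:
  assumes "0 < s1" "s1 \<le> s2"
  shows "(s1 / s2) powr (real d / 2) * heat_kernel d z s1 \<le> heat_kernel d z s2"
proof -
  have "(s1 / s2) powr (real d / 2) * (4 * pi * s1) powr (- (real d / 2)) = (4 * pi * s2) powr (- (real d / 2))"
    using assms by (simp add: powr_divide powr_mult powr_minus field_simps)
  moreover have "exp (- (norm z)\<^sup>2 / (4 * s1)) \<le> exp (- (norm z)\<^sup>2 / (4 * s2))"
    using assms by (simp add: frac_le)
  ultimately show ?thesis
    using mult_left_mono[of "exp (- (norm z)\<^sup>2 / (4 * s1))" "exp (- (norm z)\<^sup>2 / (4 * s2))" "(4 * pi * s2) powr (- (real d / 2))"]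
    by (simp add: heat_kernel_def mult.assoc[symmetric])
qed

text \<open>With \<open>r\<close> the ratio of the normalisations, r times the earlier kernel lies
  below both kernels. Their L^1 distance is therefore at most the sum of the two excess masses, 2 (1
  - r).\<close>

lemma heat_kernel_L1_diff:
  fixes s1 s2 :: real
  assumes "0 < s1" "s1 \<le> s2"
  shows "(\<integral>\<^sup>+y. \<bar>heat_kernel DIM('a) (x - y :: 'a::euclidean_space) s1 - heat_kernel DIM('a) (x - y) s2\<bar> \<partial>lborel)
    \<le> ennreal (2 * DIM('a) * (s2 - s1) / s2)"
proof -
  define d where "d = DIM('a)"
  define r where "r = (s1 / s2) powr (real d / 2)"
  have q: "0 < s1 / s2" "s1 / s2 \<le> 1" using assms by auto
  have r: "0 \<le> r" "r \<le> 1"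
    using q by (auto simp: r_def intro!: powr_le1)
  \<comment> \<open>Bernoulli's inequality is applied with an integer exponent. Replacing d/2 by d
    is harmless because the base is at most 1; it only doubles the constant.\<close>
  have "1 + real d * (s1 / s2 - 1) \<le> (1 + (s1 / s2 - 1)) ^ d"
    using q by (intro Bernoulli_inequality) auto
  also have "\<dots> = (s1 / s2) powr (real d)"
    using q by (simp add: powr_realpow)
  also have "\<dots> \<le> r"
    unfolding r_def using q by (intro powr_mono') auto
  finally have rd: "1 - r \<le> d * (s2 - s1) / s2"
    using assms by (simp add: field_simps)
  let ?h = "\<lambda>s y. heat_kernel d (x - y :: 'a) s"
  have I: "integrable lborel (?h s1)" "integrable lborel (?h s2)" "integral\<^sup>L lborel (?h s1) = 1" "integral\<^sup>L lborel (?h s2) = 1"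
    using assms integral_heat_kernel[where 'a='a] by (auto simp: d_def)
  have pt: "\<bar>?h s1 y - ?h s2 y\<bar> \<le> (?h s1 y - r * ?h s1 y) + (?h s2 y - r * ?h s1 y)" for y
  proof -
    have "r * ?h s1 y \<le> ?h s2 y" unfolding r_def by (rule heat_kernel_time_mono) fact+
    moreover have "r * ?h s1 y \<le> ?h s1 y" using r by (simp add: mult_left_le_one_le)
    ultimately show ?thesis by linarith
  qed
  have "(\<integral>\<^sup>+y. \<bar>?h s1 y - ?h s2 y\<bar> \<partial>lborel) \<le> (\<integral>\<^sup>+y. (?h s1 y - r * ?h s1 y) + (?h s2 y - r * ?h s1 y) \<partial>lborel)"
    by (intro nn_integral_mono ennreal_leI pt)
  also have "\<dots> = ennreal (\<integral>y. (?h s1 y - r * ?h s1 y) + (?h s2 y - r * ?h s1 y) \<partial>lborel)"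
    using I by (intro nn_integral_eq_integral AE_I2 order_trans[OF abs_ge_zero pt]) auto
  also have "(\<integral>y. (?h s1 y - r * ?h s1 y) + (?h s2 y - r * ?h s1 y) \<partial>lborel) = 2 * (1 - r)"
    using I by simp
  also have "ennreal (2 * (1 - r)) \<le> ennreal (2 * d * (s2 - s1) / s2)"
    using rd by (intro ennreal_leI) simp
  finally show ?thesis by (simp add: d_def)
qed

text \<open>For \<xi> > 0 this is the density of the first passage time to distance \<xi> of the
  Brownian motion with generator d^2/d\<xi>^2.\<close>

definition lev :: "real \<Rightarrow> real \<Rightarrow> real" where
  "lev \<xi> \<tau> = \<xi> / \<tau> * heat_kernel 1 \<xi> \<tau>"

lemma heat_kernel_1_deriv: "((\<lambda>z::real. heat_kernel 1 z \<tau>) has_real_derivative - lev z \<tau> / 2) (at z)"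
  unfolding heat_kernel_def lev_def
  by (cases "\<tau> = 0") (auto intro!: derivative_eq_intros simp: field_simps)

lemma dGamma1_eq_lev: "dGamma1 \<xi> \<tau> = - lev \<xi> \<tau> / 2"
  unfolding dGamma1_def by (rule DERIV_imp_deriv heat_kernel_1_deriv)+

lemma borel_measurable_lev [measurable (raw)]:
  assumes [measurable]: "f \<in> borel_measurable M" "g \<in> borel_measurable M"
  shows "(\<lambda>x. lev (f x) (g x)) \<in> borel_measurable M"
  unfolding lev_def by measurable

lemma lev_nonneg: "0 \<le> \<xi> \<Longrightarrow> 0 \<le> \<tau> \<Longrightarrow> 0 \<le> lev \<xi> \<tau>"
  by (simp add: lev_def)

lemma lev_eq:
  assumes "0 < \<tau>"
  shows "lev \<xi> \<tau> = \<xi> * (4 * pi) powr (-1/2) * \<tau> powr (-3/2) * exp (- \<xi>\<^sup>2 / (4 * \<tau>))"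
proof -
  have "\<tau> powr (-3/2) = \<tau> powr (-1 + -1/2)" by simp
  also have "\<dots> = inverse \<tau> * \<tau> powr (-1/2)"
    using assms by (subst powr_add) (simp add: powr_minus)
  finally show ?thesis using assms
    by (simp add: lev_def heat_kernel_def powr_mult field_simps)
qed

lemma four_pi_powr_le_1: "(4 * pi) powr (-1/2) \<le> 1"
  using pi_gt3 by (simp add: powr_minus_divide ge_one_powr_ge_zero)

lemma lev_le:
  assumes "0 \<le> \<xi>" "0 < \<tau>"
  shows "lev \<xi> \<tau> \<le> \<xi> * \<tau> powr (-3/2)"
proof -
  have "(4 * pi) powr (-1/2) * exp (- \<xi>\<^sup>2 / (4 * \<tau>)) \<le> 1 * 1"
    using assms four_pi_powr_le_1 by (intro mult_mono) auto
  from mult_left_mono[OF this, of "\<xi> * \<tau> powr (-3/2)"] assms show ?thesis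
    by (simp add: lev_eq mult_ac)
qed

text \<open>The factor \<xi> exp (- \<xi>^2 / (4 \<tau>)) has the derivative (1 - 2 u) exp (- u)
  with u = \<xi>^2 / (4 \<tau>), which is at most 1 in absolute value; the remaining factor of
  \<open>lev\<close> is \<open>\<tau> powr (-3/2)\<close> times a constant below 1.\<close>

lemma lev_diff_le:
  assumes "0 < \<tau>"
  shows "\<bar>lev \<xi>1 \<tau> - lev \<xi>2 \<tau>\<bar> \<le> \<bar>\<xi>1 - \<xi>2\<bar> * \<tau> powr (-3/2)"
proof -
  let ?g = "\<lambda>\<xi>. \<xi> * exp (- \<xi>\<^sup>2 / (4 * \<tau>))"
  let ?g' = "\<lambda>\<xi>. (1 - 2 * (\<xi>\<^sup>2 / (4 * \<tau>))) * exp (- \<xi>\<^sup>2 / (4 * \<tau>))"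
  have "(?g has_real_derivative ?g' \<xi>) (at \<xi>)" for \<xi>
    using assms by (auto intro!: derivative_eq_intros simp: field_simps power2_eq_square)
  moreover have "norm (?g' \<xi>) \<le> 1" for \<xi>
  proof -
    define u where "u = \<xi>\<^sup>2 / (4 * \<tau>)"
    have u: "u \<ge> 0" using assms by (simp add: u_def)
    have "\<bar>1 - 2 * u\<bar> \<le> exp u"
    proof (cases "u \<le> 1/2")
      case True then show ?thesis using u exp_ge_add_one_self[of u] by linarith
    next
      case False
      have "2 * u \<le> 1 + u + u\<^sup>2 / 2 + 1 / 2" using sum_squares_bound[of u 1] by (simp add: power2_eq_square)
      moreover have "1 + u + u\<^sup>2 / 2 \<le> exp u" using u by (rule exp_lower_Taylor_quadratic)
      ultimately show ?thesis using False by linarith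
    qed
    then have "\<bar>1 - 2 * u\<bar> * exp (- u) \<le> exp u * exp (- u)" by (intro mult_right_mono) auto
    also have "\<dots> = 1" by (simp add: exp_minus)
    finally show ?thesis by (simp add: abs_mult u_def)
  qed
  ultimately have "norm (?g \<xi>1 - ?g \<xi>2) \<le> 1 * norm (\<xi>1 - \<xi>2)"
    by (intro field_differentiable_bound[of UNIV ?g ?g']) (auto simp: has_field_derivative_at_within)
  then have g: "\<bar>?g \<xi>1 - ?g \<xi>2\<bar> \<le> \<bar>\<xi>1 - \<xi>2\<bar>" by simp
  have "\<bar>lev \<xi>1 \<tau> - lev \<xi>2 \<tau>\<bar> = \<bar>(4 * pi) powr (-1/2) * \<tau> powr (-3/2) * (?g \<xi>1 - ?g \<xi>2)\<bar>"
    using assms by (simp add: lev_eq algebra_simps)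
  also have "\<dots> = (4 * pi) powr (-1/2) * \<tau> powr (-3/2) * \<bar>?g \<xi>1 - ?g \<xi>2\<bar>"
    by (simp add: abs_mult)
  also have "\<dots> \<le> 1 * \<tau> powr (-3/2) * \<bar>\<xi>1 - \<xi>2\<bar>"
    using g four_pi_powr_le_1 by (intro mult_mono) auto
  finally show ?thesis by (simp add: mult.commute)
qed

text \<open>Inverting \<tau> to r / \<tau> turns Euler's integral for Gamma q into the normalisation
  of an inverse Gamma law. It is used with q = 1/2 for the mass of \<open>lev\<close>, q = 3/2 for
  its moment of order -1, and q = N/2 for the Poisson kernel.\<close>

lemma inverse_Gamma_integral:
  assumes "0 < q" "0 < (r::real)"
  shows "set_integrable lborel {0<..} (\<lambda>\<tau>. \<tau> powr (-1 - q) * exp (- r / \<tau>))"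
    and "(LBINT \<tau>:{0<..}. \<tau> powr (-1 - q) * exp (- r / \<tau>)) = Gamma q * r powr (- q)"
proof -
  let ?f = "\<lambda>t::real. t powr (q - 1) / exp t"
  let ?h = "\<lambda>\<tau>. \<bar>- r / \<tau>\<^sup>2\<bar> * ?f (r / \<tau>)"
  have "(?f has_integral Gamma q) {0..}" using assms by (intro Gamma_integral_real) auto
  \<comment> \<open>The endpoint 0 is removed so that the inversion maps the domain of integration
    onto itself.\<close>
  then have f: "(?f has_integral Gamma q) {0<..}"
  proof (rule has_integral_spike_set_eq[THEN iffD1, rotated 2])
    show "negligible {x \<in> {0..} - {0<..}. ?f x \<noteq> 0}"
      by (rule negligible_subset[of "{0::real}"]) auto
    show "negligible {x \<in> {0<..} - {0..}. ?f x \<noteq> 0}"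
      by (rule negligible_subset[of "{}"]) auto
  qed
  have img: "(\<lambda>\<tau>. r / \<tau>) ` {0<..} = {0<..}"
  proof safe
    fix x :: real assume "x > 0"
    then show "x \<in> (\<lambda>\<tau>. r / \<tau>) ` {0<..}" using assms by (intro image_eqI[of _ _ "r / x"]) auto
  qed (use assms in auto)
  have "?f absolutely_integrable_on {0<..}"
    using f by (intro nonnegative_absolutely_integrable_1) (auto simp: has_integral_integrable)
  then have "?f absolutely_integrable_on (\<lambda>\<tau>. r / \<tau>) ` {0<..} \<and> integral ((\<lambda>\<tau>. r / \<tau>) ` {0<..}) ?f = Gamma q"
    using f img by (auto simp: integral_unique)
  moreover have "((\<lambda>\<tau>. r / \<tau>) has_real_derivative - r / \<tau>\<^sup>2) (at \<tau> within {0<..})" if "\<tau> \<in> {0<..}" for \<tau>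
    using that by (auto intro!: derivative_eq_intros simp: power2_eq_square)
  moreover have "inj_on (\<lambda>\<tau>. r / \<tau>) {0<..}"
    using assms by (auto intro!: inj_onI)
  ultimately have "?h absolutely_integrable_on {0<..} \<and> integral {0<..} ?h = Gamma q"
    by (subst has_absolute_integral_change_of_variables_1') auto
  then have h: "?h absolutely_integrable_on {0<..}" "integral {0<..} ?h = Gamma q" by blast+
  have heq: "?h \<tau> = r powr q * (\<tau> powr (-1 - q) * exp (- r / \<tau>))" if "\<tau> > 0" for \<tau>
  proof -
    have "r powr q = r * r powr (q - 1)" using assms by (simp add: powr_diff)
    moreover have "\<tau> powr (-1 - q) = \<tau> powr (-2 + (1 - q))" by simp
    moreover have "\<tau> powr (-2 + (1 - q)) = \<tau> powr (-2) * \<tau> powr (1 - q)" by (rule powr_add)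
    moreover have "\<tau> powr (-2) = 1 / \<tau>\<^sup>2" using that by (simp add: powr_minus_divide powr_numeral)
    moreover have "\<tau> powr (1 - q) = 1 / \<tau> powr (q - 1)" using powr_minus_divide[of \<tau> "q - 1"] by simp
    ultimately show ?thesis
      using that assms by (simp add: powr_divide exp_minus field_simps)
  qed
  have h2: "(\<lambda>\<tau>. r powr q * (\<tau> powr (-1 - q) * exp (- r / \<tau>))) absolutely_integrable_on {0<..}"
    by (rule set_integrable_cong[THEN iffD1, OF refl refl _ h(1)]) (use heq in auto)
  then have h3: "(\<lambda>\<tau>. \<tau> powr (-1 - q) * exp (- r / \<tau>)) absolutely_integrable_on {0<..}"
    using assms by (subst (asm) set_integrable_mult_right_iff) auto
  then show "set_integrable lborel {0<..} (\<lambda>\<tau>. \<tau> powr (-1 - q) * exp (- r / \<tau>))"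
    unfolding set_integrable_def by (subst (asm) integrable_completion) auto
  have "(LBINT \<tau>:{0<..}. \<tau> powr (-1 - q) * exp (- r / \<tau>)) = (LINT \<tau>:{0<..}|lebesgue. \<tau> powr (-1 - q) * exp (- r / \<tau>))"
    unfolding set_lebesgue_integral_def by (subst integral_completion) auto
  also have "\<dots> = integral {0<..} (\<lambda>\<tau>. \<tau> powr (-1 - q) * exp (- r / \<tau>))"
    using h3 by (rule set_lebesgue_integral_eq_integral)
  also have "\<dots> = integral {0<..} (\<lambda>\<tau>. r powr (- q) * ?h \<tau>)"
  proof (intro integral_cong)
    fix \<tau> :: real assume "\<tau> \<in> {0<..}"
    then show "\<tau> powr (-1 - q) * exp (- r / \<tau>) = r powr (- q) * ?h \<tau>"
      using assms by (subst heq) (auto simp: powr_minus)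
  qed
  also have "\<dots> = r powr (- q) * Gamma q"
    using h(2) by (subst integral_mult_right) auto
  finally show "(LBINT \<tau>:{0<..}. \<tau> powr (-1 - q) * exp (- r / \<tau>)) = Gamma q * r powr (- q)"
    by simp
qed

lemma lev_integral:
  assumes "0 < \<xi>"
  shows "set_integrable lborel {0<..} (lev \<xi>)" and "(LBINT \<tau>:{0<..}. lev \<xi> \<tau>) = 1"
proof -
  let ?g = "\<lambda>\<tau>. \<tau> powr (-1 - 1/2) * exp (- (\<xi>\<^sup>2 / 4) / \<tau>)"
  have eq: "lev \<xi> \<tau> = \<xi> * (4 * pi) powr (-1/2) * ?g \<tau>" if "\<tau> > 0" for \<tau>
    using that by (simp add: lev_eq mult.assoc)
  have r: "0 < \<xi>\<^sup>2 / 4" using assms by simp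
  have q: "(0::real) < 1/2" by simp
  have "set_integrable lborel {0<..} (\<lambda>\<tau>. \<xi> * (4 * pi) powr (-1/2) * ?g \<tau>)"
    by (rule set_integrable_mult_right) (rule inverse_Gamma_integral(1)[OF q r])
  then show "set_integrable lborel {0<..} (lev \<xi>)"
    by (rule set_integrable_cong[THEN iffD1, OF refl refl, rotated]) (use eq in auto)
  have "(LBINT \<tau>:{0<..}. lev \<xi> \<tau>) = (LBINT \<tau>:{0<..}. \<xi> * (4 * pi) powr (-1/2) * ?g \<tau>)"
    by (intro set_lebesgue_integral_cong) (auto simp: eq)
  also have "\<dots> = \<xi> * (4 * pi) powr (-1/2) * (Gamma (1/2) * (\<xi>\<^sup>2 / 4) powr (-1/2))"
    using inverse_Gamma_integral(2)[OF q r] by simp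
  also have "(\<xi>\<^sup>2 / 4) powr (-1/2) = 2 / \<xi>"
    using assms by (simp add: powr_minus_divide powr_half_sqrt real_sqrt_divide)
  also have "(4 * pi) powr (-1/2) = 1 / (2 * sqrt pi)"
    by (simp add: powr_minus_divide powr_half_sqrt real_sqrt_mult)
  also have "\<xi> * (1 / (2 * sqrt pi)) * (Gamma (1/2) * (2 / \<xi>)) = 1"
    using assms by (simp add: Gamma_one_half_real)
  finally show "(LBINT \<tau>:{0<..}. lev \<xi> \<tau>) = 1" .
qed

text \<open>The inverse moment of the Levy law, finite because exp (- \<xi>^2 / (4 \<tau>)) beats
  every power at 0. It becomes the denominator (x_N + t / \<delta>)^2 in the comparison of v_k with
  v_0.\<close>

lemma lev_over_tau_integral:
  assumes "0 < \<xi>"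
  shows "set_integrable lborel {0<..} (\<lambda>\<tau>. lev \<xi> \<tau> / \<tau>)"
    and "(LBINT \<tau>:{0<..}. lev \<xi> \<tau> / \<tau>) = 2 / \<xi>\<^sup>2"
proof -
  let ?g = "\<lambda>\<tau>. \<tau> powr (-1 - 3/2) * exp (- (\<xi>\<^sup>2 / 4) / \<tau>)"
  have eq: "lev \<xi> \<tau> / \<tau> = \<xi> * (4 * pi) powr (-1/2) * ?g \<tau>" if "\<tau> > 0" for \<tau>
  proof -
    have "\<tau> powr (-1 - 3/2) = \<tau> powr (-1 + -3/2)" by simp
    also have "\<dots> = \<tau> powr (-3/2) / \<tau>" using that by (subst powr_add) (simp add: powr_minus_divide)
    finally show ?thesis using that by (simp add: lev_eq)
  qed
  have r: "0 < \<xi>\<^sup>2 / 4" using assms by simp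
  have q: "(0::real) < 3/2" by simp
  have "set_integrable lborel {0<..} (\<lambda>\<tau>. \<xi> * (4 * pi) powr (-1/2) * ?g \<tau>)"
    by (rule set_integrable_mult_right) (rule inverse_Gamma_integral(1)[OF q r])
  then show "set_integrable lborel {0<..} (\<lambda>\<tau>. lev \<xi> \<tau> / \<tau>)"
    by (rule set_integrable_cong[THEN iffD1, OF refl refl, rotated]) (use eq in auto)
  have "(LBINT \<tau>:{0<..}. lev \<xi> \<tau> / \<tau>) = (LBINT \<tau>:{0<..}. \<xi> * (4 * pi) powr (-1/2) * ?g \<tau>)"
    by (intro set_lebesgue_integral_cong) (auto simp: eq)
  also have "\<dots> = \<xi> * (4 * pi) powr (-1/2) * (Gamma (3/2) * (\<xi>\<^sup>2 / 4) powr (-3/2))"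
    using inverse_Gamma_integral(2)[OF q r] by simp
  also have "(\<xi>\<^sup>2 / 4) powr (-3/2) = 8 / \<xi> ^ 3"
  proof -
    have "\<xi>\<^sup>2 / 4 = (\<xi> / 2) powr 2" using assms by (simp add: powr_numeral power_divide)
    then have "(\<xi>\<^sup>2 / 4) powr (-3/2) = (\<xi> / 2) powr (- 3)" by (simp add: powr_powr)
    also have "\<dots> = 8 / \<xi> ^ 3" using assms by (simp add: powr_minus_divide powr_numeral power_divide)
    finally show ?thesis .
  qed
  also have "(4 * pi) powr (-1/2) = 1 / (2 * sqrt pi)"
    by (simp add: powr_minus_divide powr_half_sqrt real_sqrt_mult)
  also have "Gamma (3/2 :: real) = sqrt pi / 2"
    using Gamma_plus1[of "1/2::real"] nonpos_Ints_nonpos[of "1/2::real"] by (auto simp: Gamma_one_half_real)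
  also have "\<xi> * (1 / (2 * sqrt pi)) * (sqrt pi / 2 * (8 / \<xi> ^ 3)) = 2 / \<xi>\<^sup>2"
    using assms by (simp add: field_simps power2_eq_square power3_eq_cube)
  finally show "(LBINT \<tau>:{0<..}. lev \<xi> \<tau> / \<tau>) = 2 / \<xi>\<^sup>2" .
qed

lemma Phi_eq: "Phi \<delta> k x y t = (LBINT \<tau>:{0<..}.
    heat_kernel CARD('n) (fst x - fst y :: real^'n) (k / \<delta> * t + \<tau>) * lev (snd x + snd y + t / \<delta>) \<tau>)"
  unfolding Phi_def dGamma1_eq_lev
  by (subst set_integral_mult_right[symmetric]) (simp add: mult.commute mult.left_commute)

text \<open>The product of heat kernel and Levy density is a multiple of
  \<open>\<tau> powr (-1 - q) * exp (- r / \<tau>)\<close> with q = N/2 and r = |(z, \<xi>)|^2 / 4,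
  so the inverse Gamma integral yields both the factor Gamma (N/2) and the power -N of the
  norm.\<close>

lemma poisson_eq:
  fixes z :: "real^'n"
  assumes "0 < \<xi>"
  shows "poisson (z, \<xi>) = (LBINT \<tau>:{0<..}. heat_kernel CARD('n) z \<tau> * lev \<xi> \<tau>)"
proof -
  define q where "q = (real CARD('n) + 1) / 2"
  define r where "r = ((norm z)\<^sup>2 + \<xi>\<^sup>2) / 4"
  let ?g = "\<lambda>\<tau>. \<tau> powr (-1 - q) * exp (- r / \<tau>)"
  have q: "0 < q" by (simp add: q_def)
  have r: "0 < r" using assms by (simp add: r_def add_nonneg_pos)
  have eq: "heat_kernel CARD('n) z \<tau> * lev \<xi> \<tau> = \<xi> * (4 * pi) powr (-q) * ?g \<tau>" if "\<tau> > 0" for \<tau>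
  proof -
    have "(4 * pi) powr (-q) = (4 * pi) powr (- (real CARD('n) / 2) + -1/2)"
      by (rule arg_cong[where f="\<lambda>u. (4 * pi) powr u"]) (simp add: q_def field_simps)
    then have 1: "(4 * pi) powr (-q) = (4 * pi) powr (- (real CARD('n) / 2)) * (4 * pi) powr (-1/2)"
      by (simp only: powr_add)
    have "\<tau> powr (-1 - q) = \<tau> powr (- (real CARD('n) / 2) + -3/2)"
      by (rule arg_cong[where f="\<lambda>u. \<tau> powr u"]) (simp add: q_def field_simps)
    then have 2: "\<tau> powr (-1 - q) = \<tau> powr (- (real CARD('n) / 2)) * \<tau> powr (-3/2)"
      by (simp only: powr_add)
    have 3: "exp (- r / \<tau>) = exp (- (norm z)\<^sup>2 / (4 * \<tau>)) * exp (- \<xi>\<^sup>2 / (4 * \<tau>))"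
      by (simp add: exp_add[symmetric] r_def add_divide_distrib diff_divide_distrib add.commute)
    show ?thesis
      unfolding 1 2 3 using that by (simp add: heat_kernel_def lev_eq powr_mult)
  qed
  have "(LBINT \<tau>:{0<..}. heat_kernel CARD('n) z \<tau> * lev \<xi> \<tau>)
      = (LBINT \<tau>:{0<..}. \<xi> * (4 * pi) powr (-q) * ?g \<tau>)"
    by (intro set_lebesgue_integral_cong) (auto simp: eq)
  also have "\<dots> = \<xi> * (4 * pi) powr (-q) * (Gamma q * r powr (- q))"
    using inverse_Gamma_integral(2)[OF q r] by simp
  also have "\<dots> = \<xi> * Gamma q * (4 * pi * r) powr (- q)"
    using r by (simp add: powr_mult)
  also have "4 * pi * r = pi * (norm (z, \<xi>))\<^sup>2"
    by (simp add: r_def norm_Pair)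
  also have "(pi * (norm (z, \<xi>))\<^sup>2) powr (- q) = pi powr (-q) * ((norm (z, \<xi>))\<^sup>2) powr (-q)"
    by (simp add: powr_mult)
  also have "((norm (z, \<xi>))\<^sup>2) powr (-q) = 1 / norm (z, \<xi>) powr (2 * q)"
  proof -
    have "norm (z, \<xi>) > 0" using assms by (simp add: zero_prod_def)
    then have "(norm (z, \<xi>))\<^sup>2 = norm (z, \<xi>) powr 2" by (simp add: powr_numeral)
    then have "((norm (z, \<xi>))\<^sup>2) powr (-q) = (norm (z, \<xi>) powr 2) powr (-q)" by (simp only:)
    also have "\<dots> = norm (z, \<xi>) powr - (2 * q)" by (simp only: powr_powr) simp
    finally show ?thesis by (simp add: powr_minus_divide)
  qed
  finally have *: "(LBINT \<tau>:{0<..}. heat_kernel CARD('n) z \<tau> * lev \<xi> \<tau>)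
      = \<xi> * Gamma q * (pi powr - q * (1 / norm (z, \<xi>) powr (2 * q)))" .
  have N: "real (CARD('n) + 1) = 2 * q" by (simp add: q_def)
  show ?thesis
    unfolding * poisson_def Let_def N by simp
qed

text \<open>Makes the limit v_0 an instance of \<open>vk\<close>, so that a single rate estimate for
  \<kappa> \<ge> 0 serves both limits.\<close>

lemma v0_eq_vk:
  assumes "0 < \<delta>" "0 \<le> snd x" "0 < t"
  shows "v0 \<delta> \<psi> x t = vk \<delta> 0 \<psi> x t"
  using assms by (simp add: v0_def vk_def Phi_eq poisson_eq add_nonneg_pos)

text \<open>Since \<open>lev\<close> is minus twice the \<xi>-derivative of the one-dimensional heat
  kernel, integrating out the normal variable leaves twice that kernel at a, which is at most
  \<open>s powr (-1/2)\<close>.\<close>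

lemma nn_integral_lev_shift:
  assumes "0 \<le> a" "0 < s"
  shows "(\<integral>\<^sup>+y. ennreal (lev (a + y) s) * indicator {0..} y \<partial>lborel) \<le> ennreal (s powr (-1/2))"
proof -
  have "(\<integral>\<^sup>+y. ennreal (lev (a + y) s) * indicator {0..} y \<partial>lborel)
      = ennreal (0 - (- 2 * heat_kernel 1 (a + 0) s))"
  proof (rule nn_integral_FTC_atLeast)
    fix y :: real assume "0 \<le> y"
    show "((\<lambda>y. - 2 * heat_kernel 1 (a + y) s) has_real_derivative lev (a + y) s) (at y)"
      using DERIV_shift[of "\<lambda>z. heat_kernel 1 z s" "- lev (a + y) s / 2" y a]
        heat_kernel_1_deriv[of s "a + y"]
      by (auto intro!: derivative_eq_intros simp: add.commute)
    show "0 \<le> lev (a + y) s" using assms \<open>0 \<le> y\<close> by (intro lev_nonneg) auto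
  next
    have "filterlim (\<lambda>y. (a + y)\<^sup>2 / (4 * s)) at_top at_top"
      using assms by real_asymp
    then have "((\<lambda>y. exp (- ((a + y)\<^sup>2 / (4 * s)))) \<longlongrightarrow> 0) at_top"
      by (intro filterlim_compose[OF exp_at_bot] filterlim_compose[OF filterlim_uminus_at_bot_at_top])
    then have "((\<lambda>y. - 2 * ((4 * pi * s) powr - (real 1 / 2) * exp (- ((a + y)\<^sup>2 / (4 * s))))) \<longlongrightarrow> - 2 * ((4 * pi * s) powr - (real 1 / 2) * 0)) at_top"
      by (intro tendsto_mult tendsto_const)
    then show "((\<lambda>y. - 2 * heat_kernel 1 (a + y) s) \<longlongrightarrow> 0) at_top"
      by (simp add: heat_kernel_def)
  qed measurable
  also have "\<dots> \<le> ennreal (s powr (-1/2))"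
  proof (intro ennreal_leI)
    have "2 * (4 * pi * s) powr (-1/2) \<le> s powr (-1/2)"
    proof -
      have "(4 * pi) powr (-1/2) = 1 / (2 * sqrt pi)"
        by (simp add: powr_minus_divide powr_half_sqrt real_sqrt_mult)
      moreover have "1 / sqrt pi \<le> 1" using pi_gt3 by simp
      ultimately have "2 * (4 * pi) powr (-1/2) \<le> 1" by simp
      from mult_right_mono[OF this, of "s powr (-1/2)"] show ?thesis
        using assms by (simp add: powr_mult)
    qed
    moreover have "heat_kernel 1 a s \<le> (4 * pi * s) powr (-1/2)"
      using assms by (simp add: heat_kernel_def mult_left_le)
    ultimately show "0 - (- 2 * heat_kernel 1 (a + 0) s) \<le> s powr (-1/2)" by simp
  qed
  finally show ?thesis .
qed

lemma nn_integral_powr_minus_half: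
  assumes "0 \<le> T"
  shows "(\<integral>\<^sup>+s. ennreal (s powr (-1/2)) * indicator {0..T} s \<partial>lborel) = ennreal (2 * sqrt T)"
  using nn_integral_has_integral_lebesgue'[OF _ has_integral_powr_from_0[of "-1/2" T]] assms
  by (simp add: powr_half_sqrt mult.commute)

lemma nn_integral_powr_tail:
  assumes "0 < T"
  shows "(\<integral>\<^sup>+s. ennreal (s powr (-3/2)) * indicator {T..} s \<partial>lborel) = ennreal (2 / sqrt T)"
  using nn_integral_has_integral_lebesgue'[OF _ has_integral_powr_to_inf[of "-3/2" T]] assms
  by (simp add: powr_half_sqrt powr_minus_divide mult.commute)

section \<open>Rates of convergence\<close>

abbreviation "lborel2 \<equiv> lborel \<Otimes>\<^sub>M lborel"

interpretation lborel_pair: pair_sigma_finite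
  "lborel :: 'a::euclidean_space measure" "lborel :: 'b::euclidean_space measure" ..

lemma integrable_kernelI:
  fixes f :: "'a::euclidean_space \<Rightarrow> 'b::euclidean_space \<Rightarrow> real"
  assumes [measurable]: "(\<lambda>(y, s). f y s) \<in> borel_measurable lborel2"
    and B: "(\<integral>\<^sup>+s. (\<integral>\<^sup>+y. \<bar>f y s\<bar> \<partial>lborel) \<partial>lborel) \<le> ennreal B"
  shows "integrable lborel2 (\<lambda>(y, s). f y s)"
proof (rule integrableI_bounded)
  have "(\<integral>\<^sup>+z. ennreal (norm (case z of (y, s) \<Rightarrow> f y s)) \<partial>lborel2)
      = (\<integral>\<^sup>+s. (\<integral>\<^sup>+y. \<bar>f y s\<bar> \<partial>lborel) \<partial>lborel)"
    by (subst lborel_pair.nn_integral_snd[symmetric]) auto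
  then show "(\<integral>\<^sup>+z. ennreal (norm (case z of (y, s) \<Rightarrow> f y s)) \<partial>lborel2) < \<infinity>"
    using B by (simp add: le_less_trans)
qed measurable

text \<open>The norm of the kernel is computed with y inside, where heat kernels have mass one,
  whereas the quantity to be bounded has s inside. Tonelli's theorem for the absolute value
  identifies the two orders.\<close>

lemma kernel_integral_bound:
  fixes f :: "'a::euclidean_space \<Rightarrow> 'b::euclidean_space \<Rightarrow> real" and B C :: real
  assumes [measurable]: "(\<lambda>(y, s). f y s) \<in> borel_measurable lborel2" "\<psi> \<in> borel_measurable borel"
    and B: "(\<integral>\<^sup>+s. (\<integral>\<^sup>+y. \<bar>f y s\<bar> \<partial>lborel) \<partial>lborel) \<le> ennreal B" "0 \<le> B"
    and C: "\<And>y. \<bar>\<psi> y\<bar> \<le> C"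
  shows "integrable lborel (\<lambda>y. (\<integral>s. f y s \<partial>lborel) * \<psi> y)"
    and "\<bar>\<integral>y. (\<integral>s. f y s \<partial>lborel) * \<psi> y \<partial>lborel\<bar> \<le> C * B"
proof -
  have I: "integrable lborel2 (\<lambda>(y, s). f y s)"
    by (rule integrable_kernelI) fact+
  have J: "integrable lborel (\<lambda>y. \<integral>s. f y s \<partial>lborel)"
    using lborel_pair.integrable_fst'[OF I] by simp
  have C0: "0 \<le> C" using C[of undefined] by linarith
  show K: "integrable lborel (\<lambda>y. (\<integral>s. f y s \<partial>lborel) * \<psi> y)"
  proof (rule Bochner_Integration.integrable_bound)
    show "integrable lborel (\<lambda>y. (\<integral>s. f y s \<partial>lborel) * C)" using J by simp
    show "AE y in lborel. norm ((\<integral>s. f y s \<partial>lborel) * \<psi> y) \<le> norm ((\<integral>s. f y s \<partial>lborel) * C)"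
      using C C0 by (auto simp: abs_mult intro!: mult_left_mono)
  qed measurable
  have IA: "integrable lborel2 (\<lambda>z. \<bar>case z of (y, s) \<Rightarrow> f y s\<bar>)"
    using I by (rule integrable_abs)
  have "\<bar>\<integral>y. (\<integral>s. f y s \<partial>lborel) * \<psi> y \<partial>lborel\<bar> \<le> (\<integral>y. \<bar>(\<integral>s. f y s \<partial>lborel) * \<psi> y\<bar> \<partial>lborel)"
    by (rule integral_abs_bound)
  also have "\<dots> \<le> (\<integral>y. C * (\<integral>s. \<bar>f y s\<bar> \<partial>lborel) \<partial>lborel)"
  proof (rule integral_mono)
    show "integrable lborel (\<lambda>y. \<bar>(\<integral>s. f y s \<partial>lborel) * \<psi> y\<bar>)" using K by (rule integrable_abs)
    show "integrable lborel (\<lambda>y. C * (\<integral>s. \<bar>f y s\<bar> \<partial>lborel))"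
      using lborel_pair.integrable_fst'[OF IA] by simp
    fix y
    have "\<bar>(\<integral>s. f y s \<partial>lborel) * \<psi> y\<bar> \<le> (\<integral>s. \<bar>f y s\<bar> \<partial>lborel) * C"
      unfolding abs_mult by (intro mult_mono C integral_abs_bound) auto
    then show "\<bar>(\<integral>s. f y s \<partial>lborel) * \<psi> y\<bar> \<le> C * (\<integral>s. \<bar>f y s\<bar> \<partial>lborel)" by (simp add: mult.commute)
  qed
  also have "\<dots> = C * integral\<^sup>L lborel2 (\<lambda>z. \<bar>case z of (y, s) \<Rightarrow> f y s\<bar>)"
    using lborel_pair.integral_fst'[OF IA] by simp
  also have "integral\<^sup>L lborel2 (\<lambda>z. \<bar>case z of (y, s) \<Rightarrow> f y s\<bar>) \<le> B"
  proof -
    have "ennreal (integral\<^sup>L lborel2 (\<lambda>z. \<bar>case z of (y, s) \<Rightarrow> f y s\<bar>))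
        = (\<integral>\<^sup>+z. \<bar>case z of (y, s) \<Rightarrow> f y s\<bar> \<partial>lborel2)"
      using IA by (intro nn_integral_eq_integral[symmetric]) auto
    also have "\<dots> = (\<integral>\<^sup>+s. (\<integral>\<^sup>+y. \<bar>f y s\<bar> \<partial>lborel) \<partial>lborel)"
      by (subst lborel_pair.nn_integral_snd[symmetric]) auto
    finally show ?thesis using B by (metis ennreal_le_iff)
  qed
  finally show "\<bar>\<integral>y. (\<integral>s. f y s \<partial>lborel) * \<psi> y \<partial>lborel\<bar> \<le> C * B"
    using C0 by (simp add: mult_left_mono)
qed

text \<open>Here f is treated as (f - g) + g, with bounds on f - g and on g. Sections in s are
  integrable only for almost every y, so the inner integrals are added under an AE
  quantifier.\<close>

lemma kernel_integral_diff_bound: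
  fixes f g :: "'a::euclidean_space \<Rightarrow> 'b::euclidean_space \<Rightarrow> real" and B C :: real
  assumes [measurable]: "(\<lambda>(y, s). f y s) \<in> borel_measurable lborel2"
      "(\<lambda>(y, s). g y s) \<in> borel_measurable lborel2" "\<psi> \<in> borel_measurable borel"
    and A: "(\<integral>\<^sup>+s. (\<integral>\<^sup>+y. \<bar>g y s\<bar> \<partial>lborel) \<partial>lborel) \<le> ennreal A" "0 \<le> A"
    and B: "(\<integral>\<^sup>+s. (\<integral>\<^sup>+y. \<bar>f y s - g y s\<bar> \<partial>lborel) \<partial>lborel) \<le> ennreal B" "0 \<le> B"
    and C: "\<And>y. \<bar>\<psi> y\<bar> \<le> C"
  shows "\<bar>(\<integral>y. (\<integral>s. f y s \<partial>lborel) * \<psi> y \<partial>lborel) - (\<integral>y. (\<integral>s. g y s \<partial>lborel) * \<psi> y \<partial>lborel)\<bar> \<le> C * B"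
proof -
  define h where "h = (\<lambda>y s. f y s - g y s)"
  have [measurable]: "(\<lambda>(y, s). h y s) \<in> borel_measurable lborel2"
    unfolding h_def by measurable
  have Ig: "integrable lborel2 (\<lambda>(y, s). g y s)"
    by (rule integrable_kernelI) fact+
  have Ih: "integrable lborel2 (\<lambda>(y, s). h y s)"
    by (rule integrable_kernelI[where B=B]) (use B in \<open>auto simp: h_def\<close>)
  have kh: "integrable lborel (\<lambda>y. (\<integral>s. h y s \<partial>lborel) * \<psi> y)"
    "\<bar>\<integral>y. (\<integral>s. h y s \<partial>lborel) * \<psi> y \<partial>lborel\<bar> \<le> C * B"
    by (rule kernel_integral_bound[where B=B and C=C]; use B C in \<open>simp add: h_def\<close>)+
  have kg: "integrable lborel (\<lambda>y. (\<integral>s. g y s \<partial>lborel) * \<psi> y)"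
    by (rule kernel_integral_bound[where B=A and C=C]; use A C in simp)
  have "AE y in lborel. integrable lborel (g y)" "AE y in lborel. integrable lborel (h y)"
    using lborel_pair.AE_integrable_fst'[OF Ig] lborel_pair.AE_integrable_fst'[OF Ih] by simp_all
  then have "AE y in lborel. (\<integral>s. f y s \<partial>lborel) * \<psi> y = (\<integral>s. h y s \<partial>lborel) * \<psi> y + (\<integral>s. g y s \<partial>lborel) * \<psi> y"
  proof eventually_elim
    case (elim y)
    have "(\<integral>s. f y s \<partial>lborel) = (\<integral>s. h y s + g y s \<partial>lborel)" by (simp add: h_def)
    also have "\<dots> = (\<integral>s. h y s \<partial>lborel) + (\<integral>s. g y s \<partial>lborel)"
      using elim by (intro Bochner_Integration.integral_add) auto
    finally show ?case by (simp add: algebra_simps)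
  qed
  then have "(\<integral>y. (\<integral>s. f y s \<partial>lborel) * \<psi> y \<partial>lborel)
      = (\<integral>y. (\<integral>s. h y s \<partial>lborel) * \<psi> y + (\<integral>s. g y s \<partial>lborel) * \<psi> y \<partial>lborel)"
    by (intro integral_cong_AE) auto
  also have "\<dots> = (\<integral>y. (\<integral>s. h y s \<partial>lborel) * \<psi> y \<partial>lborel) + (\<integral>y. (\<integral>s. g y s \<partial>lborel) * \<psi> y \<partial>lborel)"
    using kh kg by (intro Bochner_Integration.integral_add)
  finally show ?thesis using kh by simp
qed

lemma nn_integral_heat_lev:
  fixes x :: "'a::euclidean_space"
  assumes "0 < s" "0 \<le> c"
  shows "(\<integral>\<^sup>+y. \<bar>heat_kernel DIM('a) (x - y) s * c\<bar> \<partial>lborel) = ennreal c"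
  using assms by (simp add: abs_mult ennreal_mult nn_integral_multc nn_integral_heat_kernel)

text \<open>Writing h1, h2 for the two heat kernels, the difference is c1 (h1 - h2) + h2 (c1 - c2):
  the L^1 estimate in time controls the first summand, the unit mass of h2 the second.\<close>

lemma nn_integral_product_kernel_diff:
  fixes x :: "'a::euclidean_space" and s1 s2 c1 c2 :: real
  assumes "0 < s1" "s1 \<le> s2" "0 \<le> c1"
  shows "(\<integral>\<^sup>+y. \<bar>heat_kernel DIM('a) (x - y) s1 * c1 - heat_kernel DIM('a) (x - y) s2 * c2\<bar> \<partial>lborel)
    \<le> ennreal (c1 * (2 * DIM('a) * (s2 - s1) / s2) + \<bar>c1 - c2\<bar>)"
proof -
  let ?h = "\<lambda>s y. heat_kernel DIM('a) (x - y) s"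
  have "(\<integral>\<^sup>+y. \<bar>?h s1 y * c1 - ?h s2 y * c2\<bar> \<partial>lborel)
      \<le> (\<integral>\<^sup>+y. ennreal c1 * ennreal \<bar>?h s1 y - ?h s2 y\<bar> + ennreal (?h s2 y) * ennreal \<bar>c1 - c2\<bar> \<partial>lborel)"
  proof (rule nn_integral_mono)
    fix y
    have "?h s1 y * c1 - ?h s2 y * c2 = c1 * (?h s1 y - ?h s2 y) + ?h s2 y * (c1 - c2)"
      by (simp add: algebra_simps)
    also have "\<bar>\<dots>\<bar> \<le> c1 * \<bar>?h s1 y - ?h s2 y\<bar> + ?h s2 y * \<bar>c1 - c2\<bar>"
      using abs_triangle_ineq[of "c1 * (?h s1 y - ?h s2 y)" "?h s2 y * (c1 - c2)"] assms by (simp add: abs_mult)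
    finally show "ennreal \<bar>?h s1 y * c1 - ?h s2 y * c2\<bar>
        \<le> ennreal c1 * ennreal \<bar>?h s1 y - ?h s2 y\<bar> + ennreal (?h s2 y) * ennreal \<bar>c1 - c2\<bar>"
      using assms by (simp flip: ennreal_mult ennreal_plus)
  qed
  also have "\<dots> = ennreal c1 * (\<integral>\<^sup>+y. \<bar>?h s1 y - ?h s2 y\<bar> \<partial>lborel) + ennreal \<bar>c1 - c2\<bar>"
    using assms by (simp add: nn_integral_add nn_integral_cmult nn_integral_multc nn_integral_heat_kernel)
  also have "\<dots> \<le> ennreal c1 * ennreal (2 * DIM('a) * (s2 - s1) / s2) + ennreal \<bar>c1 - c2\<bar>"
    using assms by (intro add_mono mult_left_mono heat_kernel_L1_diff) auto
  also have "\<dots> = ennreal (c1 * (2 * DIM('a) * (s2 - s1) / s2) + \<bar>c1 - c2\<bar>)"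
    using assms by (simp flip: ennreal_mult ennreal_plus)
  finally show ?thesis .
qed

lemma nn_integral_lev:
  assumes "0 < \<xi>"
  shows "(\<integral>\<^sup>+s. ennreal (lev \<xi> s) * indicator {0<..} s \<partial>lborel) = 1"
proof -
  have "(\<integral>\<^sup>+s. ennreal (lev \<xi> s) * indicator {0<..} s \<partial>lborel) = (\<integral>\<^sup>+s. ennreal (indicator {0<..} s *\<^sub>R lev \<xi> s) \<partial>lborel)"
    by (intro nn_integral_cong) (auto split: split_indicator)
  also have "\<dots> = ennreal (LBINT s:{0<..}. lev \<xi> s)"
    using lev_integral[OF assms] assms unfolding set_lebesgue_integral_def set_integrable_def
    by (intro nn_integral_eq_integral) (auto simp: lev_nonneg split: split_indicator)
  finally show ?thesis using lev_integral[OF assms] by simp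
qed

text \<open>The integrand of H after the substitution \<open>\<tau> = t - \<epsilon> s\<close>.\<close>

abbreviation rescaled_kernel :: "real \<Rightarrow> real \<Rightarrow> real \<Rightarrow> real \<Rightarrow> real^'n \<Rightarrow> real \<Rightarrow> real \<Rightarrow> real" where
  "rescaled_kernel \<epsilon> \<delta> \<kappa> t z \<xi> s \<equiv> heat_kernel CARD('n) z (s + \<kappa> / \<delta> * (t - \<epsilon> * s)) * lev (\<xi> + (t - \<epsilon> * s) / \<delta>) s"

section \<open>The boundary part of the solution\<close>

lemma Hker_rescaled:
  fixes x y :: "(real^'n) \<times> real"
  assumes "0 < \<epsilon>" "0 \<le> t"
  shows "Hker \<epsilon> \<delta> \<kappa> x y t = \<epsilon> * (\<integral>s. indicator {0<..<t / \<epsilon>} s *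
    (rescaled_kernel \<epsilon> \<delta> \<kappa> t (fst x - fst y) (snd x + snd y) s) \<partial>lborel)"
proof -
  define F where "F \<tau> = heat_kernel CARD('n) (fst x - fst y) ((t - \<tau>) / \<epsilon> + \<kappa> / \<delta> * \<tau>)
      * dGamma1 (snd x + snd y + \<tau> / \<delta>) ((t - \<tau>) / \<epsilon>)" for \<tau>
  have "Hker \<epsilon> \<delta> \<kappa> x y t = - 2 * (LBINT \<tau>:{0<..<t}. F \<tau>)"
    using assms unfolding Hker_def F_def[symmetric] by (simp add: interval_integral_Ioo zero_ereal_def)
  \<comment> \<open>This Jacobian \<epsilon> fixes the orders of magnitude: in the boundary integral
    it cancels against the weights \<delta> / \<epsilon> and 1 / \<delta>, in the interior integral
    it leaves the small factor \<epsilon> / \<delta>.\<close>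
  also have "\<dots> = - 2 * (\<epsilon> * (\<integral>s. indicator {0<..<t} (t - \<epsilon> * s) * F (t - \<epsilon> * s) \<partial>lborel))"
    using assms unfolding set_lebesgue_integral_def
    by (subst lborel_integral_real_affine[where c="- \<epsilon>" and t=t]) auto
  also have "\<dots> = \<epsilon> * (\<integral>s. - 2 * (indicator {0<..<t} (t - \<epsilon> * s) * F (t - \<epsilon> * s)) \<partial>lborel)"
    by (subst integral_mult_right_zero) simp
  also have "(\<lambda>s. - 2 * (indicator {0<..<t} (t - \<epsilon> * s) * F (t - \<epsilon> * s))) =
    (\<lambda>s. indicator {0<..<t / \<epsilon>} s * (rescaled_kernel \<epsilon> \<delta> \<kappa> t (fst x - fst y) (snd x + snd y) s))"
  proof
    fix s
    have "indicator {0<..<t} (t - \<epsilon> * s) = (indicator {0<..<t / \<epsilon>} s :: real)"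
      using assms by (auto simp: pos_less_divide_eq mult.commute zero_less_mult_iff split: split_indicator)
    moreover have "(t - (t - \<epsilon> * s)) / \<epsilon> = s" using assms by simp
    ultimately show "- 2 * (indicator {0<..<t} (t - \<epsilon> * s) * F (t - \<epsilon> * s)) = indicator {0<..<t / \<epsilon>} s * (rescaled_kernel \<epsilon> \<delta> \<kappa> t (fst x - fst y) (snd x + snd y) s)"
      by (simp add: F_def dGamma1_eq_lev)
  qed
  finally show ?thesis .
qed

text \<open>The terms are three separate errors, with T = t / \<epsilon>. \<open>A\<close> pays for
  the heat time, displaced by (\<kappa> / \<delta>) \<epsilon> s and hence relatively by at most
  (\<kappa> / \<delta>) \<epsilon>; the middle term for the distance, displaced by \<epsilon> s /
  \<delta>; the last for the mass of the limit beyond s = T.\<close>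

lemma boundary_term_bound:
  fixes x' :: "real^'n" and \<epsilon> \<delta> \<kappa> t \<xi> C :: real
  assumes "0 < \<epsilon>" "0 < \<delta>" "0 \<le> \<kappa>" "0 < t" "0 \<le> \<xi>"
    and [measurable]: "\<psi> \<in> borel_measurable borel" and C: "\<And>y. \<bar>\<psi> y\<bar> \<le> C"
  defines "A \<equiv> 2 * CARD('n) * (\<kappa> / \<delta>) * \<epsilon>"
  shows "\<bar>(\<integral>y. (\<integral>s. indicator {0<..<t / \<epsilon>} s *
      (rescaled_kernel \<epsilon> \<delta> \<kappa> t (x' - y) \<xi> s) \<partial>lborel) * \<psi> y \<partial>lborel)
    - (\<integral>y. (\<integral>s. indicator {0<..} s *
      (heat_kernel CARD('n) (x' - y) (\<kappa> / \<delta> * t + s) * lev (\<xi> + t / \<delta>) s) \<partial>lborel) * \<psi> y \<partial>lborel)\<bar>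
    \<le> C * (A + (1 + A) * (\<epsilon> / \<delta>) * (2 * sqrt (t / \<epsilon>)) + (\<xi> + t / \<delta>) * (2 / sqrt (t / \<epsilon>)))"
proof -
  define T where "T = t / \<epsilon>"
  define \<xi>0 where "\<xi>0 = \<xi> + t / \<delta>"
  define f where "f y s = indicator {0<..<T} s *
      (rescaled_kernel \<epsilon> \<delta> \<kappa> t (x' - y) \<xi> s)" for y s
  define g where "g y s = indicator {0<..} s * (heat_kernel CARD('n) (x' - y) (\<kappa> / \<delta> * t + s) * lev \<xi>0 s)" for y s
  have T: "0 < T" using assms by (simp add: T_def)
  have \<xi>0: "0 < \<xi>0" using assms by (simp add: \<xi>0_def add_nonneg_pos)
  have A: "0 \<le> A" using assms by (simp add: A_def)
  have DIM: "DIM(real^'n) = CARD('n)" by simp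
  have k0: "0 < \<kappa> / \<delta> * t + s" if "0 < s" for s using that assms by (simp add: add_nonneg_pos)
  have [measurable]: "(\<lambda>(y, s). f y s) \<in> borel_measurable lborel2"
    "(\<lambda>(y, s). g y s) \<in> borel_measurable lborel2"
    unfolding f_def g_def by measurable
  have g: "(\<integral>\<^sup>+s. (\<integral>\<^sup>+y. \<bar>g y s\<bar> \<partial>lborel) \<partial>lborel) \<le> ennreal 1"
  proof -
    have "(\<integral>\<^sup>+y. \<bar>g y s\<bar> \<partial>lborel) = ennreal (lev \<xi>0 s) * indicator {0<..} s" for s
      using nn_integral_heat_lev[OF k0, of s "lev \<xi>0 s" x'] \<xi>0 k0
      by (auto simp: g_def lev_nonneg split: split_indicator)
    then show ?thesis using nn_integral_lev[OF \<xi>0] by simp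
  qed
  \<comment> \<open>For 0 < s < T only the first two terms are used. For s \<ge> T only the third
    is: there f vanishes and g has to be estimated alone.\<close>
  have pt: "(\<integral>\<^sup>+y. \<bar>f y s - g y s\<bar> \<partial>lborel)
      \<le> ennreal A * (ennreal (lev \<xi>0 s) * indicator {0<..} s)
       + ennreal ((1 + A) * (\<epsilon> / \<delta>)) * (ennreal (s powr (-1/2)) * indicator {0..T} s)
       + ennreal \<xi>0 * (ennreal (s powr (-3/2)) * indicator {T..} s)" for s
  proof -
    consider "s \<le> 0" | "0 < s" "s < T" | "T \<le> s" by linarith
    then show ?thesis
    proof cases
      case 1 then show ?thesis by (simp add: f_def g_def)
    next
      case 3
      then have s: "0 < s" using T by linarith
      have "(\<integral>\<^sup>+y. \<bar>f y s - g y s\<bar> \<partial>lborel) = ennreal (lev \<xi>0 s)"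
        using nn_integral_heat_lev[OF k0[OF s], of "lev \<xi>0 s" x'] 3 s \<xi>0
        by (simp add: f_def g_def lev_nonneg)
      also have "\<dots> \<le> ennreal (\<xi>0 * s powr (-3/2))"
        using s \<xi>0 by (intro ennreal_leI lev_le) auto
      also have "\<dots> = ennreal \<xi>0 * (ennreal (s powr (-3/2)) * indicator {T..} s)"
        using 3 \<xi>0 by (simp add: ennreal_mult)
      finally show ?thesis by (rule order_trans) simp
    next
      case 2
      define \<xi>s where "\<xi>s = \<xi> + (t - \<epsilon> * s) / \<delta>"
      have es: "\<epsilon> * s \<le> t" using 2 assms by (simp add: T_def field_simps)
      have \<xi>s: "0 \<le> \<xi>s" using assms es by (simp add: \<xi>s_def)
      define s1 where "s1 = s + \<kappa> / \<delta> * (t - \<epsilon> * s)"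
      define s2 where "s2 = \<kappa> / \<delta> * t + s"
      have s1: "0 < s1" using 2 es assms by (simp add: s1_def add_pos_nonneg)
      have s12: "s2 - s1 = \<kappa> / \<delta> * \<epsilon> * s" by (simp add: s1_def s2_def algebra_simps)
      have ss: "s \<le> s2" "s1 \<le> s2" using assms 2 s12
        by (simp_all add: s2_def) (smt (verit, best) divide_nonneg_nonneg mult_nonneg_nonneg)
      have d: "\<bar>lev \<xi>s s - lev \<xi>0 s\<bar> \<le> \<epsilon> / \<delta> * s powr (-1/2)"
      proof -
        have "\<bar>\<xi>s - \<xi>0\<bar> = \<epsilon> / \<delta> * s" using assms 2 by (simp add: \<xi>s_def \<xi>0_def diff_divide_distrib)
        moreover have "s * s powr (-3/2) = s powr (-1/2)"
          using 2 powr_add[of s 1 "-3/2"] by simp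
        ultimately show ?thesis using lev_diff_le[of s \<xi>s \<xi>0] 2 by (simp add: mult.assoc)
      qed
      have "2 * CARD('n) * (s2 - s1) / s2 = A * (s / s2)" by (simp add: s12 A_def)
      also have "\<dots> \<le> A * 1" using ss 2 A by (intro mult_left_mono) auto
      finally have r: "2 * CARD('n) * (s2 - s1) / s2 \<le> A" by simp
      have "(\<integral>\<^sup>+y. \<bar>f y s - g y s\<bar> \<partial>lborel)
          \<le> ennreal (lev \<xi>s s * (2 * CARD('n) * (s2 - s1) / s2) + \<bar>lev \<xi>s s - lev \<xi>0 s\<bar>)"
        using nn_integral_product_kernel_diff[of s1 s2 "lev \<xi>s s" x' "lev \<xi>0 s"] s1 ss 2 \<xi>s
        by (simp add: f_def g_def lev_nonneg s1_def s2_def \<xi>s_def)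
      also have "lev \<xi>s s * (2 * CARD('n) * (s2 - s1) / s2) \<le> lev \<xi>s s * A"
        using r \<xi>s 2 by (intro mult_left_mono) (auto simp: lev_nonneg)
      \<comment> \<open>As \<xi>s varies with s, \<open>lev \<xi>s s\<close> is not a probability
        density in s. It is exchanged for \<open>lev \<xi>0 s\<close>, whose integral is 1, at the
        price of the factor 1 + A.\<close>
      also have "lev \<xi>s s * A \<le> (lev \<xi>0 s + \<epsilon> / \<delta> * s powr (-1/2)) * A"
        using d A by (intro mult_right_mono) auto
      also note d
      also have "(lev \<xi>0 s + \<epsilon> / \<delta> * s powr (-1/2)) * A + \<epsilon> / \<delta> * s powr (-1/2)
          = A * lev \<xi>0 s + (1 + A) * (\<epsilon> / \<delta>) * s powr (-1/2)" by (simp add: algebra_simps add_divide_distrib)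
      also have "ennreal \<dots> = ennreal A * (ennreal (lev \<xi>0 s) * indicator {0<..} s)
         + ennreal ((1 + A) * (\<epsilon> / \<delta>)) * (ennreal (s powr (-1/2)) * indicator {0..T} s)"
      proof -
        have "0 \<le> (1 + A) * (\<epsilon> / \<delta>)" "0 \<le> lev \<xi>0 s"
          using A assms(1,2) \<xi>0 2 by (auto simp: lev_nonneg)
        then show ?thesis using 2 A by (simp del: times_divide_eq_right flip: ennreal_mult ennreal_plus)
      qed
      finally show ?thesis using 2 by (simp add: ennreal_leI)
    qed
  qed
  have "(\<integral>\<^sup>+s. (\<integral>\<^sup>+y. \<bar>f y s - g y s\<bar> \<partial>lborel) \<partial>lborel)
      \<le> (\<integral>\<^sup>+s. ennreal A * (ennreal (lev \<xi>0 s) * indicator {0<..} s)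
       + ennreal ((1 + A) * (\<epsilon> / \<delta>)) * (ennreal (s powr (-1/2)) * indicator {0..T} s)
       + ennreal \<xi>0 * (ennreal (s powr (-3/2)) * indicator {T..} s) \<partial>lborel)"
    by (rule nn_integral_mono) (rule pt)
  also have "\<dots> = ennreal A * 1 + ennreal ((1 + A) * (\<epsilon> / \<delta>)) * ennreal (2 * sqrt T) + ennreal \<xi>0 * ennreal (2 / sqrt T)"
    unfolding nn_integral_lev[OF \<xi>0, symmetric] nn_integral_powr_minus_half[OF less_imp_le[OF T], symmetric]
      nn_integral_powr_tail[OF T, symmetric]
    by (simp add: nn_integral_add nn_integral_cmult)
  also have "\<dots> = ennreal (A + (1 + A) * (\<epsilon> / \<delta>) * (2 * sqrt T) + \<xi>0 * (2 / sqrt T))"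
    using A \<xi>0 T assms by (simp flip: ennreal_mult ennreal_plus)
  finally have B: "(\<integral>\<^sup>+s. (\<integral>\<^sup>+y. \<bar>f y s - g y s\<bar> \<partial>lborel) \<partial>lborel)
     \<le> ennreal (A + (1 + A) * (\<epsilon> / \<delta>) * (2 * sqrt T) + \<xi>0 * (2 / sqrt T))" .
  have "\<bar>(\<integral>y. (\<integral>s. f y s \<partial>lborel) * \<psi> y \<partial>lborel) - (\<integral>y. (\<integral>s. g y s \<partial>lborel) * \<psi> y \<partial>lborel)\<bar>
      \<le> C * (A + (1 + A) * (\<epsilon> / \<delta>) * (2 * sqrt T) + \<xi>0 * (2 / sqrt T))"
    using A \<xi>0 T assms by (intro kernel_integral_diff_bound[OF _ _ _ g _ B]) auto
  then show ?thesis unfolding f_def g_def T_def \<xi>0_def .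
qed

section \<open>The interior part of the solution\<close>

lemma nn_integral_lborel_Times:
  fixes f :: "'a::euclidean_space \<Rightarrow> ennreal" and g :: "'b::euclidean_space \<Rightarrow> ennreal"
  assumes [measurable]: "f \<in> borel_measurable borel" "g \<in> borel_measurable borel"
  shows "(\<integral>\<^sup>+y. f (fst y) * g (snd y) \<partial>lborel) = (\<integral>\<^sup>+a. f a \<partial>lborel) * (\<integral>\<^sup>+b. g b \<partial>lborel)"
  unfolding lborel_prod[symmetric]
  by (subst lborel_pair.nn_integral_snd[symmetric]) (simp_all add: nn_integral_multc nn_integral_cmult)

lemma heat_kernel_Pair:
  fixes a :: "real^'n" and b :: real
  assumes "0 < s"
  shows "heat_kernel (CARD('n) + 1) (a, b) s = heat_kernel CARD('n) a s * heat_kernel 1 b s"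
proof -
  have "(4 * pi * s) powr - (real (CARD('n) + 1) / 2) = (4 * pi * s) powr - (real CARD('n) / 2) * (4 * pi * s) powr - (real 1 / 2)"
    unfolding powr_add[symmetric] by (rule arg_cong[where f="\<lambda>u. (4 * pi * s) powr u"]) (simp add: field_simps)
  moreover have "exp (- (norm (a, b))\<^sup>2 / (4 * s)) = exp (- (norm a)\<^sup>2 / (4 * s)) * exp (- (norm b)\<^sup>2 / (4 * s))"
    by (simp add: exp_add[symmetric] norm_Pair add_divide_distrib diff_divide_distrib)
  ultimately show ?thesis by (simp add: heat_kernel_def)
qed

lemma G0_eq:
  fixes x y :: "(real^'n) \<times> real"
  assumes "0 < s"
  shows "G0 x y s = heat_kernel CARD('n) (fst x - fst y) s * (heat_kernel 1 (snd x - snd y) s - heat_kernel 1 (snd x + snd y) s)"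
  using assms heat_kernel_Pair[OF assms, of "fst x - fst y" "snd x - snd y"]
    heat_kernel_Pair[OF assms, of "fst x - fst y" "snd x + snd y"]
  by (simp add: G0_def reflect_def minus_prod_def algebra_simps)

text \<open>The difference is nonnegative for y > 0. Changes of variable turn its integral into the
  Gaussian mass below \<xi> minus that below -\<xi>, so what remains is the mass of an interval of
  length 2 \<xi> on which the kernel is at most \<open>s powr (-1/2)\<close>.\<close>

lemma nn_integral_reflected_heat_kernel_diff:
  fixes \<xi> :: real
  assumes "0 \<le> \<xi>" "0 < s"
  shows "(\<integral>\<^sup>+y. indicator {0<..} y * ennreal \<bar>heat_kernel 1 (\<xi> - y) s - heat_kernel 1 (\<xi> + y) s\<bar> \<partial>lborel)
    \<le> ennreal (2 * \<xi> * s powr (-1/2))"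
proof -
  let ?h = "\<lambda>u::real. heat_kernel 1 u s"
  have I: "integrable lborel ?h"
    using integral_heat_kernel(1)[OF assms(2), where 'a=real, of 0] by simp
  have nonneg: "0 \<le> ?h (\<xi> - y) - ?h (\<xi> + y)" if "0 < y" for y
  proof -
    have "(norm (\<xi> - y))\<^sup>2 \<le> (norm (\<xi> + y))\<^sup>2"
      using that assms by (simp add: power2_eq_square algebra_simps)
    then show ?thesis using assms by (simp add: heat_kernel_def divide_right_mono mult_left_mono)
  qed
  have e1: "(\<integral>y. indicator {0<..} y * ?h (\<xi> - y) \<partial>lborel) = (\<integral>u. indicator {..<\<xi>} u * ?h u \<partial>lborel)"
    using lborel_integral_real_affine[of "-1" "\<lambda>u. indicator {..<\<xi>} u * ?h u" \<xi>]
    by (auto intro!: Bochner_Integration.integral_cong split: split_indicator)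
  have e2: "(\<integral>y. indicator {0<..} y * ?h (\<xi> + y) \<partial>lborel) = (\<integral>u. indicator {..<-\<xi>} u * ?h u \<partial>lborel)"
  proof -
    have "(\<integral>u. indicator {..<-\<xi>} u * ?h u \<partial>lborel) = (\<integral>y. indicator {..<-\<xi>} (- \<xi> - y) * ?h (- (\<xi> + y)) \<partial>lborel)"
      using lborel_integral_real_affine[of "-1" "\<lambda>u. indicator {..<-\<xi>} u * ?h u" "-\<xi>"] by simp
    also have "\<dots> = (\<integral>y. indicator {0<..} y * ?h (\<xi> + y) \<partial>lborel)"
      unfolding heat_kernel_minus by (intro Bochner_Integration.integral_cong) (auto split: split_indicator)
    finally show ?thesis by simp
  qed
  have J: "integrable lborel (\<lambda>u. indicator A u * ?h u)" if "A \<in> sets borel" for A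
    using integrable_mult_indicator[OF _ I, of A] that by simp
  have K: "integrable lborel (\<lambda>y. indicator {0<..} y * ?h (\<xi> - y))" "integrable lborel (\<lambda>y. indicator {0<..} y * ?h (\<xi> + y))"
    using integrable_mult_indicator[OF _ integral_heat_kernel(1)[OF assms(2), where 'a=real, of \<xi>], of "{0<..}"]
      integrable_mult_indicator[OF _ lborel_integrable_real_affine[OF I, of 1 \<xi>], of "{0<..}"] by simp_all
  have "(\<integral>\<^sup>+y. indicator {0<..} y * ennreal \<bar>?h (\<xi> - y) - ?h (\<xi> + y)\<bar> \<partial>lborel)
      = (\<integral>\<^sup>+y. ennreal (indicator {0<..} y * ?h (\<xi> - y) - indicator {0<..} y * ?h (\<xi> + y)) \<partial>lborel)"
    using nonneg by (intro nn_integral_cong) (auto split: split_indicator)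
  also have "\<dots> = ennreal (\<integral>y. indicator {0<..} y * ?h (\<xi> - y) - indicator {0<..} y * ?h (\<xi> + y) \<partial>lborel)"
    using K nonneg by (intro nn_integral_eq_integral) (auto split: split_indicator)
  also have "(\<integral>y. indicator {0<..} y * ?h (\<xi> - y) - indicator {0<..} y * ?h (\<xi> + y) \<partial>lborel)
      = (\<integral>u. indicator {..<\<xi>} u * ?h u - indicator {..<-\<xi>} u * ?h u \<partial>lborel)"
    unfolding Bochner_Integration.integral_diff[OF K] e1 e2
    by (rule Bochner_Integration.integral_diff[symmetric]; rule J) auto
  also have "\<dots> \<le> (\<integral>u. indicator {-\<xi>..\<xi>} u * s powr (-1/2) \<partial>lborel)"
  proof (rule integral_mono)
    show "integrable lborel (\<lambda>u. indicator {..<\<xi>} u * ?h u - indicator {..<-\<xi>} u * ?h u)"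
      using J by simp
    show "integrable lborel (\<lambda>u. indicator {-\<xi>..\<xi>} u * s powr (-1/2))"
      using assms by (intro integrable_mult_left integrable_real_indicator) (auto simp: emeasure_lborel_Icc_eq)
    fix u
    have "?h u \<le> (4 * pi) powr (-1/2) * s powr (-1/2)"
      using assms by (simp add: heat_kernel_def powr_mult mult_left_le)
    also have "\<dots> \<le> s powr (-1/2)" using four_pi_powr_le_1 by (simp add: mult_left_le_one_le)
    finally show "indicator {..<\<xi>} u * ?h u - indicator {..<-\<xi>} u * ?h u \<le> indicator {-\<xi>..\<xi>} u * s powr (-1/2)"
      using assms by (auto split: split_indicator)
  qed
  also have "\<dots> = 2 * \<xi> * s powr (-1/2)"
    using assms by simp
  finally show ?thesis by (simp add: ennreal_leI)
qed

text \<open>The reflection acts only on the normal variable, so the tangential kernel factors out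
  with mass one. At s = t / \<epsilon> the bound is of order x_N sqrt (\<epsilon> / t), and it grows
  with x_N.\<close>

lemma nn_integral_G0:
  fixes x :: "(real^'n) \<times> real"
  assumes "0 \<le> snd x" "0 < s"
  shows "(\<integral>\<^sup>+y. ennreal \<bar>indicator Omega y * G0 x y s\<bar> \<partial>lborel) \<le> ennreal (2 * snd x * s powr (-1/2))"
proof -
  have "(\<integral>\<^sup>+y. ennreal \<bar>indicator Omega y * G0 x y s\<bar> \<partial>lborel)
      = (\<integral>\<^sup>+y. ennreal (heat_kernel CARD('n) (fst x - fst y) s) *
          (indicator {0<..} (snd y) * ennreal \<bar>heat_kernel 1 (snd x - snd y) s - heat_kernel 1 (snd x + snd y) s\<bar>) \<partial>lborel)"
    using assms by (intro nn_integral_cong)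
      (auto simp: G0_eq Omega_def abs_mult ennreal_mult split: split_indicator)
  also have "\<dots> = (\<integral>\<^sup>+a. ennreal (heat_kernel CARD('n) (fst x - a) s) \<partial>lborel) *
      (\<integral>\<^sup>+b. indicator {0<..} b * ennreal \<bar>heat_kernel 1 (snd x - b) s - heat_kernel 1 (snd x + b) s\<bar> \<partial>lborel)"
    by (rule nn_integral_lborel_Times) measurable
  also have "\<dots> \<le> 1 * ennreal (2 * snd x * s powr (-1/2))"
    using nn_integral_heat_kernel[OF assms(2), of "fst x"] assms
    by (intro mult_mono nn_integral_reflected_heat_kernel_diff) auto
  finally show ?thesis by simp
qed

text \<open>The tangential integral gives one, the normal one at most \<open>s powr (-1/2)\<close>,
  and integration over s up to t / \<epsilon> gives the square root. This grows as \<epsilon> tends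
  to 0, but the factor \<epsilon> / \<delta> in front of it leaves O(sqrt \<epsilon>).\<close>

lemma nn_integral_interior_H:
  fixes x :: "(real^'n) \<times> real"
  assumes "0 < \<epsilon>" "0 < \<delta>" "0 \<le> \<kappa>" "0 < t" "0 \<le> snd x"
  shows "(\<integral>\<^sup>+s. (\<integral>\<^sup>+y. ennreal \<bar>indicator Omega y * (indicator {0<..<t / \<epsilon>} s *
    (rescaled_kernel \<epsilon> \<delta> \<kappa> t (fst x - fst y) (snd x + snd y) s))\<bar> \<partial>lborel) \<partial>lborel)
    \<le> ennreal (2 * sqrt (t / \<epsilon>))"
proof -
  define T where "T = t / \<epsilon>"
  have T: "0 < T" using assms by (simp add: T_def)
  have "(\<integral>\<^sup>+y. ennreal \<bar>indicator Omega y * (indicator {0<..<T} s *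
    (rescaled_kernel \<epsilon> \<delta> \<kappa> t (fst x - fst y) (snd x + snd y) s))\<bar> \<partial>lborel)
    \<le> ennreal (s powr (-1/2)) * indicator {0..T} s" for s
  proof (cases "0 < s \<and> s < T")
    case True
    define r where "r = s + \<kappa> / \<delta> * (t - \<epsilon> * s)"
    define a where "a = snd x + (t - \<epsilon> * s) / \<delta>"
    have es: "\<epsilon> * s \<le> t" using True assms by (simp add: T_def field_simps)
    have r: "0 < r" using True es assms by (simp add: r_def add_pos_nonneg)
    have a: "0 \<le> a" using es assms by (simp add: a_def)
    have "(\<integral>\<^sup>+y. ennreal \<bar>indicator Omega y * (indicator {0<..<T} s * (heat_kernel CARD('n) (fst x - fst y) r * lev (snd x + snd y + (t - \<epsilon> * s) / \<delta>) s))\<bar> \<partial>lborel)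
        \<le> (\<integral>\<^sup>+y. ennreal (heat_kernel CARD('n) (fst x - fst y) r) * (ennreal (lev (a + snd y) s) * indicator {0..} (snd y)) \<partial>lborel)"
      using True a by (intro nn_integral_mono)
        (auto simp: Omega_def a_def abs_mult ennreal_mult lev_nonneg add_ac split: split_indicator)
    also have "\<dots> = (\<integral>\<^sup>+u. ennreal (heat_kernel CARD('n) (fst x - u) r) \<partial>lborel) * (\<integral>\<^sup>+b. ennreal (lev (a + b) s) * indicator {0..} b \<partial>lborel)"
      by (rule nn_integral_lborel_Times) measurable
    also have "\<dots> \<le> 1 * ennreal (s powr (-1/2))"
      using nn_integral_heat_kernel[OF r, of "fst x"] True a
      by (intro mult_mono nn_integral_lev_shift) auto
    finally show ?thesis using True by (simp add: r_def)
  qed auto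
  then have "(\<integral>\<^sup>+s. (\<integral>\<^sup>+y. ennreal \<bar>indicator Omega y * (indicator {0<..<T} s *
    (rescaled_kernel \<epsilon> \<delta> \<kappa> t (fst x - fst y) (snd x + snd y) s))\<bar> \<partial>lborel) \<partial>lborel)
    \<le> (\<integral>\<^sup>+s. ennreal (s powr (-1/2)) * indicator {0..T} s \<partial>lborel)"
    by (intro nn_integral_mono)
  also have "\<dots> = ennreal (2 * sqrt T)" using T by (intro nn_integral_powr_minus_half) simp
  finally show ?thesis by (simp add: T_def)
qed

section \<open>Borel representatives of the data and the rate in \<epsilon>\<close>

lemma borel_measurable_fst [measurable (raw)]:
  fixes f :: "'c \<Rightarrow> 'a::second_countable_topology \<times> 'b::second_countable_topology"
  shows "f \<in> borel_measurable M \<Longrightarrow> (\<lambda>x. fst (f x)) \<in> borel_measurable M"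
  by (erule measurable_compose) (intro borel_measurable_continuous_onI continuous_intros)

lemma borel_measurable_snd [measurable (raw)]:
  fixes f :: "'c \<Rightarrow> 'a::second_countable_topology \<times> 'b::second_countable_topology"
  shows "f \<in> borel_measurable M \<Longrightarrow> (\<lambda>x. snd (f x)) \<in> borel_measurable M"
  by (erule measurable_compose) (intro borel_measurable_continuous_onI continuous_intros)

lemma Omega_borel [measurable]: "(Omega :: ((real^'n) \<times> real) set) \<in> sets borel"
proof -
  have "open (Omega :: ((real^'n) \<times> real) set)"
    unfolding Omega_def by (intro open_Collect_less continuous_intros)
  then show ?thesis by simp
qed

lemma lebesgue_integral_eq_lborel_kernel:
  fixes f g K :: "'a::euclidean_space \<Rightarrow> real"
  assumes [measurable]: "f \<in> borel_measurable lebesgue" "g \<in> borel_measurable borel" "K \<in> borel_measurable borel"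
    and "AE y in lborel. f y = g y"
  shows "(LINT y|lebesgue. K y * f y) = (LINT y|lborel. K y * g y)"
proof -
  have [measurable]: "g \<in> borel_measurable lebesgue" "K \<in> borel_measurable lebesgue"
    by (auto intro: measurable_completion)
  have "AE y in lebesgue. f y = g y" using assms(4) by (rule AE_completion)
  then have "(LINT y|lebesgue. K y * f y) = (LINT y|lebesgue. K y * g y)"
    by (intro integral_cong_AE) auto
  also have "\<dots> = (LINT y|lborel. K y * g y)"
    by (intro integral_completion) simp
  finally show ?thesis .
qed

text \<open>The Fubini arguments run on \<open>lborel2\<close> with Borel data bounded at every
  point; clipping a Borel representative to [-|C|, |C|] provides both. The absolute value saves an
  argument that C is nonnegative.\<close>

lemma essentially_bounded_borel_version:
  fixes f :: "'a::euclidean_space \<Rightarrow> real"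
  assumes "f \<in> borel_measurable lebesgue" "AE y in lebesgue. \<bar>f y\<bar> \<le> C"
  obtains g where "g \<in> borel_measurable borel" "AE y in lborel. f y = g y" "\<And>y. \<bar>g y\<bar> \<le> \<bar>C\<bar>"
proof -
  obtain h where h[measurable]: "h \<in> borel_measurable lborel" and e: "AE y in lborel. f y = h y"
    using completion_ex_borel_measurable_real[OF assms(1)] by auto
  have "AE y in lborel. \<bar>f y\<bar> \<le> C" using assms(2) by (simp add: AE_completion_iff)
  then have "AE y in lborel. f y = max (- \<bar>C\<bar>) (min \<bar>C\<bar> (h y))"
    using e by eventually_elim auto
  then show ?thesis by (intro that[of "\<lambda>y. max (- \<bar>C\<bar>) (min \<bar>C\<bar> (h y))"]) auto
qed

lemma vk_eq_lborel:
  fixes x :: "(real^'n) \<times> real"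
  assumes [measurable]: "\<psi> \<in> borel_measurable lebesgue" "g \<in> borel_measurable borel" and "AE y in lborel. \<psi> y = g y"
  shows "vk \<delta> k \<psi> x t = (\<integral>y. (\<integral>s. indicator {0<..} s *
      (heat_kernel CARD('n) (fst x - y) (k / \<delta> * t + s) * lev (snd x + t / \<delta>) s) \<partial>lborel) * g y \<partial>lborel)"
proof -
  have "vk \<delta> k \<psi> x t = (LINT y|lebesgue. (\<integral>s. indicator {0<..} s *
      (heat_kernel CARD('n) (fst x - y) (k / \<delta> * t + s) * lev (snd x + t / \<delta>) s) \<partial>lborel) * \<psi> y)"
    by (simp add: vk_def Phi_eq set_lebesgue_integral_def)
  also have "\<dots> = (\<integral>y. (\<integral>s. indicator {0<..} s *
      (heat_kernel CARD('n) (fst x - y) (k / \<delta> * t + s) * lev (snd x + t / \<delta>) s) \<partial>lborel) * g y \<partial>lborel)"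
    by (rule lebesgue_integral_eq_lborel_kernel) (use assms in auto)
  finally show ?thesis .
qed

lemma sol_eq_lborel:
  fixes x :: "(real^'n) \<times> real"
  assumes "0 < \<epsilon>" "0 \<le> t" "0 < \<delta>" and [measurable]: "\<psi> \<in> borel_measurable lebesgue" "g \<in> borel_measurable borel"
    and "AE y in lborel. \<psi> y = g y"
    and [measurable]: "(\<lambda>y. indicator Omega y * \<phi> y) \<in> borel_measurable lebesgue" "f \<in> borel_measurable borel"
    and "AE y in lborel. indicator Omega y * \<phi> y = f y"
  shows "sol \<epsilon> \<delta> \<kappa> \<phi> \<psi> x t =
    (\<integral>y. (indicator Omega y * G0 x y (t / \<epsilon>) + \<epsilon> / \<delta> * (\<integral>s. indicator Omega y * (indicator {0<..<t / \<epsilon>} s *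
      (rescaled_kernel \<epsilon> \<delta> \<kappa> t (fst x - fst y) (snd x + snd y) s)) \<partial>lborel)) * f y \<partial>lborel)
    + (\<integral>y. (\<integral>s. indicator {0<..<t / \<epsilon>} s *
      (rescaled_kernel \<epsilon> \<delta> \<kappa> t (fst x - y) (snd x) s) \<partial>lborel) * g y \<partial>lborel)"
    (is "_ = (\<integral>y. ?K y * f y \<partial>lborel) + (\<integral>y. ?J y * g y \<partial>lborel)")
proof -
  have K: "?K \<in> borel_measurable borel"
    unfolding G0_def reflect_def by measurable
  have "(LINT y:Omega|lebesgue. Gker \<epsilon> \<delta> \<kappa> x y t * \<phi> y) = (LINT y|lebesgue. ?K y * (indicator Omega y * \<phi> y))"
    unfolding set_lebesgue_integral_def using assms(1-3)
    by (intro Bochner_Integration.integral_cong)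
      (auto simp: Gker_def Hker_rescaled split: split_indicator)
  also have "\<dots> = (\<integral>y. ?K y * f y \<partial>lborel)"
    by (rule lebesgue_integral_eq_lborel_kernel[OF assms(7,8) K assms(9)])
  finally have 1: "(LINT y:Omega|lebesgue. Gker \<epsilon> \<delta> \<kappa> x y t * \<phi> y) = (\<integral>y. ?K y * f y \<partial>lborel)" .
  have "\<delta> / \<epsilon> * (LINT y'|lebesgue. Gker \<epsilon> \<delta> \<kappa> x (y', 0) t * \<psi> y') = (LINT y'|lebesgue. \<delta> / \<epsilon> * (Gker \<epsilon> \<delta> \<kappa> x (y', 0) t * \<psi> y'))"
    by simp
  \<comment> \<open>A boundary point is its own reflection, so \<open>G0\<close> vanishes there and
    only the term with \<open>Hker\<close> is left.\<close>
  also have "\<dots> = (LINT y|lebesgue. ?J y * \<psi> y)"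
    using assms(1-3)
    by (intro Bochner_Integration.integral_cong) (auto simp: Gker_def G0_def reflect_def Hker_rescaled)
  also have "\<dots> = (\<integral>y. ?J y * g y \<partial>lborel)"
    by (rule lebesgue_integral_eq_lborel_kernel) (use assms in auto)
  finally show ?thesis using 1 by (simp add: sol_def)
qed

lemma integral_mult_bounded_le:
  fixes h f :: "'a::euclidean_space \<Rightarrow> real" and B C :: real
  assumes [measurable]: "h \<in> borel_measurable borel" "f \<in> borel_measurable borel"
    and B: "(\<integral>\<^sup>+y. \<bar>h y\<bar> \<partial>lborel) \<le> ennreal B" "0 \<le> B" and C: "\<And>y. \<bar>f y\<bar> \<le> C"
  shows "integrable lborel (\<lambda>y. h y * f y)" and "\<bar>\<integral>y. h y * f y \<partial>lborel\<bar> \<le> C * B"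
proof -
  have h: "integrable lborel h"
    by (rule integrableI_bounded) (use B in \<open>auto simp: le_less_trans\<close>)
  have C0: "0 \<le> C" using C[of undefined] by linarith
  show I: "integrable lborel (\<lambda>y. h y * f y)"
    by (rule Bochner_Integration.integrable_bound[of _ "\<lambda>y. h y * C"])
      (use h C C0 in \<open>auto simp: abs_mult intro!: mult_left_mono\<close>)
  have "\<bar>\<integral>y. h y * f y \<partial>lborel\<bar> \<le> (\<integral>y. \<bar>h y * f y\<bar> \<partial>lborel)" by (rule integral_abs_bound)
  also have "\<dots> \<le> (\<integral>y. C * \<bar>h y\<bar> \<partial>lborel)"
  proof (rule integral_mono)
    show "\<bar>h y * f y\<bar> \<le> C * \<bar>h y\<bar>" for y
      using mult_left_mono[OF C, of "\<bar>h y\<bar>" y] by (simp add: abs_mult mult.commute)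
  qed (use I h in auto)
  also have "\<dots> = C * (\<integral>y. \<bar>h y\<bar> \<partial>lborel)" by simp
  also have "(\<integral>y. \<bar>h y\<bar> \<partial>lborel) \<le> B"
    using B h nn_integral_eq_integral[of lborel "\<lambda>y. \<bar>h y\<bar>"] by (metis AE_I2 abs_ge_zero ennreal_le_iff integrable_abs)
  finally show "\<bar>\<integral>y. h y * f y \<partial>lborel\<bar> \<le> C * B" using C0 by (simp add: mult_left_mono)
qed

text \<open>The interior data leave no trace in the limit: both parts of their contribution are
  small by themselves, and v_k is compared with the boundary integral alone. The bound is explicit
  in x_N, t and \<epsilon> so that uniformity can be read off.\<close>

lemma sol_minus_vk_bound:
  fixes x :: "(real^'n) \<times> real" and \<epsilon> \<delta> \<kappa> t C F :: real
  assumes "0 < \<epsilon>" "0 < \<delta>" "0 \<le> \<kappa>" "0 < t" "0 \<le> snd x"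
    and "\<psi> \<in> borel_measurable lebesgue" "AE y in lebesgue. \<bar>\<psi> y\<bar> \<le> C"
    and "set_borel_measurable lebesgue Omega \<phi>" "AE y in lebesgue. y \<in> Omega \<longrightarrow> \<bar>\<phi> y\<bar> \<le> F"
  defines "A \<equiv> 2 * CARD('n) * (\<kappa> / \<delta>) * \<epsilon>"
  shows "\<bar>sol \<epsilon> \<delta> \<kappa> \<phi> \<psi> x t - vk \<delta> \<kappa> \<psi> x t\<bar>
    \<le> \<bar>F\<bar> * (2 * snd x * (t / \<epsilon>) powr (-1/2) + \<epsilon> / \<delta> * (2 * sqrt (t / \<epsilon>)))
     + \<bar>C\<bar> * (A + (1 + A) * (\<epsilon> / \<delta>) * (2 * sqrt (t / \<epsilon>)) + (snd x + t / \<delta>) * (2 / sqrt (t / \<epsilon>)))"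
proof -
  have \<phi>: "(\<lambda>y. indicator Omega y * \<phi> y) \<in> borel_measurable lebesgue"
    using assms(8) by (simp add: set_borel_measurable_def)
  have "AE y in lebesgue. \<bar>indicator Omega y * \<phi> y\<bar> \<le> \<bar>F\<bar>"
    using assms(9) by eventually_elim (auto split: split_indicator)
  from essentially_bounded_borel_version[OF \<phi> this]
  obtain f where f: "f \<in> borel_measurable borel" "AE y in lborel. indicator Omega y * \<phi> y = f y" "\<And>y. \<bar>f y\<bar> \<le> \<bar>F\<bar>"
    by auto
  obtain g where g: "g \<in> borel_measurable borel" "AE y in lborel. \<psi> y = g y" "\<And>y. \<bar>g y\<bar> \<le> \<bar>C\<bar>"
    using essentially_bounded_borel_version[OF assms(6,7)] by blast
  let ?G = "\<lambda>y. indicator Omega y * G0 x y (t / \<epsilon>)"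
  let ?H = "\<lambda>y s. indicator Omega y * (indicator {0<..<t / \<epsilon>} s *
      (rescaled_kernel \<epsilon> \<delta> \<kappa> t (fst x - fst y) (snd x + snd y) s))"
  have Gm: "?G \<in> borel_measurable borel" unfolding G0_def reflect_def by measurable
  have Hm: "(\<lambda>(y, s). ?H y s) \<in> borel_measurable lborel2" by measurable
  have G: "integrable lborel (\<lambda>y. ?G y * f y)" "\<bar>\<integral>y. ?G y * f y \<partial>lborel\<bar> \<le> \<bar>F\<bar> * (2 * snd x * (t / \<epsilon>) powr (-1/2))"
    by (rule integral_mult_bounded_le[OF Gm f(1) nn_integral_G0 _ f(3)]; use assms(1-5) in simp)+
  have H: "integrable lborel (\<lambda>y. (\<integral>s. ?H y s \<partial>lborel) * f y)"
      "\<bar>\<integral>y. (\<integral>s. ?H y s \<partial>lborel) * f y \<partial>lborel\<bar> \<le> \<bar>F\<bar> * (2 * sqrt (t / \<epsilon>))"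
    by (rule kernel_integral_bound[OF Hm f(1) nn_integral_interior_H[OF assms(1-5)] _ f(3)]; use assms(1-5) in simp)+
  have scale: "\<bar>\<epsilon> / \<delta> * z\<bar> \<le> \<epsilon> / \<delta> * w" if "\<bar>z\<bar> \<le> w" for z w
    using assms(1,2) mult_left_mono[OF that, of "\<epsilon> / \<delta>"] by (simp add: abs_mult)
  have "(\<integral>y. (?G y + \<epsilon> / \<delta> * (\<integral>s. ?H y s \<partial>lborel)) * f y \<partial>lborel)
      = (\<integral>y. ?G y * f y + \<epsilon> / \<delta> * ((\<integral>s. ?H y s \<partial>lborel) * f y) \<partial>lborel)"
    by (simp only: distrib_right mult.assoc)
  also have "\<dots> = (\<integral>y. ?G y * f y \<partial>lborel) + (\<integral>y. \<epsilon> / \<delta> * ((\<integral>s. ?H y s \<partial>lborel) * f y) \<partial>lborel)"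
    by (rule Bochner_Integration.integral_add[OF G(1) integrable_mult_right[OF H(1)]])
  also have "\<dots> = (\<integral>y. ?G y * f y \<partial>lborel) + \<epsilon> / \<delta> * (\<integral>y. (\<integral>s. ?H y s \<partial>lborel) * f y \<partial>lborel)"
    by (simp only: integral_mult_right_zero)
  also have "\<bar>\<dots>\<bar> \<le> \<bar>F\<bar> * (2 * snd x * (t / \<epsilon>) powr (-1/2)) + \<epsilon> / \<delta> * (\<bar>F\<bar> * (2 * sqrt (t / \<epsilon>)))"
    by (intro order_trans[OF abs_triangle_ineq] add_mono G(2) scale H(2))
  finally have "\<bar>\<integral>y. (?G y + \<epsilon> / \<delta> * (\<integral>s. ?H y s \<partial>lborel)) * f y \<partial>lborel\<bar>
      \<le> \<bar>F\<bar> * (2 * snd x * (t / \<epsilon>) powr (-1/2) + \<epsilon> / \<delta> * (2 * sqrt (t / \<epsilon>)))" by (simp add: algebra_simps)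
  moreover note boundary_term_bound[OF assms(1-5) g(1,3), of "fst x"]
  ultimately show ?thesis
    unfolding A_def vk_eq_lborel[OF assms(6) g(1,2)]
      sol_eq_lborel[OF assms(1) less_imp_le[OF assms(4)] assms(2) assms(6) g(1,2) \<phi> f(1,2)]
    by linarith
qed

lemma sol_minus_vk_rate:
  fixes \<delta> \<kappa> L :: real and \<phi> :: "(real^'n) \<times> real \<Rightarrow> real" and I :: "real set"
  assumes "0 < \<delta>" "0 \<le> \<kappa>" "0 < L" "compact I" "I \<subseteq> {0<..}"
    and "\<psi> \<in> borel_measurable lebesgue" "AE y in lebesgue. \<bar>\<psi> y\<bar> \<le> C"
    and "set_borel_measurable lebesgue Omega \<phi>" "AE y in lebesgue. y \<in> Omega \<longrightarrow> \<bar>\<phi> y\<bar> \<le> F"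
  shows "\<exists>K. \<forall>\<^sub>F \<epsilon> in at_right 0. \<forall>x\<in>OmegaL L. \<forall>t\<in>I. \<bar>sol \<epsilon> \<delta> \<kappa> \<phi> \<psi> x t - vk \<delta> \<kappa> \<psi> x t\<bar> \<le> K * sqrt \<epsilon>"
proof (cases "I = {}")
  case False
  obtain a where a: "a \<in> I" "\<And>t. t \<in> I \<Longrightarrow> a \<le> t"
    using compact_attains_inf[OF assms(4) False] by blast
  obtain b where b: "b \<in> I" "\<And>t. t \<in> I \<Longrightarrow> t \<le> b"
    using compact_attains_sup[OF assms(4) False] by blast
  have a0: "0 < a" using a assms(5) by auto
  have b0: "0 < b" using b assms(5) by auto
  define D where "D = 2 * CARD('n) * (\<kappa> / \<delta>)"
  have D: "0 \<le> D" using assms by (simp add: D_def)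
  \<comment> \<open>\<open>K\<close> collects the worst cases: 1 / sqrt t at the least element a of
    I, sqrt t and t at the greatest element b, x_N = L, and \<epsilon> \<le> sqrt \<epsilon> for
    \<epsilon> < 1 in the terms with \<open>D\<close>.\<close>
  define K where "K = \<bar>F\<bar> * (2 * L / sqrt a + 2 * sqrt b / \<delta>)
    + \<bar>C\<bar> * (D + (1 + D) * (2 * sqrt b / \<delta>) + (L + b / \<delta>) * (2 / sqrt a))"
  have "\<bar>sol \<epsilon> \<delta> \<kappa> \<phi> \<psi> x t - vk \<delta> \<kappa> \<psi> x t\<bar> \<le> K * sqrt \<epsilon>"
    if e: "0 < \<epsilon>" "\<epsilon> < 1" and x: "x \<in> OmegaL L" and t: "t \<in> I" for \<epsilon> x t
  proof -
    have x: "0 \<le> snd x" "snd x \<le> L" using x by (auto simp: OmegaL_def)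
    have t: "a \<le> t" "t \<le> b" "0 < t" using a b t assms(5) by auto
    have se: "\<epsilon> \<le> sqrt \<epsilon>"
      using e by (intro real_le_rsqrt) (simp add: power2_eq_square mult_left_le)
    have 1: "2 / sqrt (t / \<epsilon>) \<le> 2 / sqrt a * sqrt \<epsilon>"
    proof -
      have "1 / sqrt t \<le> 1 / sqrt a" using t a0 by (intro divide_left_mono) auto
      then have "2 * sqrt \<epsilon> * (1 / sqrt t) \<le> 2 * sqrt \<epsilon> * (1 / sqrt a)" using e by (intro mult_left_mono) auto
      then show ?thesis by (simp add: real_sqrt_divide)
    qed
    have 2: "(t / \<epsilon>) powr (-1/2) = 1 / sqrt (t / \<epsilon>)"
      using t e by (simp add: powr_minus_divide powr_half_sqrt)
    have 3: "\<epsilon> / \<delta> * (2 * sqrt (t / \<epsilon>)) \<le> 2 * sqrt b / \<delta> * sqrt \<epsilon>"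
    proof -
      have "\<epsilon> * sqrt (t / \<epsilon>) = sqrt \<epsilon> * sqrt t"
        using e t by (simp add: real_sqrt_divide field_simps)
      also have "\<dots> \<le> sqrt \<epsilon> * sqrt b" using t e by (intro mult_left_mono) auto
      finally show ?thesis using assms(1) by (simp add: field_simps)
    qed
    have 4: "snd x * (2 / sqrt (t / \<epsilon>)) \<le> L * (2 / sqrt a * sqrt \<epsilon>)"
      using x 1 t e assms(3) by (intro mult_mono) auto
    have 5: "(snd x + t / \<delta>) * (2 / sqrt (t / \<epsilon>)) \<le> (L + b / \<delta>) * (2 / sqrt a * sqrt \<epsilon>)"
      using x t 1 e assms(1,3) b0 by (intro mult_mono add_mono divide_right_mono) auto
    have 6: "D * \<epsilon> \<le> D * sqrt \<epsilon>" using se D by (rule mult_left_mono)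
    have "D * \<epsilon> \<le> D" using D e by (simp add: mult_left_le)
    then have 7: "(1 + D * \<epsilon>) * (\<epsilon> / \<delta> * (2 * sqrt (t / \<epsilon>))) \<le> (1 + D) * (2 * sqrt b / \<delta> * sqrt \<epsilon>)"
      using D e t assms(1) by (intro mult_mono[OF _ 3]) auto
    have "\<bar>sol \<epsilon> \<delta> \<kappa> \<phi> \<psi> x t - vk \<delta> \<kappa> \<psi> x t\<bar>
      \<le> \<bar>F\<bar> * (2 * snd x * (t / \<epsilon>) powr (-1/2) + \<epsilon> / \<delta> * (2 * sqrt (t / \<epsilon>)))
       + \<bar>C\<bar> * (D * \<epsilon> + (1 + D * \<epsilon>) * (\<epsilon> / \<delta>) * (2 * sqrt (t / \<epsilon>)) + (snd x + t / \<delta>) * (2 / sqrt (t / \<epsilon>)))"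
      unfolding D_def by (rule sol_minus_vk_bound) (use e assms t x in auto)
    also have "\<dots> \<le> \<bar>F\<bar> * (L * (2 / sqrt a * sqrt \<epsilon>) + 2 * sqrt b / \<delta> * sqrt \<epsilon>)
       + \<bar>C\<bar> * (D * sqrt \<epsilon> + (1 + D) * (2 * sqrt b / \<delta> * sqrt \<epsilon>) + (L + b / \<delta>) * (2 / sqrt a * sqrt \<epsilon>))"
    proof (intro add_mono mult_left_mono)
      show "2 * snd x * (t / \<epsilon>) powr (-1/2) \<le> L * (2 / sqrt a * sqrt \<epsilon>)" using 4 unfolding 2 by (simp add: mult_ac)
      show "(1 + D * \<epsilon>) * (\<epsilon> / \<delta>) * (2 * sqrt (t / \<epsilon>)) \<le> (1 + D) * (2 * sqrt b / \<delta> * sqrt \<epsilon>)"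
        using 7 by (simp only: mult.assoc)
    qed (use 3 5 se D in auto)
    also have "\<dots> = K * sqrt \<epsilon>" by (simp add: K_def algebra_simps)
    finally show ?thesis .
  qed
  then show ?thesis
    unfolding eventually_at_right_field by (intro exI[of _ K] exI[of _ 1]) auto
qed auto

lemma closure_Omega: "closure Omega = {p :: (real^'n) \<times> real. 0 \<le> snd p}"
proof
  have "closed {p :: (real^'n) \<times> real. 0 \<le> snd p}"
    by (intro closed_Collect_le continuous_intros)
  then show "closure Omega \<subseteq> {p :: (real^'n) \<times> real. 0 \<le> snd p}"
    by (rule closure_minimal[rotated]) (auto simp: Omega_def)
  show "{p :: (real^'n) \<times> real. 0 \<le> snd p} \<subseteq> closure Omega"
  proof
    fix p :: "(real^'n) \<times> real" assume "p \<in> {p. 0 \<le> snd p}"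
    then have "\<forall>n. p + (0, 1 / Suc n) \<in> Omega" by (simp add: Omega_def add_nonneg_pos)
    moreover have "(\<lambda>n. p + (0, 1 / Suc n)) \<longlonglongrightarrow> p + (0, 0)"
      by (intro tendsto_intros LIMSEQ_Suc[OF lim_1_over_n])
    ultimately show "p \<in> closure Omega"
      by (auto simp: closure_sequential zero_prod_def[symmetric] intro!: exI[of _ "\<lambda>n. p + (0, 1 / Suc n)"])
  qed
qed

section \<open>Comparison of v_k with v_0\<close>

lemma nn_integral_lev_over_tau:
  assumes "0 < \<xi>"
  shows "(\<integral>\<^sup>+s. ennreal (lev \<xi> s / s) * indicator {0<..} s \<partial>lborel) = ennreal (2 / \<xi>\<^sup>2)"
proof -
  have "(\<integral>\<^sup>+s. ennreal (lev \<xi> s / s) * indicator {0<..} s \<partial>lborel) = (\<integral>\<^sup>+s. ennreal (indicator {0<..} s *\<^sub>R (lev \<xi> s / s)) \<partial>lborel)"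
    by (intro nn_integral_cong) (auto split: split_indicator)
  also have "\<dots> = ennreal (LBINT s:{0<..}. lev \<xi> s / s)"
    using lev_over_tau_integral[OF assms] assms unfolding set_lebesgue_integral_def set_integrable_def
    by (intro nn_integral_eq_integral) (auto simp: lev_nonneg split: split_indicator)
  finally show ?thesis using lev_over_tau_integral[OF assms] by simp
qed

text \<open>Both functions carry the same Levy weight at distance \<xi> = x_N + t / \<delta>; only
  the heat times differ, \<tau> against a + \<tau> with a = k t / \<delta>. The relative difference
  is at most a / \<tau>, and the weight has inverse moment 2 / \<xi>^2, which explains the condition
  \<xi> \<ge> R.\<close>

lemma vk_minus_v0_bound:
  fixes x :: "(real^'n) \<times> real" and \<delta> k t C :: real
  assumes "0 < \<delta>" "0 \<le> k" "0 < t" "0 \<le> snd x"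
    and "\<psi> \<in> borel_measurable lebesgue" "AE y in lebesgue. \<bar>\<psi> y\<bar> \<le> C"
  shows "\<bar>vk \<delta> k \<psi> x t - v0 \<delta> \<psi> x t\<bar> \<le> \<bar>C\<bar> * (2 * CARD('n) * (k / \<delta> * t) * (2 / (snd x + t / \<delta>)\<^sup>2))"
proof -
  define \<xi> where "\<xi> = snd x + t / \<delta>"
  define a where "a = k / \<delta> * t"
  have \<xi>: "0 < \<xi>" using assms by (simp add: \<xi>_def add_nonneg_pos)
  have a: "0 \<le> a" using assms by (simp add: a_def)
  obtain g where g: "g \<in> borel_measurable borel" "AE y in lborel. \<psi> y = g y" "\<And>y. \<bar>g y\<bar> \<le> \<bar>C\<bar>"
    using essentially_bounded_borel_version[OF assms(5,6)] by blast
  define K where "K b y s = indicator {0<..} s * (heat_kernel CARD('n) (fst x - y) (b + s) * lev \<xi> s)" for b y s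
  have Km: "(\<lambda>(y, s). K b y s) \<in> borel_measurable lborel2" for b
    unfolding K_def by measurable
  have DIM: "DIM(real^'n) = CARD('n)" by simp
  have 1: "(\<integral>\<^sup>+s. (\<integral>\<^sup>+y. \<bar>K a y s\<bar> \<partial>lborel) \<partial>lborel) \<le> ennreal 1"
  proof -
    have "(\<integral>\<^sup>+y. \<bar>K a y s\<bar> \<partial>lborel) = ennreal (lev \<xi> s) * indicator {0<..} s" for s
      using nn_integral_heat_lev[of "a + s" "lev \<xi> s" "fst x"] \<xi> a
      by (auto simp: K_def lev_nonneg split: split_indicator)
    then show ?thesis using nn_integral_lev[OF \<xi>] by simp
  qed
  have pt: "(\<integral>\<^sup>+y. \<bar>K 0 y s - K a y s\<bar> \<partial>lborel) \<le> ennreal (2 * CARD('n) * a) * (ennreal (lev \<xi> s / s) * indicator {0<..} s)" for s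
  proof (cases "0 < s")
    case True
    have l: "0 \<le> lev \<xi> s" using \<xi> True by (simp add: lev_nonneg)
    have "(\<integral>\<^sup>+y. \<bar>K 0 y s - K a y s\<bar> \<partial>lborel) \<le> ennreal (lev \<xi> s * (2 * CARD('n) * (a + s - s) / (a + s)) + \<bar>lev \<xi> s - lev \<xi> s\<bar>)"
      using nn_integral_product_kernel_diff[of s "a + s" "lev \<xi> s" "fst x" "lev \<xi> s"] True a l by (simp add: K_def)
    also have "lev \<xi> s * (2 * CARD('n) * (a + s - s) / (a + s)) + \<bar>lev \<xi> s - lev \<xi> s\<bar> = lev \<xi> s * (2 * CARD('n) * a / (a + s))"
      by simp
    also have "\<dots> \<le> lev \<xi> s * (2 * CARD('n) * a / s)"
      using True a l by (intro mult_left_mono divide_left_mono) auto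
    also have "\<dots> = (2 * CARD('n) * a) * (lev \<xi> s / s)" by simp
    also have "ennreal \<dots> = ennreal (2 * CARD('n) * a) * ennreal (lev \<xi> s / s)"
      using True a l by (intro ennreal_mult) auto
    finally show ?thesis using True by (simp add: ennreal_leI)
  qed (simp add: K_def)
  have "(\<integral>\<^sup>+s. (\<integral>\<^sup>+y. \<bar>K 0 y s - K a y s\<bar> \<partial>lborel) \<partial>lborel)
      \<le> (\<integral>\<^sup>+s. ennreal (2 * CARD('n) * a) * (ennreal (lev \<xi> s / s) * indicator {0<..} s) \<partial>lborel)"
    by (rule nn_integral_mono) (rule pt)
  also have "\<dots> = ennreal (2 * CARD('n) * a) * ennreal (2 / \<xi>\<^sup>2)"
    unfolding nn_integral_lev_over_tau[OF \<xi>, symmetric] by (simp add: nn_integral_cmult)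
  also have "\<dots> = ennreal (2 * CARD('n) * a * (2 / \<xi>\<^sup>2))" using a by (intro ennreal_mult[symmetric]) auto
  finally have "\<bar>(\<integral>y. (\<integral>s. K 0 y s \<partial>lborel) * g y \<partial>lborel) - (\<integral>y. (\<integral>s. K a y s \<partial>lborel) * g y \<partial>lborel)\<bar>
      \<le> \<bar>C\<bar> * (2 * CARD('n) * a * (2 / \<xi>\<^sup>2))"
    using a by (intro kernel_integral_diff_bound[OF Km Km g(1) 1 _ _ _ g(3)]) auto
  then show ?thesis
    unfolding v0_eq_vk[OF assms(1,4,3)] vk_eq_lborel[OF assms(5) g(1,2)] K_def a_def \<xi>_def by (simp add: abs_minus_commute)
qed

lemma vk_minus_v0_rate:
  fixes \<delta> T R :: real and \<psi> :: "real^'n \<Rightarrow> real"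
  assumes "0 < \<delta>" "0 < T" "0 < R"
    and "\<psi> \<in> borel_measurable lebesgue" "AE y in lebesgue. \<bar>\<psi> y\<bar> \<le> C"
  shows "\<exists>K. \<forall>\<^sub>F k in at_right 0. \<forall>x\<in>closure Omega. \<forall>t\<in>{0<..T}.
        R \<le> snd x + t / \<delta> \<longrightarrow> \<bar>vk \<delta> k \<psi> x t - v0 \<delta> \<psi> x t\<bar> \<le> K * k"
proof -
  define K where "K = \<bar>C\<bar> * (2 * CARD('n) * (1 / \<delta> * T) * (2 / R\<^sup>2))"
  have "\<bar>vk \<delta> k \<psi> x t - v0 \<delta> \<psi> x t\<bar> \<le> K * k"
    if k: "0 < k" and x: "x \<in> closure Omega" and t: "0 < t" "t \<le> T" and R: "R \<le> snd x + t / \<delta>" for k t x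
  proof -
    have "\<bar>vk \<delta> k \<psi> x t - v0 \<delta> \<psi> x t\<bar> \<le> \<bar>C\<bar> * (2 * CARD('n) * (k / \<delta> * t) * (2 / (snd x + t / \<delta>)\<^sup>2))"
      using k x t assms by (intro vk_minus_v0_bound) (auto simp: closure_Omega)
    also have "\<dots> \<le> \<bar>C\<bar> * (2 * CARD('n) * (k / \<delta> * T) * (2 / R\<^sup>2))"
      using k t R assms by (intro mult_left_mono mult_mono divide_left_mono power_mono) auto
    also have "\<dots> = K * k" by (simp add: K_def)
    finally show ?thesis .
  qed
  then show ?thesis
    unfolding eventually_at_right_field by (intro exI[of _ K] exI[of _ 1]) auto
qed

section \<open>Differentiation under the integral sign\<close>

text \<open>The remainder quotient is at most 2 \<open>g\<close>, once by the mean value inequality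
  on the ball and once by the bound on \<open>F' p0\<close>, so dominated convergence applies. A
  joint derivative is wanted because time will move two parameters at once.\<close>

lemma has_derivative_integral_dominated:
  fixes F :: "'p::euclidean_space \<Rightarrow> 'w \<Rightarrow> real"
  assumes r: "0 < r"
    and D: "\<And>p w. p \<in> ball p0 r \<Longrightarrow> ((\<lambda>p. F p w) has_derivative F' p w) (at p)"
    and M: "\<And>p. p \<in> ball p0 r \<Longrightarrow> F p \<in> borel_measurable M" "\<And>v. (\<lambda>w. F' p0 w v) \<in> borel_measurable M"
    and B: "\<And>p w v. p \<in> ball p0 r \<Longrightarrow> \<bar>F' p w v\<bar> \<le> g w * norm v" and g: "integrable M g"
    and I: "integrable M (F p0)"
  shows "((\<lambda>p. \<integral>w. F p w \<partial>M) has_derivative (\<lambda>v. \<integral>w. F' p0 w v \<partial>M)) (at p0)"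
proof -
  have p0: "p0 \<in> ball p0 r" using r by simp
  have lin: "linear (F' p0 w)" for w using D[OF p0] by (rule has_derivative_linear)
  have I': "integrable M (\<lambda>w. F' p0 w v)" for v
  proof (rule Bochner_Integration.integrable_bound)
    show "integrable M (\<lambda>w. g w * norm v)" using g by simp
    show "AE w in M. norm (F' p0 w v) \<le> norm (g w * norm v)"
      by (rule AE_I2, unfold real_norm_def) (rule order_trans[OF B[OF p0] abs_ge_self])
  qed (rule M)
  have lip: "\<bar>F p w - F p0 w\<bar> \<le> g w * norm (p - p0)" if p: "p \<in> ball p0 r" for p w
  proof -
    have "norm (F p w - F p0 w) \<le> g w * norm (p - p0)"
    proof (rule differentiable_bound[OF convex_ball _ _ p p0])
      fix q assume q: "q \<in> ball p0 r"
      show "((\<lambda>p. F p w) has_derivative F' q w) (at q within ball p0 r)"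
        using D[OF q] by (rule has_derivative_at_withinI)
      show "onorm (F' q w) \<le> g w"
        using B[OF q] by (intro onorm_le) auto
    qed
    then show ?thesis by simp
  qed
  have IF: "integrable M (F p)" if p: "p \<in> ball p0 r" for p
  proof -
    have "integrable M (\<lambda>w. F p w - F p0 w)"
    proof (rule Bochner_Integration.integrable_bound)
      show "integrable M (\<lambda>w. g w * norm (p - p0))" using g by simp
      show "AE w in M. norm (F p w - F p0 w) \<le> norm (g w * norm (p - p0))"
        by (rule AE_I2, unfold real_norm_def) (rule order_trans[OF lip[OF p] abs_ge_self])
    qed (intro borel_measurable_diff M p p0)
    from Bochner_Integration.integrable_add[OF this I] show ?thesis by simp
  qed
  have bl: "bounded_linear (\<lambda>v. \<integral>w. F' p0 w v \<partial>M)"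
  proof (rule linear_conv_bounded_linear[THEN iffD1], rule linearI)
    show "(\<integral>w. F' p0 w (u + v) \<partial>M) = (\<integral>w. F' p0 w u \<partial>M) + (\<integral>w. F' p0 w v \<partial>M)" for u v
      using I' by (simp add: linear_add[OF lin])
    show "(\<integral>w. F' p0 w (c *\<^sub>R v) \<partial>M) = c *\<^sub>R (\<integral>w. F' p0 w v \<partial>M)" for c v
      by (simp add: linear_scale[OF lin])
  qed
  have "((\<lambda>p. ((\<integral>w. F p w \<partial>M) - (\<integral>w. F p0 w \<partial>M) - (\<integral>w. F' p0 w (p - p0) \<partial>M)) /\<^sub>R norm (p - p0)) \<longlongrightarrow> 0) (at p0 within ball p0 r)"
    unfolding tendsto_at_iff_sequentially
  proof (intro allI impI)
    fix X assume X: "\<forall>i. X i \<in> ball p0 r - {p0}" "X \<longlonglongrightarrow> p0"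
    define d where "d i w = (F (X i) w - F p0 w - F' p0 w (X i - p0)) / norm (X i - p0)" for i w
    have Xb: "X i \<in> ball p0 r" and Xn: "0 < norm (X i - p0)" for i using X by auto
    have "(\<lambda>i. \<integral>w. d i w \<partial>M) \<longlonglongrightarrow> (\<integral>w. 0 \<partial>M)"
    proof (rule integral_dominated_convergence[where w="\<lambda>w. 2 * g w"])
      show "d i \<in> borel_measurable M" for i
        unfolding d_def using M Xb p0 by (intro borel_measurable_divide borel_measurable_diff) auto
      show "AE w in M. (\<lambda>i. d i w) \<longlonglongrightarrow> 0"
      proof (rule AE_I2)
        fix w
        have "((\<lambda>p. (F p w - F p0 w - F' p0 w (p - p0)) /\<^sub>R norm (p - p0)) \<longlongrightarrow> 0) (at p0)"
          by (rule conjunct2[OF D[OF p0, of w, unfolded has_derivative_at_within]])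
        then have "((\<lambda>p. (F p w - F p0 w - F' p0 w (p - p0)) /\<^sub>R norm (p - p0)) \<longlongrightarrow> 0) (at p0 within ball p0 r)"
          by (rule tendsto_within_subset) simp
        then have "((\<lambda>p. (F p w - F p0 w - F' p0 w (p - p0)) /\<^sub>R norm (p - p0)) \<circ> X) \<longlonglongrightarrow> 0"
          using X unfolding tendsto_at_iff_sequentially by blast
        then show "(\<lambda>i. d i w) \<longlonglongrightarrow> 0" by (simp add: d_def o_def divide_inverse mult.commute)
      qed
      show "AE w in M. norm (d i w) \<le> 2 * g w" for i
      proof (rule AE_I2)
        fix w
        have "\<bar>F (X i) w - F p0 w - F' p0 w (X i - p0)\<bar> \<le> g w * norm (X i - p0) + g w * norm (X i - p0)"
          using lip[OF Xb, of i w] B[OF p0, of w "X i - p0"] by linarith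
        then show "norm (d i w) \<le> 2 * g w" using Xn[of i] by (simp add: d_def field_simps)
      qed
    qed (use g in auto)
    moreover have "(\<integral>w. d i w \<partial>M) = ((\<integral>w. F (X i) w \<partial>M) - (\<integral>w. F p0 w \<partial>M) - (\<integral>w. F' p0 w (X i - p0) \<partial>M)) /\<^sub>R norm (X i - p0)" for i
      using IF[OF Xb] I I' by (simp add: d_def divide_inverse mult.commute)
    ultimately show "((\<lambda>p. ((\<integral>w. F p w \<partial>M) - (\<integral>w. F p0 w \<partial>M) - (\<integral>w. F' p0 w (p - p0) \<partial>M)) /\<^sub>R norm (p - p0)) \<circ> X) \<longlonglongrightarrow> 0"
      by (simp add: o_def)
  qed
  then have "((\<lambda>p. ((\<integral>w. F p w \<partial>M) - (\<integral>w. F p0 w \<partial>M) - (\<integral>w. F' p0 w (p - p0) \<partial>M)) /\<^sub>R norm (p - p0)) \<longlongrightarrow> 0) (at p0)"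
    by (simp only: at_within_open[OF p0 open_ball])
  then show ?thesis
    by (rule has_derivativeI[OF bl])
qed

section \<open>Gaussian majorants\<close>

lemma powr_minus_double:
  fixes x :: real
  assumes "0 < x"
  shows "x powr (- q) = 2 powr q * (2 * x) powr (- q)"
  using assms by (simp add: powr_mult powr_minus)

text \<open>From |z|^2 \<le> 2 |z + h|^2 + 2 |h|^2: doubling the time halves the exponent, which
  leaves room for a shift of the centre.\<close>

lemma heat_kernel_shift_le:
  fixes z h :: "'a::real_normed_vector"
  assumes "0 < s"
  shows "heat_kernel d (z + h) s \<le> 2 powr (real d / 2) * exp ((norm h)\<^sup>2 / (4 * s)) * heat_kernel d z (2 * s)"
proof -
  have "norm z \<le> norm (z + h) + norm h" using norm_triangle_ineq4[of "z + h" h] by simp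
  then have "(norm z)\<^sup>2 \<le> (norm (z + h) + norm h)\<^sup>2" by (rule power_mono) simp
  also have "\<dots> \<le> 2 * (norm (z + h))\<^sup>2 + 2 * (norm h)\<^sup>2"
    using sum_squares_bound[of "norm (z + h)" "norm h"] by (simp add: power2_sum)
  finally have "- (norm (z + h))\<^sup>2 / (4 * s) \<le> (norm h)\<^sup>2 / (4 * s) + - (norm z)\<^sup>2 / (4 * (2 * s))"
    using assms by (simp add: field_simps)
  then have e: "exp (- (norm (z + h))\<^sup>2 / (4 * s)) \<le> exp ((norm h)\<^sup>2 / (4 * s)) * exp (- (norm z)\<^sup>2 / (4 * (2 * s)))"
    by (simp flip: exp_add)
  have "(4 * pi * s) powr (- (real d / 2)) = 2 powr (real d / 2) * (4 * pi * (2 * s)) powr (- (real d / 2))"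
    using assms powr_minus_double[of "4 * pi * s" "real d / 2"] by (simp add: mult.left_commute)
  then show ?thesis
    using mult_left_mono[OF e, of "(4 * pi * s) powr (- (real d / 2))"] unfolding heat_kernel_def by (simp add: mult_ac)
qed

text \<open>The family is closed under differentiation in (z, s, \<open>\<xi>\<close>), and each member is dominated by a
  heat kernel times an integrable function of \<open>\<tau>\<close>. For the latter z occurs only in the combination z / s.\<close>

inductive gauss_kernel :: "(real^'n \<Rightarrow> real \<Rightarrow> real \<Rightarrow> real \<Rightarrow> real) \<Rightarrow> bool" where
  base: "gauss_kernel (\<lambda>z s \<xi> \<tau>. heat_kernel CARD('n) z s * (\<tau> powr (-3/2) * exp (- \<xi>\<^sup>2 / (4 * \<tau>))))"
| space: "b \<in> Basis \<Longrightarrow> gauss_kernel K \<Longrightarrow> gauss_kernel (\<lambda>z s \<xi> \<tau>. (z \<bullet> b) / s * K z s \<xi> \<tau>)"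
| time: "gauss_kernel K \<Longrightarrow> gauss_kernel (\<lambda>z s \<xi> \<tau>. 1 / s * K z s \<xi> \<tau>)"
| xi: "gauss_kernel K \<Longrightarrow> gauss_kernel (\<lambda>z s \<xi> \<tau>. \<xi> * K z s \<xi> \<tau>)"
| tau: "gauss_kernel K \<Longrightarrow> gauss_kernel (\<lambda>z s \<xi> \<tau>. 1 / \<tau> * K z s \<xi> \<tau>)"
| add: "gauss_kernel K \<Longrightarrow> gauss_kernel L \<Longrightarrow> gauss_kernel (\<lambda>z s \<xi> \<tau>. K z s \<xi> \<tau> + L z s \<xi> \<tau>)"
| scale: "gauss_kernel K \<Longrightarrow> gauss_kernel (\<lambda>z s \<xi> \<tau>. c * K z s \<xi> \<tau>)"

lemma gauss_kernel_sum:
  assumes "finite A" "A \<noteq> {}" "\<And>b. b \<in> A \<Longrightarrow> gauss_kernel (K b)"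
  shows "gauss_kernel (\<lambda>z s \<xi> \<tau>. \<Sum>b\<in>A. K b z s \<xi> \<tau>)"
  using assms by (induction A rule: finite_ne_induct) (auto intro: gauss_kernel.add)

lemma borel_measurable_gauss_kernel:
  assumes "gauss_kernel K" and [measurable]: "f1 \<in> borel_measurable M" "f2 \<in> borel_measurable M" "f3 \<in> borel_measurable M" "f4 \<in> borel_measurable M"
  shows "(\<lambda>w. K (f1 w) (f2 w) (f3 w) (f4 w)) \<in> borel_measurable M"
  using assms(1) by induction simp_all

text \<open>\<open>C\<close> is the size, \<open>l\<close> a dilation of the heat time, and
  \<open>c\<close> the rate of decay at \<tau> = 0. The variable \<xi> is absent because bounds are
  taken uniformly over an interval of \<xi> away from 0.\<close>

definition gauss_bound :: "real \<Rightarrow> real \<Rightarrow> real \<Rightarrow> real^'n \<Rightarrow> real \<Rightarrow> real \<Rightarrow> real" where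
  "gauss_bound C l c z s \<tau> = C * (heat_kernel CARD('n) z (l * s) * (\<tau> powr (-3/2) * exp (- c / \<tau>)))"

text \<open>Brings two bounds to a common \<open>l\<close> and \<open>c\<close>, as the sum of two
  kernels requires.\<close>

lemma gauss_bound_weaken:
  fixes z :: "real^'n"
  assumes "0 \<le> C" "0 < l" "l \<le> l'" "0 < c'" "c' \<le> c" "0 < s" "0 < \<tau>"
  shows "gauss_bound C l c z s \<tau> \<le> gauss_bound (C * (l' / l) powr (real CARD('n) / 2)) l' c' z s \<tau>"
proof -
  let ?r = "(l' / l) powr (real CARD('n) / 2)"
  have "(l * s / (l' * s)) powr (real CARD('n) / 2) * heat_kernel CARD('n) z (l * s) \<le> heat_kernel CARD('n) z (l' * s)"
    using assms by (intro heat_kernel_time_mono) auto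
  then have "?r * ((l / l') powr (real CARD('n) / 2) * heat_kernel CARD('n) z (l * s)) \<le> ?r * heat_kernel CARD('n) z (l' * s)"
    using assms by (intro mult_left_mono) auto
  moreover have "?r * (l / l') powr (real CARD('n) / 2) = 1"
    using assms by (simp add: powr_mult[symmetric])
  ultimately have 1: "heat_kernel CARD('n) z (l * s) \<le> ?r * heat_kernel CARD('n) z (l' * s)"
    by (simp add: mult.assoc[symmetric])
  have 2: "\<tau> powr (-3/2) * exp (- c / \<tau>) \<le> \<tau> powr (-3/2) * exp (- c' / \<tau>)"
    using assms by (intro mult_left_mono) (auto simp: divide_right_mono)
  have "C * (heat_kernel CARD('n) z (l * s) * (\<tau> powr (-3/2) * exp (- c / \<tau>)))
      \<le> C * ((?r * heat_kernel CARD('n) z (l' * s)) * (\<tau> powr (-3/2) * exp (- c' / \<tau>)))"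
    using assms by (intro mult_left_mono mult_mono 1 2) auto
  then show ?thesis by (simp add: gauss_bound_def mult_ac)
qed

text \<open>Half of the exponent is spent on the factor u. This is how polynomial factors are traded
  for worse Gaussian constants.\<close>

lemma exp_minus_mult_le:
  fixes u l :: real
  assumes "0 \<le> u" "0 < l"
  shows "u * exp (- u / l) \<le> 2 * l * exp (- u / (2 * l))"
proof -
  have "u / (2 * l) \<le> exp (u / (2 * l))" using exp_ge_add_one_self[of "u / (2 * l)"] by linarith
  then have "u \<le> 2 * l * exp (u / (2 * l))" using assms by (simp add: field_simps)
  then have "u * exp (- u / l) \<le> 2 * l * exp (u / (2 * l)) * exp (- u / l)" by (intro mult_right_mono) auto
  also have "\<dots> = 2 * l * exp (- u / (2 * l))"
    using assms by (simp add: mult.assoc flip: exp_add)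
  finally show ?thesis .
qed

text \<open>Every rule of the family pays with its own parameter: a factor z / s doubles
  \<open>l\<close>, a factor 1 / \<tau> halves \<open>c\<close>, the factors 1 / s and \<xi> change
  only \<open>C\<close> because s is bounded below and \<xi> above, and a sum takes the larger
  \<open>l\<close> and the smaller \<open>c\<close>.\<close>

lemma gauss_kernel_dominated:
  fixes K :: "real^'n \<Rightarrow> real \<Rightarrow> real \<Rightarrow> real \<Rightarrow> real"
  assumes "gauss_kernel K" "0 < \<sigma>" "0 < \<xi>1"
  shows "\<exists>C l c. 0 \<le> C \<and> 0 < l \<and> 0 < c \<and>
    (\<forall>z s \<xi> \<tau>. \<sigma> \<le> s \<longrightarrow> \<xi>1 \<le> \<xi> \<longrightarrow> \<xi> \<le> \<xi>2 \<longrightarrow> 0 < \<tau> \<longrightarrow> \<bar>K z s \<xi> \<tau>\<bar> \<le> gauss_bound C l c z s \<tau>)"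
  using assms(1)
proof induction
  case base
  have "exp (- \<xi>\<^sup>2 / (4 * \<tau>)) \<le> exp (- (\<xi>1\<^sup>2 / 4) / \<tau>)" if "\<xi>1 \<le> \<xi>" "0 < \<tau>" for \<xi> \<tau> :: real
  proof -
    have "\<xi>1\<^sup>2 \<le> \<xi>\<^sup>2" using that assms by (intro power_mono) auto
    then show ?thesis using that by (simp add: divide_right_mono)
  qed
  then show ?case using assms
    by (intro exI[of _ 1] exI[of _ 1] exI[of _ "\<xi>1\<^sup>2 / 4"])
      (auto simp: gauss_bound_def abs_mult intro!: mult_left_mono)
next
  case (space b K)
  then obtain C l c where *: "0 \<le> C" "0 < l" "0 < c" and
    B: "\<And>z s \<xi> \<tau>. \<sigma> \<le> s \<Longrightarrow> \<xi>1 \<le> \<xi> \<Longrightarrow> \<xi> \<le> \<xi>2 \<Longrightarrow> 0 < \<tau> \<Longrightarrow> \<bar>K z s \<xi> \<tau>\<bar> \<le> gauss_bound C l c z s \<tau>"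
    by auto
  \<comment> \<open>With u = |z|^2 / s the factor |z| / s is at most (1 + u) / sqrt \<sigma>.
    Absorbing 1 + u into the Gaussian costs 1 + 8 l, and the power of 2 corrects the normalisation
    at the doubled time.\<close>
  define M where "M = (1 + 8 * l) / sqrt \<sigma> * 2 powr (real CARD('n) / 2)"
  have hk: "norm z / s * heat_kernel CARD('n) z (l * s) \<le> M * heat_kernel CARD('n) z (2 * l * s)" if s: "\<sigma> \<le> s" for z :: "real^'n" and s
  proof -
    have s0: "0 < s" using s assms by simp
    define u where "u = (norm z)\<^sup>2 / s"
    have u: "0 \<le> u" using s0 by (simp add: u_def)
    have a: "norm z / s \<le> (1 + u) / sqrt \<sigma>"
    proof -
      have "2 * (norm z / sqrt s) \<le> 1 + u"
        using sum_squares_bound[of 1 "norm z / sqrt s"] s0 by (simp add: u_def power_divide)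
      moreover have "0 \<le> norm z / sqrt s" using s0 by simp
      ultimately have "norm z / sqrt s \<le> 1 + u" by linarith
      then have "(norm z / sqrt s) / sqrt s \<le> (1 + u) / sqrt \<sigma>"
        using s0 s assms u by (intro frac_le) auto
      then show ?thesis using s0 by simp
    qed
    have b: "(1 + u) * exp (- u / (4 * l)) \<le> (1 + 8 * l) * exp (- u / (8 * l))"
    proof -
      have e1: "exp (- u / (4 * l)) \<le> exp (- u / (8 * l))"
        using * u by (simp add: frac_le)
      have e2: "u * exp (- u / (4 * l)) \<le> 8 * l * exp (- u / (8 * l))"
        using exp_minus_mult_le[of u "4 * l"] * u by simp
      from add_mono[OF e1 e2] show ?thesis by (simp only: distrib_right mult_1_left)
    qed
    have e: "- (norm z)\<^sup>2 / (4 * (l * s)) = - u / (4 * l)" "- (norm z)\<^sup>2 / (4 * (2 * l * s)) = - u / (8 * l)"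
      using s0 by (simp_all add: u_def field_simps)
    have p: "(4 * pi * (l * s)) powr (- (real CARD('n) / 2)) = 2 powr (real CARD('n) / 2) * (4 * pi * (2 * l * s)) powr (- (real CARD('n) / 2))"
      using s0 * powr_minus_double[of "4 * pi * (l * s)" "real CARD('n) / 2"] by (simp add: mult_ac)
    have "norm z / s * exp (- u / (4 * l)) \<le> (1 + u) / sqrt \<sigma> * exp (- u / (4 * l))"
      using a by (intro mult_right_mono) auto
    also have "\<dots> = (1 + u) * exp (- u / (4 * l)) / sqrt \<sigma>" by simp
    also have "\<dots> \<le> (1 + 8 * l) * exp (- u / (8 * l)) / sqrt \<sigma>"
      using b assms by (intro divide_right_mono) auto
    finally have "(4 * pi * (l * s)) powr (- (real CARD('n) / 2)) * (norm z / s * exp (- u / (4 * l)))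
        \<le> (4 * pi * (l * s)) powr (- (real CARD('n) / 2)) * ((1 + 8 * l) * exp (- u / (8 * l)) / sqrt \<sigma>)"
      by (rule mult_left_mono) simp
    also have "\<dots> = M * ((4 * pi * (2 * l * s)) powr (- (real CARD('n) / 2)) * exp (- u / (8 * l)))"
      unfolding p M_def by simp
    finally show ?thesis
      unfolding heat_kernel_def e by (simp add: mult.left_commute)
  qed
  have M: "0 \<le> M" using * assms by (simp add: M_def)
  have "\<bar>(z \<bullet> b) / s * K z s \<xi> \<tau>\<bar> \<le> gauss_bound (C * M) (2 * l) c z s \<tau>"
    if h: "\<sigma> \<le> s" "\<xi>1 \<le> \<xi>" "\<xi> \<le> \<xi>2" "0 < \<tau>" for z s \<xi> \<tau>
  proof -
    have s0: "0 < s" using h assms by simp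
    have "\<bar>(z \<bullet> b) / s * K z s \<xi> \<tau>\<bar> \<le> norm z / s * gauss_bound C l c z s \<tau>"
      using B[OF h] s0 Basis_le_norm[OF space(1), of z] unfolding abs_mult
      by (intro mult_mono) (auto simp: divide_right_mono)
    also have "\<dots> = C * ((norm z / s * heat_kernel CARD('n) z (l * s)) * (\<tau> powr (-3/2) * exp (- c / \<tau>)))"
      by (simp add: gauss_bound_def)
    also have "\<dots> \<le> C * ((M * heat_kernel CARD('n) z (2 * l * s)) * (\<tau> powr (-3/2) * exp (- c / \<tau>)))"
      using * by (intro mult_left_mono mult_right_mono hk h) auto
    finally show ?thesis by (simp add: gauss_bound_def mult_ac)
  qed
  then show ?case using * M by (intro exI[of _ "C * M"] exI[of _ "2 * l"] exI[of _ c]) auto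
next
  case (time K)
  then obtain C l c where *: "0 \<le> C" "0 < l" "0 < c" and
    B: "\<And>z s \<xi> \<tau>. \<sigma> \<le> s \<Longrightarrow> \<xi>1 \<le> \<xi> \<Longrightarrow> \<xi> \<le> \<xi>2 \<Longrightarrow> 0 < \<tau> \<Longrightarrow> \<bar>K z s \<xi> \<tau>\<bar> \<le> gauss_bound C l c z s \<tau>"
    by auto
  have "\<bar>1 / s * K z s \<xi> \<tau>\<bar> \<le> gauss_bound (1 / \<sigma> * C) l c z s \<tau>"
    if h: "\<sigma> \<le> s" "\<xi>1 \<le> \<xi>" "\<xi> \<le> \<xi>2" "0 < \<tau>" for z s \<xi> \<tau>
  proof -
    have "\<bar>1 / s * K z s \<xi> \<tau>\<bar> \<le> 1 / \<sigma> * gauss_bound C l c z s \<tau>"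
      using B[OF h] h assms unfolding abs_mult by (intro mult_mono) (auto simp: frac_le)
    then show ?thesis by (simp add: gauss_bound_def)
  qed
  then show ?case using * assms by (intro exI[of _ "1 / \<sigma> * C"] exI[of _ l] exI[of _ c]) auto
next
  case (xi K)
  then obtain C l c where *: "0 \<le> C" "0 < l" "0 < c" and
    B: "\<And>z s \<xi> \<tau>. \<sigma> \<le> s \<Longrightarrow> \<xi>1 \<le> \<xi> \<Longrightarrow> \<xi> \<le> \<xi>2 \<Longrightarrow> 0 < \<tau> \<Longrightarrow> \<bar>K z s \<xi> \<tau>\<bar> \<le> gauss_bound C l c z s \<tau>"
    by auto
  have "\<bar>\<xi> * K z s \<xi> \<tau>\<bar> \<le> gauss_bound (\<bar>\<xi>2\<bar> * C) l c z s \<tau>"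
    if h: "\<sigma> \<le> s" "\<xi>1 \<le> \<xi>" "\<xi> \<le> \<xi>2" "0 < \<tau>" for z s \<xi> \<tau>
  proof -
    have "\<bar>\<xi> * K z s \<xi> \<tau>\<bar> \<le> \<bar>\<xi>2\<bar> * gauss_bound C l c z s \<tau>"
      using B[OF h] h assms unfolding abs_mult by (intro mult_mono) auto
    then show ?thesis by (simp add: gauss_bound_def)
  qed
  then show ?case using * by (intro exI[of _ "\<bar>\<xi>2\<bar> * C"] exI[of _ l] exI[of _ c]) auto
next
  case (tau K)
  then obtain C l c where *: "0 \<le> C" "0 < l" "0 < c" and
    B: "\<And>z s \<xi> \<tau>. \<sigma> \<le> s \<Longrightarrow> \<xi>1 \<le> \<xi> \<Longrightarrow> \<xi> \<le> \<xi>2 \<Longrightarrow> 0 < \<tau> \<Longrightarrow> \<bar>K z s \<xi> \<tau>\<bar> \<le> gauss_bound C l c z s \<tau>"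
    by auto
  have "\<bar>1 / \<tau> * K z s \<xi> \<tau>\<bar> \<le> gauss_bound (C * (2 / c)) l (c / 2) z s \<tau>"
    if h: "\<sigma> \<le> s" "\<xi>1 \<le> \<xi>" "\<xi> \<le> \<xi>2" "0 < \<tau>" for z s \<xi> \<tau>
  proof -
    have e: "1 / \<tau> * exp (- c / \<tau>) \<le> 2 / c * exp (- (c / 2) / \<tau>)"
      using exp_minus_mult_le[of "1 / \<tau>" "1 / c"] h * by (simp add: field_simps)
    have "\<bar>1 / \<tau> * K z s \<xi> \<tau>\<bar> \<le> 1 / \<tau> * gauss_bound C l c z s \<tau>"
      using B[OF h] h unfolding abs_mult by (intro mult_mono) auto
    also have "\<dots> = C * (heat_kernel CARD('n) z (l * s) * (\<tau> powr (-3/2) * (1 / \<tau> * exp (- c / \<tau>))))"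
      by (simp add: gauss_bound_def)
    also have "\<dots> \<le> C * (heat_kernel CARD('n) z (l * s) * (\<tau> powr (-3/2) * (2 / c * exp (- (c / 2) / \<tau>))))"
      using * by (intro mult_left_mono e) auto
    finally show ?thesis by (simp add: gauss_bound_def mult_ac)
  qed
  then show ?case using * by (intro exI[of _ "C * (2 / c)"] exI[of _ l] exI[of _ "c / 2"]) auto
next
  case (add K L)
  from add.IH(1) obtain C1 l1 c1 where 1: "0 \<le> C1" "0 < l1" "0 < c1" and
    B1: "\<And>z s \<xi> \<tau>. \<sigma> \<le> s \<Longrightarrow> \<xi>1 \<le> \<xi> \<Longrightarrow> \<xi> \<le> \<xi>2 \<Longrightarrow> 0 < \<tau> \<Longrightarrow> \<bar>K z s \<xi> \<tau>\<bar> \<le> gauss_bound C1 l1 c1 z s \<tau>"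
    by auto
  from add.IH(2) obtain C2 l2 c2 where 2: "0 \<le> C2" "0 < l2" "0 < c2" and
    B2: "\<And>z s \<xi> \<tau>. \<sigma> \<le> s \<Longrightarrow> \<xi>1 \<le> \<xi> \<Longrightarrow> \<xi> \<le> \<xi>2 \<Longrightarrow> 0 < \<tau> \<Longrightarrow> \<bar>L z s \<xi> \<tau>\<bar> \<le> gauss_bound C2 l2 c2 z s \<tau>"
    by auto
  define l c where "l = max l1 l2" and "c = min c1 c2"
  define C where "C = C1 * (l / l1) powr (real CARD('n) / 2) + C2 * (l / l2) powr (real CARD('n) / 2)"
  have "\<bar>K z s \<xi> \<tau> + L z s \<xi> \<tau>\<bar> \<le> gauss_bound C l c z s \<tau>"
    if h: "\<sigma> \<le> s" "\<xi>1 \<le> \<xi>" "\<xi> \<le> \<xi>2" "0 < \<tau>" for z s \<xi> \<tau>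
  proof -
    have s0: "0 < s" using h assms by simp
    have "\<bar>K z s \<xi> \<tau> + L z s \<xi> \<tau>\<bar> \<le> gauss_bound C1 l1 c1 z s \<tau> + gauss_bound C2 l2 c2 z s \<tau>"
      using B1[OF h, of z] B2[OF h, of z] by linarith
    also have "\<dots> \<le> gauss_bound (C1 * (l / l1) powr (real CARD('n) / 2)) l c z s \<tau> + gauss_bound (C2 * (l / l2) powr (real CARD('n) / 2)) l c z s \<tau>"
      using 1 2 s0 h by (intro add_mono gauss_bound_weaken) (auto simp: l_def c_def)
    also have "\<dots> = gauss_bound C l c z s \<tau>" by (simp add: gauss_bound_def C_def algebra_simps)
    finally show ?thesis .
  qed
  then show ?case using 1 2 by (intro exI[of _ C] exI[of _ l] exI[of _ c]) (auto simp: C_def l_def c_def)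
next
  case (scale K a)
  then obtain C l c where *: "0 \<le> C" "0 < l" "0 < c" and
    B: "\<And>z s \<xi> \<tau>. \<sigma> \<le> s \<Longrightarrow> \<xi>1 \<le> \<xi> \<Longrightarrow> \<xi> \<le> \<xi>2 \<Longrightarrow> 0 < \<tau> \<Longrightarrow> \<bar>K z s \<xi> \<tau>\<bar> \<le> gauss_bound C l c z s \<tau>"
    by auto
  have "\<bar>a * K z s \<xi> \<tau>\<bar> \<le> gauss_bound (\<bar>a\<bar> * C) l c z s \<tau>"
    if h: "\<sigma> \<le> s" "\<xi>1 \<le> \<xi>" "\<xi> \<le> \<xi>2" "0 < \<tau>" for z s \<xi> \<tau>
    using mult_left_mono[OF B[OF h, of z], of "\<bar>a\<bar>"] by (simp add: abs_mult gauss_bound_def mult.assoc)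
  then show ?case using * by (intro exI[of _ "\<bar>a\<bar> * C"] exI[of _ l] exI[of _ c]) auto
qed

text \<open>The heat kernel has mass one in y, and what is left in \<tau> is the inverse Gamma
  integral with q = 1/2.\<close>

lemma integrable_gauss_bound:
  fixes x0 :: "real^'n"
  assumes "0 \<le> C" "0 < l" "0 < c" "0 < a"
  shows "integrable lborel2 (\<lambda>(y, \<tau>). indicator {0<..} \<tau> * gauss_bound C l c (x0 - y) (a + \<tau>) \<tau>)"
proof (rule integrable_kernelI)
  show "(\<lambda>(y, \<tau>). indicator {0<..} \<tau> * gauss_bound C l c (x0 - y) (a + \<tau>) \<tau>) \<in> borel_measurable lborel2"
    unfolding gauss_bound_def by measurable
  let ?w = "\<lambda>\<tau>. \<tau> powr (-1 - 1/2) * exp (- c / \<tau>)"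
  have "(\<integral>\<^sup>+y. \<bar>indicator {0<..} \<tau> * gauss_bound C l c (x0 - y) (a + \<tau>) \<tau>\<bar> \<partial>lborel) = ennreal C * ennreal (indicator {0<..} \<tau> *\<^sub>R ?w \<tau>)" for \<tau>
  proof (cases "0 < \<tau>")
    case True
    have "(\<integral>\<^sup>+y. \<bar>indicator {0<..} \<tau> * gauss_bound C l c (x0 - y) (a + \<tau>) \<tau>\<bar> \<partial>lborel)
        = (\<integral>\<^sup>+y. \<bar>heat_kernel CARD('n) (x0 - y) (l * (a + \<tau>)) * (C * (\<tau> powr (-3/2) * exp (- c / \<tau>)))\<bar> \<partial>lborel)"
      using True by (simp add: gauss_bound_def mult_ac)
    also have "\<dots> = ennreal (C * (\<tau> powr (-3/2) * exp (- c / \<tau>)))"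
      using nn_integral_heat_lev[of "l * (a + \<tau>)" "C * (\<tau> powr (-3/2) * exp (- c / \<tau>))" x0] True assms by simp
    finally show ?thesis using True assms by (simp add: ennreal_mult)
  qed simp
  then have "(\<integral>\<^sup>+\<tau>. (\<integral>\<^sup>+y. \<bar>indicator {0<..} \<tau> * gauss_bound C l c (x0 - y) (a + \<tau>) \<tau>\<bar> \<partial>lborel) \<partial>lborel)
      = ennreal C * (\<integral>\<^sup>+\<tau>. ennreal (indicator {0<..} \<tau> *\<^sub>R ?w \<tau>) \<partial>lborel)"
    by (simp add: nn_integral_cmult)
  also have "(\<integral>\<^sup>+\<tau>. ennreal (indicator {0<..} \<tau> *\<^sub>R ?w \<tau>) \<partial>lborel) = ennreal (LBINT \<tau>:{0<..}. ?w \<tau>)"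
    using inverse_Gamma_integral(1)[of "1/2" c] assms unfolding set_lebesgue_integral_def set_integrable_def
    by (intro nn_integral_eq_integral) auto
  also have "ennreal C * \<dots> = ennreal (C * (LBINT \<tau>:{0<..}. ?w \<tau>))"
    using assms by (intro ennreal_mult'[symmetric])
  finally show "(\<integral>\<^sup>+\<tau>. (\<integral>\<^sup>+y. \<bar>indicator {0<..} \<tau> * gauss_bound C l c (x0 - y) (a + \<tau>) \<tau>\<bar> \<partial>lborel) \<partial>lborel)
      \<le> ennreal (C * (LBINT \<tau>:{0<..}. ?w \<tau>))" by simp
qed

text \<open>Doubling the time absorbs the shift h, and S \<le> 4 s allows the time to be replaced by
  S. The two normalisations cost factors 2 and 4 under the power, hence the 8; the resulting
  majorant depends on neither h nor s.\<close>

lemma gauss_bound_shift: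
  fixes z h :: "real^'n"
  assumes "0 \<le> C" "0 < l" "0 < c" "norm h \<le> 1" "\<sigma> \<le> s" "s \<le> S" "S \<le> 4 * s" "0 < \<sigma>"
  shows "gauss_bound C l c (z + h) s \<tau> \<le> gauss_bound (C * (8 powr (real CARD('n) / 2) * exp (1 / (4 * (l * \<sigma>))))) (2 * l) c z S \<tau>"
proof -
  define q where "q = real CARD('n) / 2"
  have s: "0 < s" using assms by simp
  have e: "exp ((norm h)\<^sup>2 / (4 * (l * s))) \<le> exp (1 / (4 * (l * \<sigma>)))"
  proof -
    have "(norm h)\<^sup>2 \<le> 1" using assms by (simp add: power_le_one)
    then have "(norm h)\<^sup>2 / (4 * (l * s)) \<le> 1 / (4 * (l * \<sigma>))" using assms s by (intro frac_le) auto
    then show ?thesis by simp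
  qed
  have t: "heat_kernel CARD('n) z (2 * (l * s)) \<le> 4 powr q * heat_kernel CARD('n) z (2 * l * S)"
  proof -
    have "(2 * (l * s) / (2 * l * S)) powr q * heat_kernel CARD('n) z (2 * (l * s)) \<le> heat_kernel CARD('n) z (2 * l * S)"
      unfolding q_def using assms s by (intro heat_kernel_time_mono) auto
    moreover have "(1/4) powr q \<le> (2 * (l * s) / (2 * l * S)) powr q"
      using assms s by (intro powr_mono2) (auto simp: q_def field_simps)
    ultimately have "(1/4) powr q * heat_kernel CARD('n) z (2 * (l * s)) \<le> heat_kernel CARD('n) z (2 * l * S)"
      by (meson heat_kernel_nonneg mult_right_mono order_trans)
    then have "4 powr q * ((1/4) powr q * heat_kernel CARD('n) z (2 * (l * s))) \<le> 4 powr q * heat_kernel CARD('n) z (2 * l * S)"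
      by (intro mult_left_mono) auto
    then show ?thesis by (simp add: mult.assoc[symmetric] powr_mult[symmetric])
  qed
  have "heat_kernel CARD('n) (z + h) (l * s) \<le> 2 powr q * exp ((norm h)\<^sup>2 / (4 * (l * s))) * heat_kernel CARD('n) z (2 * (l * s))"
    unfolding q_def using assms s by (intro heat_kernel_shift_le) auto
  also have "\<dots> \<le> 2 powr q * exp (1 / (4 * (l * \<sigma>))) * (4 powr q * heat_kernel CARD('n) z (2 * l * S))"
    using e t by (intro mult_mono) auto
  also have "\<dots> = 8 powr q * exp (1 / (4 * (l * \<sigma>))) * heat_kernel CARD('n) z (2 * l * S)"
    using powr_mult[of 2 4 q] by simp
  finally have "C * (heat_kernel CARD('n) (z + h) (l * s) * (\<tau> powr (-3/2) * exp (- c / \<tau>)))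
      \<le> C * ((8 powr q * exp (1 / (4 * (l * \<sigma>))) * heat_kernel CARD('n) z (2 * l * S)) * (\<tau> powr (-3/2) * exp (- c / \<tau>)))"
    using assms by (intro mult_left_mono mult_right_mono) auto
  then show ?thesis by (simp add: gauss_bound_def q_def mult_ac)
qed

text \<open>The radius keeps the parameters within a factor of two of a0 and \<xi>0 and the shift of
  the centre below 1. The majorant is evaluated at heat time 2 a0 + \<tau>, which exceeds every a +
  \<tau> from the ball, but by a factor of at most 4 since a \<ge> a0 / 2.\<close>

lemma gauss_kernel_locally_dominated:
  fixes K :: "real^'n \<Rightarrow> real \<Rightarrow> real \<Rightarrow> real \<Rightarrow> real"
  assumes K: "gauss_kernel K" and "0 < a0" "0 < \<xi>0"
  shows "\<exists>g. integrable lborel2 g \<and> (\<forall>w. 0 \<le> g w) \<and>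
    (\<forall>p\<in>ball (x0, a0, \<xi>0) (min 1 (min (a0 / 2) (\<xi>0 / 2))). \<forall>y \<tau>. 0 < \<tau> \<longrightarrow>
      \<bar>K (fst p - y) (fst (snd p) + \<tau>) (snd (snd p)) \<tau>\<bar> \<le> g (y, \<tau>))"
proof -
  obtain C l c where *: "0 \<le> C" "0 < l" "0 < c" and
    B: "\<And>z s \<xi> \<tau>. a0 / 2 \<le> s \<Longrightarrow> \<xi>0 / 2 \<le> \<xi> \<Longrightarrow> \<xi> \<le> 2 * \<xi>0 \<Longrightarrow> 0 < \<tau> \<Longrightarrow> \<bar>K z s \<xi> \<tau>\<bar> \<le> gauss_bound C l c z s \<tau>"
    using gauss_kernel_dominated[OF K, of "a0 / 2" "\<xi>0 / 2" "2 * \<xi>0"] assms by auto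
  define C' where "C' = C * (8 powr (real CARD('n) / 2) * exp (1 / (4 * (l * (a0 / 2)))))"
  define g where "g = (\<lambda>(y, \<tau>). indicator {0<..} \<tau> * gauss_bound C' (2 * l) c (x0 - y) (2 * a0 + \<tau>) \<tau>)"
  have C': "0 \<le> C'" using * by (simp add: C'_def)
  have "integrable lborel2 g"
    unfolding g_def using * assms C' by (intro integrable_gauss_bound) auto
  moreover have "\<forall>w. 0 \<le> g w"
    using C' by (auto simp: g_def gauss_bound_def)
  moreover have "\<bar>K (fst p - y) (fst (snd p) + \<tau>) (snd (snd p)) \<tau>\<bar> \<le> g (y, \<tau>)"
    if p: "p \<in> ball (x0, a0, \<xi>0) (min 1 (min (a0 / 2) (\<xi>0 / 2)))" and t: "0 < \<tau>" for p y \<tau>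
  proof -
    have d: "dist (x0, a0, \<xi>0) p < 1" "dist (x0, a0, \<xi>0) p < a0 / 2" "dist (x0, a0, \<xi>0) p < \<xi>0 / 2"
      using p by auto
    have "dist x0 (fst p) < 1" using dist_fst_le[of "(x0, a0, \<xi>0)" p] d by simp
    then have h: "norm (fst p - x0) \<le> 1" by (simp add: dist_norm norm_minus_commute)
    have "\<bar>a0 - fst (snd p)\<bar> < a0 / 2" "\<bar>\<xi>0 - snd (snd p)\<bar> < \<xi>0 / 2"
      using dist_fst_le[of "(a0, \<xi>0)" "snd p"] dist_snd_le[of "(a0, \<xi>0)" "snd p"] dist_snd_le[of "(x0, a0, \<xi>0)" p] d
      by (simp_all add: dist_real_def)
    then have a: "a0 / 2 \<le> fst (snd p)" "fst (snd p) \<le> 2 * a0" "\<xi>0 / 2 \<le> snd (snd p)" "snd (snd p) \<le> 2 * \<xi>0"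
      using assms by linarith+
    have "\<bar>K (fst p - y) (fst (snd p) + \<tau>) (snd (snd p)) \<tau>\<bar> \<le> gauss_bound C l c ((x0 - y) + (fst p - x0)) (fst (snd p) + \<tau>) \<tau>"
      using B[of "fst (snd p) + \<tau>" "snd (snd p)" \<tau> "fst p - y"] a t by simp
    also have "\<dots> \<le> gauss_bound C' (2 * l) c (x0 - y) (2 * a0 + \<tau>) \<tau>"
      unfolding C'_def using * a t h assms by (intro gauss_bound_shift) auto
    finally show ?thesis using t by (simp add: g_def)
  qed
  ultimately show ?thesis by blast
qed

text \<open>Keeping the components a and \<xi> of p independent lets one derivative serve for both
  space and time. The double integral is taken over a single product measure so that domination is
  needed only once, and the indicator restricts \<tau> to the range where the kernels are
  controlled.\<close>

definition KI :: "(real^'n \<Rightarrow> real \<Rightarrow> real \<Rightarrow> real \<Rightarrow> real) \<Rightarrow> (real^'n \<Rightarrow> real) \<Rightarrow> (real^'n) \<times> real \<times> real \<Rightarrow> real" where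
  "KI K \<psi> p = (\<integral>w. indicator {0<..} (snd w) * (K (fst p - fst w) (fst (snd p) + snd w) (snd (snd p)) (snd w) * \<psi> (fst w))
      \<partial>lborel2)"

abbreviation kernel_deriv_at :: "(real^'n \<Rightarrow> real \<Rightarrow> real \<Rightarrow> real \<Rightarrow> real) \<Rightarrow> (real^'n \<Rightarrow> real^'n \<Rightarrow> real \<Rightarrow> real \<Rightarrow> real \<Rightarrow> real) \<Rightarrow> (real^'n \<Rightarrow> real \<Rightarrow> real \<Rightarrow> real \<Rightarrow> real) \<Rightarrow> (real^'n \<Rightarrow> real \<Rightarrow> real \<Rightarrow> real \<Rightarrow> real) \<Rightarrow> real^'n \<Rightarrow> real \<Rightarrow> real \<Rightarrow> real \<Rightarrow> bool" where
  "kernel_deriv_at K Kz Ks Kx z s \<xi> \<tau> \<equiv> ((\<lambda>p. K (fst p) (fst (snd p)) (snd (snd p)) \<tau>) has_derivative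
    (\<lambda>h. (\<Sum>b\<in>Basis. (fst h \<bullet> b) * Kz b z s \<xi> \<tau>) + fst (snd h) * Ks z s \<xi> \<tau> + snd (snd h) * Kx z s \<xi> \<tau>)) (at (z, s, \<xi>))"

text \<open>The derivative kernels are arguments, not existentially quantified, because the
  differential equations need their explicit form; requiring them to lie in the family allows
  iteration. The derivative is taken at fixed \<tau>: in the integral \<tau> and y merely translate
  (z, s).\<close>

definition kernel_derivs :: "(real^'n \<Rightarrow> real \<Rightarrow> real \<Rightarrow> real \<Rightarrow> real) \<Rightarrow> (real^'n \<Rightarrow> real^'n \<Rightarrow> real \<Rightarrow> real \<Rightarrow> real \<Rightarrow> real)
    \<Rightarrow> (real^'n \<Rightarrow> real \<Rightarrow> real \<Rightarrow> real \<Rightarrow> real) \<Rightarrow> (real^'n \<Rightarrow> real \<Rightarrow> real \<Rightarrow> real \<Rightarrow> real) \<Rightarrow> bool" where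
  "kernel_derivs K Kz Ks Kx \<longleftrightarrow> gauss_kernel K \<and> (\<forall>b\<in>Basis. gauss_kernel (Kz b)) \<and> gauss_kernel Ks \<and> gauss_kernel Kx \<and>
    (\<forall>z s \<xi> \<tau>. 0 < s \<longrightarrow> 0 < \<tau> \<longrightarrow>
      kernel_deriv_at K Kz Ks Kx z s \<xi> \<tau>)"

lemma KI_integrable:
  assumes "gauss_kernel K" "0 < fst (snd p)" "0 < snd (snd p)" and [measurable]: "\<psi> \<in> borel_measurable borel" and C: "\<And>y. \<bar>\<psi> y\<bar> \<le> C"
  shows "integrable lborel2 (\<lambda>w. indicator {0<..} (snd w) * (K (fst p - fst w) (fst (snd p) + snd w) (snd (snd p)) (snd w) * \<psi> (fst w)))"
proof -
  obtain g where g: "integrable lborel2 g" "\<And>w. 0 \<le> g w"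
    "\<And>q y \<tau>. q \<in> ball p (min 1 (min (fst (snd p) / 2) (snd (snd p) / 2))) \<Longrightarrow> 0 < \<tau> \<Longrightarrow>
      \<bar>K (fst q - y) (fst (snd q) + \<tau>) (snd (snd q)) \<tau>\<bar> \<le> g (y, \<tau>)"
    using gauss_kernel_locally_dominated[OF assms(1-3), of "fst p"] by (metis prod.collapse)
  have C0: "0 \<le> C" using C[of undefined] by linarith
  show ?thesis
  proof (rule Bochner_Integration.integrable_bound)
    show "integrable lborel2 (\<lambda>w. g w * C)" using g by simp
    show "AE w in lborel2. norm (indicator {0<..} (snd w) * (K (fst p - fst w) (fst (snd p) + snd w) (snd (snd p)) (snd w) * \<psi> (fst w))) \<le> norm (g w * C)"
    proof (rule AE_I2)
      fix w :: "(real^'a) \<times> real"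
      show "norm (indicator {0<..} (snd w) * (K (fst p - fst w) (fst (snd p) + snd w) (snd (snd p)) (snd w) * \<psi> (fst w))) \<le> norm (g w * C)"
      proof (cases "0 < snd w")
        case True
        have "\<bar>K (fst p - fst w) (fst (snd p) + snd w) (snd (snd p)) (snd w)\<bar> * \<bar>\<psi> (fst w)\<bar> \<le> g w * C"
          using g(3)[of p "snd w" "fst w"] True assms C g(2) by (intro mult_mono) auto
        then show ?thesis using True g(2) C0 by (simp add: abs_mult)
      qed simp
    qed
  qed (intro borel_measurable_times borel_measurable_gauss_kernel[OF assms(1)]; measurable)
qed

text \<open>The passage from p to the arguments (x' - y, a + \<tau>, \<xi>) is a translation, so the
  chain rule adds no factor. The majorant is the sum of those of all partial derivatives, times the
  bound C of \<psi>.\<close>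

lemma KI_has_derivative:
  fixes K :: "real^'n \<Rightarrow> real \<Rightarrow> real \<Rightarrow> real \<Rightarrow> real"
  assumes K: "kernel_derivs K Kz Ks Kx" and p0: "0 < fst (snd p0)" "0 < snd (snd p0)"
    and [measurable]: "\<psi> \<in> borel_measurable borel" and C: "\<And>y. \<bar>\<psi> y\<bar> \<le> C"
  shows "(KI K \<psi> has_derivative (\<lambda>h. (\<Sum>b\<in>Basis. (fst h \<bullet> b) * KI (Kz b) \<psi> p0) + fst (snd h) * KI Ks \<psi> p0 + snd (snd h) * KI Kx \<psi> p0)) (at p0)"
proof -
  have gk: "gauss_kernel K" "\<And>b. b \<in> Basis \<Longrightarrow> gauss_kernel (Kz b)" "gauss_kernel Ks" "gauss_kernel Kx"
    and D: "\<And>z s \<xi> \<tau>. 0 < s \<Longrightarrow> 0 < \<tau> \<Longrightarrow> kernel_deriv_at K Kz Ks Kx z s \<xi> \<tau>"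
    using K by (auto simp: kernel_derivs_def)
  define r where "r = min 1 (min (fst (snd p0) / 2) (snd (snd p0) / 2))"
  have r: "0 < r" using p0 by (simp add: r_def)
  have dom: "\<exists>g. integrable lborel2 g \<and> (\<forall>w. 0 \<le> g w) \<and>
    (\<forall>p\<in>ball p0 r. \<forall>y \<tau>. 0 < \<tau> \<longrightarrow> \<bar>L (fst p - y) (fst (snd p) + \<tau>) (snd (snd p)) \<tau>\<bar> \<le> g (y, \<tau>))" if "gauss_kernel L" for L
    using gauss_kernel_locally_dominated[OF that p0, of "fst p0"] by (simp add: r_def)
  obtain gs where gs: "integrable lborel2 gs" "\<And>w. 0 \<le> gs w"
    "\<And>p y \<tau>. p \<in> ball p0 r \<Longrightarrow> 0 < \<tau> \<Longrightarrow> \<bar>Ks (fst p - y) (fst (snd p) + \<tau>) (snd (snd p)) \<tau>\<bar> \<le> gs (y, \<tau>)"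
    using dom[OF gk(3)] by blast
  obtain gx where gx: "integrable lborel2 gx" "\<And>w. 0 \<le> gx w"
    "\<And>p y \<tau>. p \<in> ball p0 r \<Longrightarrow> 0 < \<tau> \<Longrightarrow> \<bar>Kx (fst p - y) (fst (snd p) + \<tau>) (snd (snd p)) \<tau>\<bar> \<le> gx (y, \<tau>)"
    using dom[OF gk(4)] by blast
  have "\<exists>gz. \<forall>b\<in>Basis. integrable lborel2 (gz b) \<and> (\<forall>w. 0 \<le> gz b w) \<and>
    (\<forall>p\<in>ball p0 r. \<forall>y \<tau>. 0 < \<tau> \<longrightarrow> \<bar>Kz b (fst p - y) (fst (snd p) + \<tau>) (snd (snd p)) \<tau>\<bar> \<le> gz b (y, \<tau>))"
    using dom[OF gk(2)] by (intro bchoice) blast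
  then obtain gz where gz: "\<And>b. b \<in> Basis \<Longrightarrow> integrable lborel2 (gz b)" "\<And>b w. b \<in> Basis \<Longrightarrow> 0 \<le> gz b w"
    "\<And>b p y \<tau>. b \<in> Basis \<Longrightarrow> p \<in> ball p0 r \<Longrightarrow> 0 < \<tau> \<Longrightarrow> \<bar>Kz b (fst p - y) (fst (snd p) + \<tau>) (snd (snd p)) \<tau>\<bar> \<le> gz b (y, \<tau>)"
    by blast
  define g where "g w = ((\<Sum>b\<in>Basis. gz b w) + gs w + gx w) * C" for w
  let ?at = "\<lambda>L p w. L (fst p - fst w) (fst (snd p) + snd w) (snd (snd p)) (snd w) :: real"
  define F where "F p w = indicator {0<..} (snd w) * (?at K p w * \<psi> (fst w))" for p and w :: "(real^'n) \<times> real"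
  define F' where "F' p w h = indicator {0<..} (snd w) *
      (((\<Sum>b\<in>Basis. (fst h \<bullet> b) * ?at (Kz b) p w) + fst (snd h) * ?at Ks p w + snd (snd h) * ?at Kx p w) * \<psi> (fst w))"
    for p and w :: "(real^'n) \<times> real" and h :: "(real^'n) \<times> real \<times> real"
  have C0: "0 \<le> C" using C[of undefined] by linarith
  have pos: "0 < fst (snd p)" if "p \<in> ball p0 r" for p
  proof -
    have "dist p0 p < fst (snd p0) / 2" using that by (simp add: r_def)
    then have "\<bar>fst (snd p0) - fst (snd p)\<bar> < fst (snd p0) / 2"
      using dist_fst_le[of "snd p0" "snd p"] dist_snd_le[of p0 p] by (simp add: dist_real_def)
    then show ?thesis using p0 by linarith
  qed
  have "((\<lambda>p. \<integral>w. F p w \<partial>lborel2) has_derivative (\<lambda>h. \<integral>w. F' p0 w h \<partial>lborel2)) (at p0)"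
  proof (rule has_derivative_integral_dominated[OF r])
    fix p w assume p: "p \<in> ball p0 r"
    show "((\<lambda>p. F p w) has_derivative F' p w) (at p)"
    proof (cases "0 < snd w")
      case True
      have g: "((\<lambda>p. (fst p - fst w, fst (snd p) + snd w, snd (snd p))) has_derivative (\<lambda>h. h)) (at p)"
        by (auto intro!: derivative_eq_intros has_derivative_Pair)
      have "((\<lambda>q. ?at K q w) has_derivative
        (\<lambda>h. (\<Sum>b\<in>Basis. (fst h \<bullet> b) * ?at (Kz b) p w) + fst (snd h) * ?at Ks p w + snd (snd h) * ?at Kx p w)) (at p)"
        using has_derivative_compose[OF g D[of "fst (snd p) + snd w" "snd w" "fst p - fst w" "snd (snd p)"]] True pos[OF p] by simp
      from has_derivative_mult_left[OF this, of "\<psi> (fst w)"] show ?thesis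
        using True by (simp add: F_def[abs_def] F'_def[abs_def])
    qed (simp add: F_def[abs_def] F'_def[abs_def])
  next
    fix p assume p: "p \<in> ball p0 r"
    show "F p \<in> borel_measurable lborel2"
      unfolding F_def[abs_def] by (intro borel_measurable_times borel_measurable_gauss_kernel[OF gk(1)]; measurable)
  next
    fix v
    show "(\<lambda>w. F' p0 w v) \<in> borel_measurable lborel2"
      unfolding F'_def
      by (intro borel_measurable_times borel_measurable_add borel_measurable_sum borel_measurable_gauss_kernel[OF gk(2)]
          borel_measurable_gauss_kernel[OF gk(3)] borel_measurable_gauss_kernel[OF gk(4)]; (assumption | measurable))
  next
    fix p w and v :: "(real^'n) \<times> real \<times> real" assume p: "p \<in> ball p0 r"
    have v: "\<bar>fst v \<bullet> b\<bar> \<le> norm v" if "b \<in> Basis" for b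
      using Basis_le_norm[OF that, of "fst v"] norm_fst_le[of "fst v" "snd v"] by simp
    have v2: "\<bar>fst (snd v)\<bar> \<le> norm v" "\<bar>snd (snd v)\<bar> \<le> norm v"
      using norm_fst_le[of "fst (snd v)" "snd (snd v)"] norm_snd_le[of "snd (snd v)" "fst (snd v)"] norm_snd_le[of "snd v" "fst v"] by auto
    show "\<bar>F' p w v\<bar> \<le> g w * norm v"
    proof (cases "0 < snd w")
      case True
      have "\<bar>(\<Sum>b\<in>Basis. (fst v \<bullet> b) * ?at (Kz b) p w) + fst (snd v) * ?at Ks p w + snd (snd v) * ?at Kx p w\<bar>
        \<le> (\<Sum>b\<in>Basis. \<bar>(fst v \<bullet> b) * ?at (Kz b) p w\<bar>) + \<bar>fst (snd v) * ?at Ks p w\<bar> + \<bar>snd (snd v) * ?at Kx p w\<bar>"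
        by (intro order_trans[OF abs_triangle_ineq] add_mono sum_abs order_refl)
      also have "\<dots> \<le> (\<Sum>b\<in>Basis. norm v * gz b w) + norm v * gs w + norm v * gx w"
        unfolding abs_mult
        using v v2 gz(3)[OF _ p True, of _ "fst w"] gs(3)[OF p True, of "fst w"] gx(3)[OF p True, of "fst w"]
        by (intro add_mono sum_mono mult_mono) auto
      also have "\<dots> = norm v * ((\<Sum>b\<in>Basis. gz b w) + gs w + gx w)" by (simp add: sum_distrib_left algebra_simps)
      finally have "\<bar>(\<Sum>b\<in>Basis. (fst v \<bullet> b) * ?at (Kz b) p w) + fst (snd v) * ?at Ks p w + snd (snd v) * ?at Kx p w\<bar> * \<bar>\<psi> (fst w)\<bar>
          \<le> norm v * ((\<Sum>b\<in>Basis. gz b w) + gs w + gx w) * C"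
        using gz(2) gs(2) gx(2) C by (intro mult_mono) (auto intro!: sum_nonneg mult_nonneg_nonneg add_nonneg_nonneg)
      then show ?thesis using True by (simp add: F'_def g_def abs_mult mult_ac)
    next
      case False
      moreover have "0 \<le> g w"
        unfolding g_def by (intro mult_nonneg_nonneg add_nonneg_nonneg sum_nonneg gz(2) gs(2) gx(2) C0)
      ultimately show ?thesis by (simp add: F'_def)
    qed
  next
    show "integrable lborel2 g" unfolding g_def[abs_def] using gz gs gx by auto
    show "integrable lborel2 (F p0)"
      unfolding F_def[abs_def] by (rule KI_integrable[OF gk(1) p0 _ C]) measurable
  qed
  moreover have "(\<lambda>p. \<integral>w. F p w \<partial>lborel2) = KI K \<psi>"
    by (simp add: fun_eq_iff KI_def F_def)
  moreover have "(\<integral>w. F' p0 w h \<partial>lborel2) = (\<Sum>b\<in>Basis. (fst h \<bullet> b) * KI (Kz b) \<psi> p0) + fst (snd h) * KI Ks \<psi> p0 + snd (snd h) * KI Kx \<psi> p0" for h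
  proof -
    let ?I = "\<lambda>L w. indicator {0<..} (snd w) * (?at L p0 w * \<psi> (fst w))"
    have I: "integrable lborel2 (?I L)" if "gauss_kernel L" for L
      by (rule KI_integrable[OF that p0 _ C]) measurable
    have "F' p0 w h = (\<Sum>b\<in>Basis. (fst h \<bullet> b) * ?I (Kz b) w) + fst (snd h) * ?I Ks w + snd (snd h) * ?I Kx w" for w
      by (simp add: F'_def distrib_left distrib_right sum_distrib_left sum_distrib_right mult_ac)
    then have "(\<integral>w. F' p0 w h \<partial>lborel2)
       = (\<integral>w. (\<Sum>b\<in>Basis. (fst h \<bullet> b) * ?I (Kz b) w) + fst (snd h) * ?I Ks w + snd (snd h) * ?I Kx w \<partial>lborel2)"
      by (simp only:)
    also have "\<dots> = (\<Sum>b\<in>Basis. (fst h \<bullet> b) * (\<integral>w. ?I (Kz b) w \<partial>lborel2))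
        + fst (snd h) * (\<integral>w. ?I Ks w \<partial>lborel2) + snd (snd h) * (\<integral>w. ?I Kx w \<partial>lborel2)"
    proof -
      have 1: "integrable lborel2 (\<lambda>w. (fst h \<bullet> b) * ?I (Kz b) w)" if "b \<in> Basis" for b
        by (rule integrable_mult_right[OF I[OF gk(2)[OF that]]])
      have 2: "integrable lborel2 (\<lambda>w. \<Sum>b\<in>Basis. (fst h \<bullet> b) * ?I (Kz b) w)"
        by (rule Bochner_Integration.integrable_sum[OF 1])
      have 3: "integrable lborel2 (\<lambda>w. fst (snd h) * ?I Ks w)"
        by (rule integrable_mult_right[OF I[OF gk(3)]])
      have 4: "integrable lborel2 (\<lambda>w. snd (snd h) * ?I Kx w)"
        by (rule integrable_mult_right[OF I[OF gk(4)]])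
      have 5: "(\<integral>w. (\<Sum>b\<in>Basis. (fst h \<bullet> b) * ?I (Kz b) w) \<partial>lborel2)
          = (\<Sum>b\<in>Basis. \<integral>w. (fst h \<bullet> b) * ?I (Kz b) w \<partial>lborel2)"
        by (rule Bochner_Integration.integral_sum[OF 1])
      show ?thesis
        unfolding Bochner_Integration.integral_add[OF Bochner_Integration.integrable_add[OF 2 3] 4]
          Bochner_Integration.integral_add[OF 2 3] 5 integral_mult_right_zero ..
    qed
    finally show ?thesis by (simp only: KI_def)
  qed
  ultimately show ?thesis by simp
qed

section \<open>Derivatives of the kernels in the family\<close>

lemma kernel_derivs_base:
  "kernel_derivs (\<lambda>z s \<xi> \<tau>. heat_kernel CARD('n) (z::real^'n) s * (\<tau> powr (-3/2) * exp (- \<xi>\<^sup>2 / (4 * \<tau>))))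
    (\<lambda>b z s \<xi> \<tau>. (-1/2) * ((z \<bullet> b) / s * (heat_kernel CARD('n) z s * (\<tau> powr (-3/2) * exp (- \<xi>\<^sup>2 / (4 * \<tau>))))))
    (\<lambda>z s \<xi> \<tau>. (\<Sum>b\<in>Basis. (1/4) * ((z \<bullet> b) / s * ((z \<bullet> b) / s * (heat_kernel CARD('n) z s * (\<tau> powr (-3/2) * exp (- \<xi>\<^sup>2 / (4 * \<tau>)))))))
      + (- real CARD('n) / 2) * (1 / s * (heat_kernel CARD('n) z s * (\<tau> powr (-3/2) * exp (- \<xi>\<^sup>2 / (4 * \<tau>))))))
    (\<lambda>z s \<xi> \<tau>. (-1/2) * (\<xi> * (1 / \<tau> * (heat_kernel CARD('n) z s * (\<tau> powr (-3/2) * exp (- \<xi>\<^sup>2 / (4 * \<tau>)))))))"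
  (is "kernel_derivs ?B ?Bz ?Bs ?Bx")
  unfolding kernel_derivs_def
proof (intro conjI ballI allI impI)
  show "gauss_kernel ?B" by (rule gauss_kernel.base)
  show "gauss_kernel (?Bz b)" if "b \<in> Basis" for b
    using that by (intro gauss_kernel.scale gauss_kernel.space gauss_kernel.base)
  show "gauss_kernel ?Bs"
    by (intro gauss_kernel.add gauss_kernel_sum gauss_kernel.scale gauss_kernel.space gauss_kernel.time gauss_kernel.base) auto
  show "gauss_kernel ?Bx" by (intro gauss_kernel.scale gauss_kernel.xi gauss_kernel.tau gauss_kernel.base)
next
  fix z :: "real^'n" and s \<xi> \<tau> :: real
  assume s: "0 < s" and \<tau>: "0 < \<tau>"
  define d where "d = real CARD('n)"
  \<comment> \<open>The power and both Gaussians are merged into one exponential, so that a single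
    exponent has to be differentiated. Writing the power through \<open>ln\<close> uses s > 0, hence
    the transfer on an open set at the end.\<close>
  define f where "f p = exp (- d / 2 * ln (4 * pi * fst (snd p)) - (fst p \<bullet> fst p) / (4 * fst (snd p)) - (snd (snd p))\<^sup>2 / (4 * \<tau>))"
    for p :: "(real^'n) \<times> real \<times> real"
  have eq: "\<tau> powr (-3/2) * f p = ?B (fst p) (fst (snd p)) (snd (snd p)) \<tau>" if "0 < fst (snd p)" for p
  proof -
    have "f p = exp (- d / 2 * ln (4 * pi * fst (snd p))) * exp (- (fst p \<bullet> fst p) / (4 * fst (snd p))) * exp (- (snd (snd p))\<^sup>2 / (4 * \<tau>))"
      unfolding f_def by (simp flip: exp_add)
    moreover have "(4 * pi * fst (snd p)) powr - (real CARD('n) / 2) = exp (- d / 2 * ln (4 * pi * fst (snd p)))"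
      using that by (simp add: powr_def d_def)
    ultimately show ?thesis by (simp add: heat_kernel_def power2_norm_eq_inner)
  qed
  have "((\<lambda>p. - d / 2 * ln (4 * pi * fst (snd p)) - (fst p \<bullet> fst p) / (4 * fst (snd p)) - (snd (snd p))\<^sup>2 / (4 * \<tau>)) has_derivative
      (\<lambda>h. - d / 2 * (fst (snd h) / s) - (2 * (z \<bullet> fst h) / (4 * s) - (z \<bullet> z) * (4 * fst (snd h)) / (4 * s)\<^sup>2)
      - 2 * \<xi> * snd (snd h) / (4 * \<tau>))) (at (z, s, \<xi>))"
    using s \<tau> by (auto intro!: derivative_eq_intros simp: fun_eq_iff inner_commute field_simps power2_eq_square)
  from has_derivative_exp[OF this]
  have "(f has_derivative (\<lambda>h. f (z, s, \<xi>) * (- d / 2 * (fst (snd h) / s) - (2 * (z \<bullet> fst h) / (4 * s) - (z \<bullet> z) * (4 * fst (snd h)) / (4 * s)\<^sup>2)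
      - 2 * \<xi> * snd (snd h) / (4 * \<tau>)))) (at (z, s, \<xi>))"
    unfolding f_def by (simp only: mult.commute fst_conv snd_conv)
  note Df = has_derivative_mult_right[OF this, of "\<tau> powr (-3/2)"]
  have eq': "\<tau> powr (-3/2) * f (z, s, \<xi>) = ?B z s \<xi> \<tau>" using eq[of "(z, s, \<xi>)"] s by simp
  have "((\<lambda>p. \<tau> powr (-3/2) * f p) has_derivative (\<lambda>h. ?B z s \<xi> \<tau> * (- d / 2 * (fst (snd h) / s) - (2 * (z \<bullet> fst h) / (4 * s) - (z \<bullet> z) * (4 * fst (snd h)) / (4 * s)\<^sup>2)
      - 2 * \<xi> * snd (snd h) / (4 * \<tau>)))) (at (z, s, \<xi>))"
    using Df unfolding eq'[symmetric] mult.assoc .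
  moreover have "(\<lambda>h. ?B z s \<xi> \<tau> * (- d / 2 * (fst (snd h) / s) - (2 * (z \<bullet> fst h) / (4 * s) - (z \<bullet> z) * (4 * fst (snd h)) / (4 * s)\<^sup>2)
      - 2 * \<xi> * snd (snd h) / (4 * \<tau>))) =
    (\<lambda>h. (\<Sum>b\<in>Basis. (fst h \<bullet> b) * ?Bz b z s \<xi> \<tau>) + fst (snd h) * ?Bs z s \<xi> \<tau> + snd (snd h) * ?Bx z s \<xi> \<tau>)"
  proof
    fix h :: "(real^'n) \<times> real \<times> real"
    define B where "B = ?B z s \<xi> \<tau>"
    have 1: "(\<Sum>b\<in>Basis. (fst h \<bullet> b) * ((-1/2) * ((z \<bullet> b) / s * B))) = (-1/2) * (z \<bullet> fst h) / s * B"
      by (subst euclidean_inner) (simp add: sum_distrib_left sum_distrib_right sum_divide_distrib mult_ac sum_negf)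
    have 2: "(\<Sum>b\<in>Basis. (1/4) * ((z \<bullet> b) / s * ((z \<bullet> b) / s * B))) = (1/4) * (z \<bullet> z) / s\<^sup>2 * B"
      unfolding euclidean_inner[of z z] by (simp add: sum_distrib_left sum_distrib_right sum_divide_distrib power2_eq_square mult_ac)
    show "?B z s \<xi> \<tau> * (- d / 2 * (fst (snd h) / s) - (2 * (z \<bullet> fst h) / (4 * s) - (z \<bullet> z) * (4 * fst (snd h)) / (4 * s)\<^sup>2)
      - 2 * \<xi> * snd (snd h) / (4 * \<tau>)) = (\<Sum>b\<in>Basis. (fst h \<bullet> b) * ?Bz b z s \<xi> \<tau>) + fst (snd h) * ?Bs z s \<xi> \<tau> + snd (snd h) * ?Bx z s \<xi> \<tau>"
      unfolding B_def[symmetric] 1 2 using s \<tau> by (simp add: d_def field_simps power2_eq_square)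
  qed
  ultimately have "((\<lambda>p. \<tau> powr (-3/2) * f p) has_derivative
      (\<lambda>h. (\<Sum>b\<in>Basis. (fst h \<bullet> b) * ?Bz b z s \<xi> \<tau>) + fst (snd h) * ?Bs z s \<xi> \<tau> + snd (snd h) * ?Bx z s \<xi> \<tau>)) (at (z, s, \<xi>))"
    by simp
  then show "((\<lambda>p. ?B (fst p) (fst (snd p)) (snd (snd p)) \<tau>) has_derivative
      (\<lambda>h. (\<Sum>b\<in>Basis. (fst h \<bullet> b) * ?Bz b z s \<xi> \<tau>) + fst (snd h) * ?Bs z s \<xi> \<tau> + snd (snd h) * ?Bx z s \<xi> \<tau>)) (at (z, s, \<xi>))"
  proof (rule has_derivative_transform_within_open)
    show "open {p :: (real^'n) \<times> real \<times> real. 0 < fst (snd p)}"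
      by (intro open_Collect_less continuous_intros)
  qed (use s eq in auto)
qed

lemma kernel_derivs_scale:
  assumes K: "kernel_derivs K Kz Ks Kx"
  shows "kernel_derivs (\<lambda>z s \<xi> \<tau>. c * K z s \<xi> \<tau>) (\<lambda>b z s \<xi> \<tau>. c * Kz b z s \<xi> \<tau>) (\<lambda>z s \<xi> \<tau>. c * Ks z s \<xi> \<tau>) (\<lambda>z s \<xi> \<tau>. c * Kx z s \<xi> \<tau>)"
  unfolding kernel_derivs_def
proof (intro conjI ballI allI impI)
  fix z and s \<xi> \<tau> :: real assume "0 < s" "0 < \<tau>"
  then have D: "kernel_deriv_at K Kz Ks Kx z s \<xi> \<tau>"
    using K unfolding kernel_derivs_def by blast
  show "((\<lambda>p. c * K (fst p) (fst (snd p)) (snd (snd p)) \<tau>) has_derivative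
        (\<lambda>h. (\<Sum>b\<in>Basis. (fst h \<bullet> b) * (c * Kz b z s \<xi> \<tau>)) + fst (snd h) * (c * Ks z s \<xi> \<tau>) + snd (snd h) * (c * Kx z s \<xi> \<tau>))) (at (z, s, \<xi>))"
    by (rule has_derivative_eq_rhs[OF has_derivative_mult_right[OF D, of c]])
      (simp add: fun_eq_iff distrib_left sum_distrib_left mult.left_commute)
qed (use K in \<open>auto simp: kernel_derivs_def intro: gauss_kernel.scale\<close>)

lemma kernel_derivs_add:
  assumes K: "kernel_derivs K Kz Ks Kx" and L: "kernel_derivs L Lz Ls Lx"
  shows "kernel_derivs (\<lambda>z s \<xi> \<tau>. K z s \<xi> \<tau> + L z s \<xi> \<tau>) (\<lambda>b z s \<xi> \<tau>. Kz b z s \<xi> \<tau> + Lz b z s \<xi> \<tau>)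
    (\<lambda>z s \<xi> \<tau>. Ks z s \<xi> \<tau> + Ls z s \<xi> \<tau>) (\<lambda>z s \<xi> \<tau>. Kx z s \<xi> \<tau> + Lx z s \<xi> \<tau>)"
  unfolding kernel_derivs_def
proof (intro conjI ballI allI impI)
  fix z and s \<xi> \<tau> :: real assume "0 < s" "0 < \<tau>"
  then have D: "kernel_deriv_at K Kz Ks Kx z s \<xi> \<tau>"
    and E: "kernel_deriv_at L Lz Ls Lx z s \<xi> \<tau>"
    using K L unfolding kernel_derivs_def by blast+
  show "((\<lambda>p. K (fst p) (fst (snd p)) (snd (snd p)) \<tau> + L (fst p) (fst (snd p)) (snd (snd p)) \<tau>) has_derivative
        (\<lambda>h. (\<Sum>b\<in>Basis. (fst h \<bullet> b) * (Kz b z s \<xi> \<tau> + Lz b z s \<xi> \<tau>)) + fst (snd h) * (Ks z s \<xi> \<tau> + Ls z s \<xi> \<tau>)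
          + snd (snd h) * (Kx z s \<xi> \<tau> + Lx z s \<xi> \<tau>))) (at (z, s, \<xi>))"
    by (rule has_derivative_eq_rhs[OF has_derivative_add[OF D E]])
      (simp add: fun_eq_iff distrib_left sum.distrib)
qed (use K L in \<open>auto simp: kernel_derivs_def intro: gauss_kernel.add\<close>)

lemma kernel_derivs_xi:
  assumes K: "kernel_derivs K Kz Ks Kx"
  shows "kernel_derivs (\<lambda>z s \<xi> \<tau>. \<xi> * K z s \<xi> \<tau>) (\<lambda>b z s \<xi> \<tau>. \<xi> * Kz b z s \<xi> \<tau>) (\<lambda>z s \<xi> \<tau>. \<xi> * Ks z s \<xi> \<tau>)
    (\<lambda>z s \<xi> \<tau>. K z s \<xi> \<tau> + \<xi> * Kx z s \<xi> \<tau>)"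
  unfolding kernel_derivs_def
proof (intro conjI ballI allI impI)
  fix z and s \<xi> \<tau> :: real assume "0 < s" "0 < \<tau>"
  then have D: "kernel_deriv_at K Kz Ks Kx z s \<xi> \<tau>"
    using K unfolding kernel_derivs_def by blast
  have E: "((\<lambda>p. snd (snd p)) has_derivative (\<lambda>h. snd (snd h))) (at (z, s, \<xi>))"
    by (intro bounded_linear_imp_has_derivative bounded_linear_snd_comp bounded_linear_snd)
  show "((\<lambda>p. snd (snd p) * K (fst p) (fst (snd p)) (snd (snd p)) \<tau>) has_derivative
        (\<lambda>h. (\<Sum>b\<in>Basis. (fst h \<bullet> b) * (\<xi> * Kz b z s \<xi> \<tau>)) + fst (snd h) * (\<xi> * Ks z s \<xi> \<tau>)
          + snd (snd h) * (K z s \<xi> \<tau> + \<xi> * Kx z s \<xi> \<tau>))) (at (z, s, \<xi>))"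
    by (rule has_derivative_eq_rhs[OF has_derivative_mult[OF E D]])
      (simp add: fun_eq_iff distrib_left sum_distrib_left mult.left_commute)
qed (use K in \<open>auto simp: kernel_derivs_def intro: gauss_kernel.add gauss_kernel.xi\<close>)

lemma kernel_derivs_tau:
  assumes K: "kernel_derivs K Kz Ks Kx"
  shows "kernel_derivs (\<lambda>z s \<xi> \<tau>. 1 / \<tau> * K z s \<xi> \<tau>) (\<lambda>b z s \<xi> \<tau>. 1 / \<tau> * Kz b z s \<xi> \<tau>) (\<lambda>z s \<xi> \<tau>. 1 / \<tau> * Ks z s \<xi> \<tau>)
    (\<lambda>z s \<xi> \<tau>. 1 / \<tau> * Kx z s \<xi> \<tau>)"
  unfolding kernel_derivs_def
proof (intro conjI ballI allI impI)
  fix z and s \<xi> \<tau> :: real assume "0 < s" "0 < \<tau>"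
  then have D: "kernel_deriv_at K Kz Ks Kx z s \<xi> \<tau>"
    using K unfolding kernel_derivs_def by blast
  show "((\<lambda>p. 1 / \<tau> * K (fst p) (fst (snd p)) (snd (snd p)) \<tau>) has_derivative
        (\<lambda>h. (\<Sum>b\<in>Basis. (fst h \<bullet> b) * (1 / \<tau> * Kz b z s \<xi> \<tau>)) + fst (snd h) * (1 / \<tau> * Ks z s \<xi> \<tau>) + snd (snd h) * (1 / \<tau> * Kx z s \<xi> \<tau>))) (at (z, s, \<xi>))"
    by (rule has_derivative_eq_rhs[OF has_derivative_mult_right[OF D, of "1 / \<tau>"]])
      (simp add: fun_eq_iff add_divide_distrib sum_divide_distrib)
qed (use K in \<open>auto simp only: kernel_derivs_def intro!: gauss_kernel.tau\<close>)

text \<open>The product rule, where (z . i) / s contributes i . b in direction b and minus (z . i) /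
  s^2 in s. Products are arranged so that every term is literally built by the rules of
  \<open>gauss_kernel\<close>.\<close>

lemma kernel_derivs_space:
  fixes K :: "real^'n \<Rightarrow> real \<Rightarrow> real \<Rightarrow> real \<Rightarrow> real"
  assumes K: "kernel_derivs K Kz Ks Kx" and i: "i \<in> Basis"
  shows "kernel_derivs (\<lambda>z s \<xi> \<tau>. (z \<bullet> i) / s * K z s \<xi> \<tau>)
    (\<lambda>b z s \<xi> \<tau>. (i \<bullet> b) * (1 / s * K z s \<xi> \<tau>) + (z \<bullet> i) / s * Kz b z s \<xi> \<tau>)
    (\<lambda>z s \<xi> \<tau>. (-1) * (1 / s * ((z \<bullet> i) / s * K z s \<xi> \<tau>)) + (z \<bullet> i) / s * Ks z s \<xi> \<tau>)
    (\<lambda>z s \<xi> \<tau>. (z \<bullet> i) / s * Kx z s \<xi> \<tau>)"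
  unfolding kernel_derivs_def
proof (intro conjI ballI allI impI)
  have gk: "gauss_kernel K" "\<And>b. b \<in> Basis \<Longrightarrow> gauss_kernel (Kz b)" "gauss_kernel Ks" "gauss_kernel Kx"
    using K by (auto simp: kernel_derivs_def)
  show "gauss_kernel (\<lambda>z s \<xi> \<tau>. (z \<bullet> i) / s * K z s \<xi> \<tau>)"
    "gauss_kernel (\<lambda>z s \<xi> \<tau>. (z \<bullet> i) / s * Kx z s \<xi> \<tau>)"
    "gauss_kernel (\<lambda>z s \<xi> \<tau>. (-1) * (1 / s * ((z \<bullet> i) / s * K z s \<xi> \<tau>)) + (z \<bullet> i) / s * Ks z s \<xi> \<tau>)"
    by (intro gauss_kernel.add gauss_kernel.scale gauss_kernel.time gauss_kernel.space gk i)+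
  show "gauss_kernel (\<lambda>z s \<xi> \<tau>. (i \<bullet> b) * (1 / s * K z s \<xi> \<tau>) + (z \<bullet> i) / s * Kz b z s \<xi> \<tau>)" if "b \<in> Basis" for b
    by (intro gauss_kernel.add gauss_kernel.scale gauss_kernel.time gauss_kernel.space gk i that)
next
  fix z and s \<xi> \<tau> :: real assume s: "0 < s" and "0 < \<tau>"
  then have D: "kernel_deriv_at K Kz Ks Kx z s \<xi> \<tau>"
    using K unfolding kernel_derivs_def by blast
  have E: "((\<lambda>p. (fst p \<bullet> i) / fst (snd p)) has_derivative (\<lambda>h. (fst h \<bullet> i) / s - (z \<bullet> i) * fst (snd h) / (s * s))) (at (z, s, \<xi>))"
    using s by (auto intro!: derivative_eq_intros simp: fun_eq_iff field_simps)
  have "(\<Sum>b\<in>Basis. (fst h \<bullet> b) * ((i \<bullet> b) * (1 / s * K z s \<xi> \<tau>) + (z \<bullet> i) / s * Kz b z s \<xi> \<tau>))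
      = (fst h \<bullet> i) * (1 / s * K z s \<xi> \<tau>) + (z \<bullet> i) / s * (\<Sum>b\<in>Basis. (fst h \<bullet> b) * Kz b z s \<xi> \<tau>)"
    for h :: "(real^'n) \<times> real \<times> real"
    unfolding euclidean_inner[of "fst h" i] sum_distrib_left sum_distrib_right sum.distrib[symmetric]
    by (intro sum.cong refl) (simp add: distrib_left mult_ac)
  then show "((\<lambda>p. (fst p \<bullet> i) / fst (snd p) * K (fst p) (fst (snd p)) (snd (snd p)) \<tau>) has_derivative
    (\<lambda>h. (\<Sum>b\<in>Basis. (fst h \<bullet> b) * ((i \<bullet> b) * (1 / s * K z s \<xi> \<tau>) + (z \<bullet> i) / s * Kz b z s \<xi> \<tau>)) +
      fst (snd h) * ((-1) * (1 / s * ((z \<bullet> i) / s * K z s \<xi> \<tau>)) + (z \<bullet> i) / s * Ks z s \<xi> \<tau>) + snd (snd h) * ((z \<bullet> i) / s * Kx z s \<xi> \<tau>))) (at (z, s, \<xi>))"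
    by (intro has_derivative_eq_rhs[OF has_derivative_mult[OF E D]])
      (simp add: fun_eq_iff algebra_simps diff_divide_distrib add_divide_distrib)
qed

section \<open>The classical solution\<close>

text \<open>For \<tau> > 0 this is the heat kernel times \<open>lev\<close>, spelled out so that it
  is an instance of the rules \<open>base\<close>, \<open>xi\<close> and
  \<open>scale\<close>.\<close>

definition heat_lev_kernel :: "real^'n \<Rightarrow> real \<Rightarrow> real \<Rightarrow> real \<Rightarrow> real" where
  "heat_lev_kernel z s \<xi> \<tau> = (4 * pi) powr (-1/2) * (\<xi> * (heat_kernel CARD('n) z s * (\<tau> powr (-3/2) * exp (- \<xi>\<^sup>2 / (4 * \<tau>)))))"

lemma heat_lev_kernel_eq: "0 < \<tau> \<Longrightarrow> heat_lev_kernel (z::real^'n) s \<xi> \<tau> = heat_kernel CARD('n) z s * lev \<xi> \<tau>"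
  by (simp add: heat_lev_kernel_def lev_eq)

text \<open>Closed forms are given for the three derivatives that enter the equations. The
  s-derivative equals the Laplacian in z, which is the heat equation; the factor in the second
  \<xi>-derivative is the one that a \<tau>-derivative puts on \<open>lev\<close>.\<close>

lemma heat_lev_kernel_derivs:
  obtains Kz Ks Kx Kzz Kzs Kzx Kxz Kxs Kxx where
    "kernel_derivs (heat_lev_kernel :: real^'n \<Rightarrow> _) Kz Ks Kx"
    "\<And>i. i \<in> Basis \<Longrightarrow> kernel_derivs (Kz i) (Kzz i) (Kzs i) (Kzx i)"
    "kernel_derivs Kx Kxz Kxs Kxx"
    "\<And>z s \<xi> \<tau>. 0 < s \<Longrightarrow> 0 < \<tau> \<Longrightarrow>
      Ks z s \<xi> \<tau> = ((norm z)\<^sup>2 / (4 * s\<^sup>2) - real CARD('n) / (2 * s)) * heat_lev_kernel z s \<xi> \<tau>"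
    "\<And>z s \<xi> \<tau>. 0 < s \<Longrightarrow> 0 < \<tau> \<Longrightarrow>
      (\<Sum>i\<in>Basis. Kzz i i z s \<xi> \<tau>) = ((norm z)\<^sup>2 / (4 * s\<^sup>2) - real CARD('n) / (2 * s)) * heat_lev_kernel z s \<xi> \<tau>"
    "\<And>z s \<xi> \<tau>. 0 < s \<Longrightarrow> 0 < \<tau> \<Longrightarrow>
      Kxx z s \<xi> \<tau> = (\<xi>\<^sup>2 / (4 * \<tau>\<^sup>2) - 3 / (2 * \<tau>)) * heat_lev_kernel z s \<xi> \<tau>"
proof -
  define B where "B = (\<lambda>(z::real^'n) s \<xi> \<tau>. heat_kernel CARD('n) z s * (\<tau> powr (-3/2) * exp (- \<xi>\<^sup>2 / (4 * \<tau>))))"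
  define c :: real where "c = (4 * pi) powr (-1/2)"
  have K0: "heat_lev_kernel = (\<lambda>z s \<xi> \<tau>. c * (\<xi> * B z s \<xi> \<tau>))"
    by (simp add: fun_eq_iff heat_lev_kernel_def B_def c_def)
  have kB: "kernel_derivs B (\<lambda>b z s \<xi> \<tau>. (-1/2) * ((z \<bullet> b) / s * B z s \<xi> \<tau>))
    (\<lambda>z s \<xi> \<tau>. (\<Sum>b\<in>Basis. (1/4) * ((z \<bullet> b) / s * ((z \<bullet> b) / s * B z s \<xi> \<tau>))) + (- real CARD('n) / 2) * (1 / s * B z s \<xi> \<tau>))
    (\<lambda>z s \<xi> \<tau>. (-1/2) * (\<xi> * (1 / \<tau> * B z s \<xi> \<tau>)))"
    unfolding B_def by (rule kernel_derivs_base)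
  note k0 = kernel_derivs_scale[OF kernel_derivs_xi[OF kB], of c]
  note kz = kernel_derivs_scale[OF kernel_derivs_xi[OF kernel_derivs_scale[OF kernel_derivs_space[OF kB], of _ "-1/2"]], of _ c]
  note kx = kernel_derivs_scale[OF kernel_derivs_add[OF kB kernel_derivs_xi[OF kernel_derivs_scale[OF
        kernel_derivs_xi[OF kernel_derivs_tau[OF kB]], of "-1/2"]]], of c]
  have sum4: "(\<Sum>b\<in>Basis. ((z::real^'n) \<bullet> b) * (z \<bullet> b)) = (norm z)\<^sup>2" for z
    unfolding power2_norm_eq_inner by (rule euclidean_inner[symmetric])
  have S1: "(\<Sum>b\<in>Basis. (1/4) * ((z \<bullet> b) / s * ((z \<bullet> b) / s * X))) = (norm z)\<^sup>2 / (4 * s\<^sup>2) * X" for z :: "real^'n" and s X :: real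
    unfolding sum4[symmetric] by (simp add: sum_distrib_left sum_distrib_right sum_divide_distrib power2_eq_square mult_ac)
  \<comment> \<open>The Laplacian in z: summing i . i over the orthonormal basis produces the
    dimension, and the squares (z . i)^2 add up to |z|^2.\<close>
  have S2: "(\<Sum>i\<in>Basis. (-1/2) * ((i \<bullet> i) * (1 / s * X) + (z \<bullet> i) / s * ((-1/2) * ((z \<bullet> i) / s * X))))
      = ((norm z)\<^sup>2 / (4 * s\<^sup>2) - real CARD('n) / (2 * s)) * X" for z :: "real^'n" and s X :: real
  proof -
    have "(\<Sum>i\<in>Basis. (-1/2) * ((i \<bullet> i) * (1 / s * X) + (z \<bullet> i) / s * ((-1/2) * ((z \<bullet> i) / s * X))))
       = (\<Sum>i\<in>(Basis :: (real^'n) set). (-1/2) * (1 / s * X) + (1/4) * ((z \<bullet> i) / s * ((z \<bullet> i) / s * X)))"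
      by (intro sum.cong refl) (simp add: inner_same_Basis algebra_simps)
    also have "\<dots> = real CARD('n) * ((-1/2) * (1 / s * X)) + (norm z)\<^sup>2 / (4 * s\<^sup>2) * X"
      unfolding sum.distrib S1 by simp
    finally show ?thesis by (simp add: algebra_simps)
  qed
  show ?thesis
    apply (rule that[unfolded K0])
         apply (rule k0)
        apply (erule kz)
       apply (rule kx)
    subgoal unfolding S1 by (simp add: algebra_simps)
    subgoal unfolding sum_distrib_left[symmetric] S2[unfolded sum_distrib_left[symmetric]] by (simp add: algebra_simps)
    subgoal by (simp add: field_simps power2_eq_square)
    done
qed

lemma KI_cong:
  assumes "0 < fst (snd p)"
    and "\<And>z s \<tau>. 0 < s \<Longrightarrow> 0 < \<tau> \<Longrightarrow> K z s (snd (snd p)) \<tau> = L z s (snd (snd p)) \<tau>"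
  shows "KI K \<psi> p = KI L \<psi> p"
  unfolding KI_def using assms by (intro Bochner_Integration.integral_cong) (auto split: split_indicator)

lemma KI_sum:
  assumes "finite A" "\<And>i. i \<in> A \<Longrightarrow> gauss_kernel (K i)" "0 < fst (snd p)" "0 < snd (snd p)" "\<psi> \<in> borel_measurable borel" "\<And>y. \<bar>\<psi> y\<bar> \<le> C"
  shows "KI (\<lambda>z s \<xi> \<tau>. \<Sum>i\<in>A. K i z s \<xi> \<tau>) \<psi> p = (\<Sum>i\<in>A. KI (K i) \<psi> p)"
proof -
  have "(\<Sum>i\<in>A. KI (K i) \<psi> p) = (\<integral>w. (\<Sum>i\<in>A. indicator {0<..} (snd w) * (K i (fst p - fst w) (fst (snd p) + snd w) (snd (snd p)) (snd w) * \<psi> (fst w)))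
      \<partial>lborel2)"
    unfolding KI_def by (intro Bochner_Integration.integral_sum[symmetric] KI_integrable[where C=C] assms(2-6))
  then show ?thesis by (simp add: KI_def sum_distrib_left sum_distrib_right)
qed

lemma heat_kernel_time_deriv:
  assumes "0 < s"
  shows "((\<lambda>s. heat_kernel d z s) has_real_derivative ((norm z)\<^sup>2 / (4 * s\<^sup>2) - real d / (2 * s)) * heat_kernel d z s) (at s)"
proof -
  have "(4 * pi * s) powr (- (real d / 2) - 1) = (4 * pi * s) powr (- (real d / 2)) / (4 * pi * s)"
    using assms by (simp add: powr_diff)
  then show ?thesis
    unfolding heat_kernel_def using assms
    by (auto intro!: derivative_eq_intros simp: field_simps power2_eq_square)
qed

lemma lev_time_deriv:
  assumes "0 < \<tau>"
  shows "((\<lambda>\<tau>. lev \<xi> \<tau>) has_real_derivative (\<xi>\<^sup>2 / (4 * \<tau>\<^sup>2) - 3 / (2 * \<tau>)) * lev \<xi> \<tau>) (at \<tau>)"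
proof -
  have 1: "((\<lambda>\<tau>. \<xi> / \<tau>) has_real_derivative - \<xi> / \<tau>\<^sup>2) (at \<tau>)"
    using assms by (auto intro!: derivative_eq_intros simp: power2_eq_square)
  have 2: "((\<lambda>\<tau>. heat_kernel 1 \<xi> \<tau>) has_real_derivative (\<xi>\<^sup>2 / (4 * \<tau>\<^sup>2) - 1 / (2 * \<tau>)) * heat_kernel 1 \<xi> \<tau>) (at \<tau>)"
    using heat_kernel_time_deriv[OF assms, of 1 \<xi>] by simp
  show ?thesis
    unfolding lev_def
    by (rule DERIV_cong[OF DERIV_mult[OF 1 2]]) (use assms in \<open>simp add: field_simps power2_eq_square\<close>)
qed

text \<open>\<open>w\<close> is the \<tau>-derivative of \<open>W\<close>, and \<open>W\<close>
  vanishes at both ends: at 0 because of exp (- \<xi>^2 / (4 \<tau>)), at infinity because of the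
  power -3/2. The heat factor stays bounded since a > 0.\<close>

lemma integral_tau_derivative_heat_lev:
  fixes z :: "real^'n"
  defines "W \<equiv> \<lambda>a \<xi> \<tau>. heat_kernel CARD('n) z (a + \<tau>) * lev \<xi> \<tau>"
  defines "w \<equiv> \<lambda>a \<xi> \<tau>. ((norm z)\<^sup>2 / (4 * (a + \<tau>)\<^sup>2) - real CARD('n) / (2 * (a + \<tau>)) + (\<xi>\<^sup>2 / (4 * \<tau>\<^sup>2) - 3 / (2 * \<tau>))) * W a \<xi> \<tau>"
  assumes "0 < a" "0 < \<xi>" and I: "set_integrable lborel {0<..} (w a \<xi>)"
  shows "(LBINT \<tau>:{0<..}. w a \<xi> \<tau>) = 0"
proof -
  have D: "(W a \<xi> has_real_derivative w a \<xi> \<tau>) (at \<tau>)" if "0 < \<tau>" for \<tau>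
  proof -
    have 1: "((\<lambda>\<tau>. heat_kernel CARD('n) z (a + \<tau>)) has_real_derivative ((norm z)\<^sup>2 / (4 * (a + \<tau>)\<^sup>2) - real CARD('n) / (2 * (a + \<tau>))) * heat_kernel CARD('n) z (a + \<tau>)) (at \<tau>)"
      using DERIV_shift[of "heat_kernel CARD('n) z" _ \<tau> a] heat_kernel_time_deriv[of "a + \<tau>" "CARD('n)" z] assms that
      by (simp add: add.commute)
    show ?thesis unfolding W_def w_def
      by (rule DERIV_cong[OF DERIV_mult[OF 1 lev_time_deriv[OF that]]]) (simp add: algebra_simps)
  qed
  have W_le: "0 \<le> W a \<xi> \<tau>" "W a \<xi> \<tau> \<le> (4 * pi * a) powr (- (real CARD('n) / 2)) * lev \<xi> \<tau>" if "0 < \<tau>" for \<tau>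
  proof -
    have l: "0 \<le> lev \<xi> \<tau>" using that assms by (simp add: lev_nonneg)
    then show "0 \<le> W a \<xi> \<tau>" by (simp add: W_def)
    have "heat_kernel CARD('n) z (a + \<tau>) \<le> (4 * pi * (a + \<tau>)) powr (- (real CARD('n) / 2))"
      using that assms by (simp add: heat_kernel_def mult_left_le)
    also have "\<dots> \<le> (4 * pi * a) powr (- (real CARD('n) / 2))"
      using that assms by (intro powr_mono2') auto
    finally show "W a \<xi> \<tau> \<le> (4 * pi * a) powr (- (real CARD('n) / 2)) * lev \<xi> \<tau>"
      unfolding W_def using l by (rule mult_right_mono)
  qed
  define q where "q = \<xi>\<^sup>2 / 4"
  have q: "0 < q" using assms by (simp add: q_def)
  have lev_q: "lev \<xi> \<tau> = \<xi> * (4 * pi) powr (-1/2) * (\<tau> powr (-3/2) * exp (- q / \<tau>))" if "0 < \<tau>" for \<tau>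
    using that by (simp add: lev_eq q_def)
  have L: "(lev \<xi> \<longlongrightarrow> 0) F" if F: "F = at_right 0 \<or> F = at_top" for F
  proof -
    have 1: "((\<lambda>\<tau>. \<tau> powr (-3/2) * exp (- q / \<tau>)) \<longlongrightarrow> 0) F"
      using F q by (elim disjE; hypsubst; real_asymp)
    have 2: "eventually (\<lambda>\<tau>. 0 < \<tau>) F" using F by (auto simp: eventually_at_right_less eventually_gt_at_top)
    have "((\<lambda>\<tau>. \<xi> * (4 * pi) powr (-1/2) * (\<tau> powr (-3/2) * exp (- q / \<tau>))) \<longlongrightarrow> \<xi> * (4 * pi) powr (-1/2) * 0) F"
      by (intro tendsto_mult tendsto_const 1)
    moreover have "eventually (\<lambda>\<tau>. \<xi> * (4 * pi) powr (-1/2) * (\<tau> powr (-3/2) * exp (- q / \<tau>)) = lev \<xi> \<tau>) F"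
      using 2 by eventually_elim (simp add: lev_q)
    ultimately show ?thesis using Lim_transform_eventually by fastforce
  qed
  have WL: "(W a \<xi> \<longlongrightarrow> 0) F" if F: "F = at_right 0 \<or> F = at_top" for F
  proof (rule tendsto_sandwich)
    have 2: "eventually (\<lambda>\<tau>. 0 < \<tau>) F" using F by (auto simp: eventually_at_right_less eventually_gt_at_top)
    show "eventually (\<lambda>\<tau>. 0 \<le> W a \<xi> \<tau>) F" using 2 by eventually_elim (rule W_le)
    show "eventually (\<lambda>\<tau>. W a \<xi> \<tau> \<le> (4 * pi * a) powr (- (real CARD('n) / 2)) * lev \<xi> \<tau>) F"
      using 2 by eventually_elim (rule W_le)
    show "((\<lambda>\<tau>. (4 * pi * a) powr (- (real CARD('n) / 2)) * lev \<xi> \<tau>) \<longlongrightarrow> 0) F"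
      using tendsto_mult[OF tendsto_const L[OF F], of "(4 * pi * a) powr (- (real CARD('n) / 2))"] by simp
  qed simp
  have "(LBINT \<tau>=0..\<infinity>. w a \<xi> \<tau>) = 0 - 0"
  proof (rule interval_integral_FTC_integrable)
    show "(W a \<xi> has_vector_derivative w a \<xi> \<tau>) (at \<tau>)" if "0 < ereal \<tau>" for \<tau>
      using D that by (simp add: has_real_derivative_iff_has_vector_derivative)
    show "isCont (w a \<xi>) \<tau>" if "0 < ereal \<tau>" for \<tau>
      unfolding w_def using that assms DERIV_isCont[OF D, of \<tau>] by (intro continuous_intros) auto
    have "einterval 0 \<infinity> = {0<..}" by (auto simp: einterval_def)
    then show "set_integrable lborel (einterval 0 \<infinity>) (w a \<xi>)" using I by simp
    show "((W a \<xi> \<circ> real_of_ereal) \<longlongrightarrow> 0) (at_right 0)"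
      using WL[of "at_right 0"] by (simp add: zero_ereal_def ereal_tendsto_simps)
    show "((W a \<xi> \<circ> real_of_ereal) \<longlongrightarrow> 0) (at_left \<infinity>)"
      using WL[of at_top] by (simp add: ereal_tendsto_simps)
  qed simp
  moreover have "(LBINT \<tau>=0..\<infinity>. w a \<xi> \<tau>) = (LBINT \<tau>:{0<..}. w a \<xi> \<tau>)"
    by (simp add: interval_lebesgue_integral_def einterval_def greaterThan_def)
  ultimately show ?thesis by simp
qed

text \<open>With \<tau> as the inner variable, \<psi> y is a constant factor and the sum of the two
  kernels is the \<tau>-derivative of a function vanishing at both ends.\<close>

lemma KI_harmonic:
  fixes \<psi> :: "real^'n \<Rightarrow> real"
  assumes gk: "gauss_kernel Ks" "gauss_kernel Kxx"
    and Ks: "\<And>z s \<xi> \<tau>. 0 < s \<Longrightarrow> 0 < \<tau> \<Longrightarrow> Ks z s \<xi> \<tau> = ((norm z)\<^sup>2 / (4 * s\<^sup>2) - real CARD('n) / (2 * s)) * heat_lev_kernel z s \<xi> \<tau>"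
    and Kxx: "\<And>z s \<xi> \<tau>. 0 < s \<Longrightarrow> 0 < \<tau> \<Longrightarrow> Kxx z s \<xi> \<tau> = (\<xi>\<^sup>2 / (4 * \<tau>\<^sup>2) - 3 / (2 * \<tau>)) * heat_lev_kernel z s \<xi> \<tau>"
    and p: "0 < fst (snd p)" "0 < snd (snd p)" and \<psi>: "\<psi> \<in> borel_measurable borel" "\<And>y. \<bar>\<psi> y\<bar> \<le> C"
  shows "KI Ks \<psi> p + KI Kxx \<psi> p = 0"
proof -
  define a \<xi> where "a = fst (snd p)" and "\<xi> = snd (snd p)"
  define w where "w y \<tau> = ((norm (fst p - y))\<^sup>2 / (4 * (a + \<tau>)\<^sup>2) - real CARD('n) / (2 * (a + \<tau>)) + (\<xi>\<^sup>2 / (4 * \<tau>\<^sup>2) - 3 / (2 * \<tau>)))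
      * (heat_kernel CARD('n) (fst p - y) (a + \<tau>) * lev \<xi> \<tau>)" for y \<tau>
  define h where "h = (\<lambda>(y, \<tau>). indicator {0<..} \<tau> * (w y \<tau> * \<psi> y))"
  let ?I = "\<lambda>L w. indicator {0<..} (snd w) * (L (fst p - fst w) (fst (snd p) + snd w) (snd (snd p)) (snd w) * \<psi> (fst w))"
  have I: "integrable lborel2 (?I Ks)" "integrable lborel2 (?I Kxx)"
    using KI_integrable[OF gk(1) p \<psi>] KI_integrable[OF gk(2) p \<psi>] by auto
  have h: "h = (\<lambda>w. ?I Ks w + ?I Kxx w)"
  proof
    fix v :: "(real^'n) \<times> real"
    show "h v = ?I Ks v + ?I Kxx v"
    proof (cases "0 < snd v")
      case True
      then have "0 < a + snd v" using p by (simp add: a_def)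
      then show ?thesis using True
        by (cases v) (simp add: h_def w_def Ks Kxx heat_lev_kernel_eq a_def \<xi>_def algebra_simps)
    qed (cases v, simp add: h_def)
  qed
  have Ih: "integrable lborel2 h"
    unfolding h using I by (rule Bochner_Integration.integrable_add)
  have "KI Ks \<psi> p + KI Kxx \<psi> p = (\<integral>v. h v \<partial>lborel2)"
    unfolding KI_def h using Bochner_Integration.integral_add[OF I] by simp
  also have "\<dots> = (\<integral>y. (\<integral>\<tau>. h (y, \<tau>) \<partial>lborel) \<partial>lborel)"
    by (rule lborel_pair.integral_fst'[OF Ih, symmetric])
  also have "\<dots> = (\<integral>y. 0 \<partial>(lborel :: (real^'n) measure))"
  proof (rule integral_cong_AE)
    show "(\<lambda>y. \<integral>\<tau>. h (y, \<tau>) \<partial>lborel) \<in> borel_measurable lborel"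
      using lborel_pair.integrable_fst'[OF Ih] by (rule borel_measurable_integrable)
    show "AE y in lborel. (\<integral>\<tau>. h (y, \<tau>) \<partial>lborel) = 0"
      using lborel_pair.AE_integrable_fst'[OF Ih]
    proof eventually_elim
      case (elim y)
      have e: "h (y, \<tau>) = (indicator {0<..} \<tau> *\<^sub>R w y \<tau>) * \<psi> y" for \<tau> by (simp add: h_def)
      show ?case
      \<comment> \<open>Fubini gives integrability only for \<open>w y\<close> multiplied by \<psi>
        y. Where \<psi> y is nonzero it passes to \<open>w y\<close>; elsewhere the integrand is
        0.\<close>
      proof (cases "\<psi> y = 0")
        case False
        then have "set_integrable lborel {0<..} (w y)"
          using elim unfolding e set_integrable_def by simp
        then have "(LBINT \<tau>:{0<..}. w y \<tau>) = 0"
          using p unfolding w_def a_def[symmetric] \<xi>_def[symmetric] by (intro integral_tau_derivative_heat_lev) auto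
        then show ?thesis unfolding e set_lebesgue_integral_def by simp
      qed (simp add: e)
    qed
  qed simp
  finally show ?thesis by simp
qed

lemma vk_eq_KI:
  fixes \<psi> :: "real^'n \<Rightarrow> real"
  assumes "0 < \<delta>" "0 < k" "0 \<le> snd x" "0 < t" and \<psi>: "\<psi> \<in> borel_measurable borel" "\<And>y. \<bar>\<psi> y\<bar> \<le> C"
  shows "vk \<delta> k \<psi> x t = KI heat_lev_kernel \<psi> (fst x, k / \<delta> * t, snd x + t / \<delta>)"
proof -
  let ?p = "(fst x, k / \<delta> * t, snd x + t / \<delta>)"
  have p: "0 < fst (snd ?p)" "0 < snd (snd ?p)" using assms by (auto intro: add_nonneg_pos)
  have gk: "gauss_kernel (heat_lev_kernel :: real^'n \<Rightarrow> _)"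
    unfolding heat_lev_kernel_def[abs_def] by (intro gauss_kernel.scale gauss_kernel.xi gauss_kernel.base)
  have m: "\<psi> \<in> borel_measurable lebesgue" using \<psi>(1) by (auto intro: measurable_completion)
  have "KI heat_lev_kernel \<psi> ?p = (\<integral>y. (\<integral>\<tau>. indicator {0<..} \<tau> * (heat_lev_kernel (fst x - y) (k / \<delta> * t + \<tau>) (snd x + t / \<delta>) \<tau> * \<psi> y) \<partial>lborel) \<partial>lborel)"
    unfolding KI_def using lborel_pair.integral_fst'[OF KI_integrable[OF gk p \<psi>]] by simp
  also have "\<dots> = (\<integral>y. (\<integral>s. indicator {0<..} s * (heat_kernel CARD('n) (fst x - y) (k / \<delta> * t + s) * lev (snd x + t / \<delta>) s) \<partial>lborel) * \<psi> y \<partial>lborel)"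
    unfolding integral_mult_left_zero[symmetric]
    by (intro Bochner_Integration.integral_cong refl) (auto simp: heat_lev_kernel_eq split: split_indicator)
  also have "\<dots> = vk \<delta> k \<psi> x t"
    by (rule vk_eq_lborel[symmetric]) (use m \<psi> in auto)
  finally show ?thesis by simp
qed

lemma kernel_derivs_time:
  fixes K :: "real^'n \<Rightarrow> real \<Rightarrow> real \<Rightarrow> real \<Rightarrow> real"
  assumes K: "kernel_derivs K Kz Ks Kx"
  shows "kernel_derivs (\<lambda>z s \<xi> \<tau>. 1 / s * K z s \<xi> \<tau>) (\<lambda>b z s \<xi> \<tau>. 1 / s * Kz b z s \<xi> \<tau>)
    (\<lambda>z s \<xi> \<tau>. (-1) * (1 / s * (1 / s * K z s \<xi> \<tau>)) + 1 / s * Ks z s \<xi> \<tau>)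
    (\<lambda>z s \<xi> \<tau>. 1 / s * Kx z s \<xi> \<tau>)"
  unfolding kernel_derivs_def
proof (intro conjI ballI allI impI)
  have gk: "gauss_kernel K" "\<And>b. b \<in> Basis \<Longrightarrow> gauss_kernel (Kz b)" "gauss_kernel Ks" "gauss_kernel Kx"
    using K by (auto simp: kernel_derivs_def)
  show "gauss_kernel (\<lambda>z s \<xi> \<tau>. 1 / s * K z s \<xi> \<tau>)"
    "gauss_kernel (\<lambda>z s \<xi> \<tau>. 1 / s * Kx z s \<xi> \<tau>)"
    "gauss_kernel (\<lambda>z s \<xi> \<tau>. (-1) * (1 / s * (1 / s * K z s \<xi> \<tau>)) + 1 / s * Ks z s \<xi> \<tau>)"
    by (intro gauss_kernel.add gauss_kernel.scale gauss_kernel.time gk)+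
  show "gauss_kernel (\<lambda>z s \<xi> \<tau>. 1 / s * Kz b z s \<xi> \<tau>)" if "b \<in> Basis" for b
    by (intro gauss_kernel.time gk that)
next
  fix z and s \<xi> \<tau> :: real assume s: "0 < s" and "0 < \<tau>"
  then have D: "kernel_deriv_at K Kz Ks Kx z s \<xi> \<tau>"
    using K unfolding kernel_derivs_def by blast
  have E: "((\<lambda>p. 1 / fst (snd p)) has_derivative (\<lambda>h. - fst (snd h) / (s * s))) (at (z, s, \<xi>))"
    using s by (auto intro!: derivative_eq_intros simp: fun_eq_iff field_simps)
  show "((\<lambda>p. 1 / fst (snd p) * K (fst p) (fst (snd p)) (snd (snd p)) \<tau>) has_derivative
    (\<lambda>h. (\<Sum>b\<in>Basis. (fst h \<bullet> b) * (1 / s * Kz b z s \<xi> \<tau>)) +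
      fst (snd h) * ((-1) * (1 / s * (1 / s * K z s \<xi> \<tau>)) + 1 / s * Ks z s \<xi> \<tau>) + snd (snd h) * (1 / s * Kx z s \<xi> \<tau>))) (at (z, s, \<xi>))"
    by (rule has_derivative_eq_rhs[OF has_derivative_mult[OF E D]])
      (simp add: fun_eq_iff algebra_simps diff_divide_distrib add_divide_distrib sum_divide_distrib)
qed

text \<open>Serves continuity: an integral of any kernel of the family is differentiable and hence
  continuous. The second derivatives of v_k are continuous because they could be differentiated once
  more.\<close>

lemma gauss_kernel_has_derivs:
  assumes "gauss_kernel K"
  shows "\<exists>Kz Ks Kx. kernel_derivs K Kz Ks Kx"
  using assms
proof induction
  case base show ?case by (intro exI) (rule kernel_derivs_base)
next
  case (space b K) then show ?case using kernel_derivs_space by blast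
next
  case (time K) then show ?case using kernel_derivs_time by blast
next
  case (xi K) then show ?case using kernel_derivs_xi by blast
next
  case (tau K) then show ?case using kernel_derivs_tau by blast
next
  case (add K L) then show ?case using kernel_derivs_add by blast
next
  case (scale K c) then show ?case using kernel_derivs_scale by blast
qed

lemma sum_Basis_prod_real:
  "(\<Sum>b\<in>(Basis :: ('a::euclidean_space \<times> real) set). f b) = (\<Sum>i\<in>Basis. f (i, 0)) + f (0, 1)"
proof -
  have "(Basis :: ('a \<times> real) set) = (\<lambda>i. (i, 0)) ` Basis \<union> {(0, 1)}"
    by (auto simp: Basis_prod_def)
  then have "sum f Basis = sum f ((\<lambda>i. (i, 0)) ` Basis \<union> {(0, 1)})" by (rule arg_cong)
  also have "\<dots> = sum f ((\<lambda>i. (i, 0)) ` Basis) + sum f {(0, 1)}"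
    by (intro sum.union_disjoint) auto
  finally show ?thesis by (simp add: sum.reindex inj_on_def)
qed

section \<open>The chain rule along the curve of parameters\<close>

context
  fixes \<delta> k C :: real and \<psi> :: "real^'n \<Rightarrow> real"
  assumes \<delta>: "0 < \<delta>" and k: "0 < k" and \<psi>_meas: "\<psi> \<in> borel_measurable borel" and \<psi>_le: "\<And>y. \<bar>\<psi> y\<bar> \<le> C"
begin

text \<open>The test \<open>snd b = 0\<close> separates the tangential basis vectors (i, 0) from the
  normal one (0, 1). Even at x_N = 0 the derivative is two-sided, because x_N + t / \<delta> stays
  positive slightly beyond the boundary.\<close>

lemma KI_space_derivative:
  assumes K: "kernel_derivs K Kz Ks Kx" and "0 \<le> snd x" "0 < t"
  shows "((\<lambda>y. KI K \<psi> (fst y, k / \<delta> * t, snd y + t / \<delta>)) has_derivative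
    (\<lambda>v. \<Sum>b\<in>Basis. (v \<bullet> b) * KI (if snd b = 0 then Kz (fst b) else Kx) \<psi> (fst x, k / \<delta> * t, snd x + t / \<delta>))) (at x)"
proof -
  let ?p = "(fst x, k / \<delta> * t, snd x + t / \<delta>)"
  have g: "((\<lambda>y. (fst y, k / \<delta> * t, snd y + t / \<delta>)) has_derivative (\<lambda>v. (fst v, 0, snd v))) (at x)"
    by (auto intro!: derivative_eq_intros has_derivative_Pair)
  have D: "(KI K \<psi> has_derivative (\<lambda>h. (\<Sum>b\<in>Basis. (fst h \<bullet> b) * KI (Kz b) \<psi> ?p) + fst (snd h) * KI Ks \<psi> ?p + snd (snd h) * KI Kx \<psi> ?p)) (at ?p)"
    using assms \<delta> k by (intro KI_has_derivative[OF K _ _ \<psi>_meas \<psi>_le]) (auto intro: add_nonneg_pos)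
  show ?thesis
    by (rule has_derivative_eq_rhs[OF has_derivative_compose[OF g D]])
      (auto simp: fun_eq_iff sum_Basis_prod_real intro!: sum.cong)
qed

text \<open>Time moves a with speed k / \<delta> and \<xi> with speed 1 / \<delta>. For
  \<open>heat_lev_kernel\<close> the first term is the tangential Laplacian and the second the
  normal derivative, so this is the dynamical boundary condition divided by \<delta>.\<close>

lemma KI_time_derivative:
  assumes K: "kernel_derivs K Kz Ks Kx" and "0 \<le> snd x" "0 < t"
  shows "((\<lambda>s. KI K \<psi> (fst x, k / \<delta> * s, snd x + s / \<delta>)) has_real_derivative
    (k / \<delta> * KI Ks \<psi> (fst x, k / \<delta> * t, snd x + t / \<delta>) + 1 / \<delta> * KI Kx \<psi> (fst x, k / \<delta> * t, snd x + t / \<delta>))) (at t)"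
proof -
  let ?p = "(fst x, k / \<delta> * t, snd x + t / \<delta>)"
  have g: "((\<lambda>s. (fst x, k / \<delta> * s, snd x + s / \<delta>)) has_derivative (\<lambda>v. (0, k / \<delta> * v, v / \<delta>))) (at t)"
    using \<delta> by (auto intro!: derivative_eq_intros has_derivative_Pair)
  have D: "(KI K \<psi> has_derivative (\<lambda>h. (\<Sum>b\<in>Basis. (fst h \<bullet> b) * KI (Kz b) \<psi> ?p) + fst (snd h) * KI Ks \<psi> ?p + snd (snd h) * KI Kx \<psi> ?p)) (at ?p)"
    using assms \<delta> k by (intro KI_has_derivative[OF K _ _ \<psi>_meas \<psi>_le]) (auto intro: add_nonneg_pos)
  show ?thesis
    unfolding has_field_derivative_def
    by (rule has_derivative_eq_rhs[OF has_derivative_compose[OF g D]])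
      (simp add: fun_eq_iff algebra_simps)
qed

lemma KI_continuous_on:
  assumes "gauss_kernel K"
  shows "continuous_on (closure Omega \<times> {0<..}) (\<lambda>p. KI K \<psi> (fst (fst p), k / \<delta> * snd p, snd (fst p) + snd p / \<delta>))"
proof -
  obtain Kz Ks Kx where K: "kernel_derivs K Kz Ks Kx" using gauss_kernel_has_derivs[OF assms] by blast
  have "isCont (KI K \<psi>) q" if "0 < fst (snd q)" "0 < snd (snd q)" for q
    using KI_has_derivative[OF K that \<psi>_meas \<psi>_le] by (rule has_derivative_continuous)
  then have "continuous_on {q. 0 < fst (snd q) \<and> 0 < snd (snd q)} (KI K \<psi>)"
    by (intro continuous_at_imp_continuous_on) auto
  then show ?thesis
  proof (rule continuous_on_compose2)
    show "(\<lambda>p. (fst (fst p), k / \<delta> * snd p, snd (fst p) + snd p / \<delta>)) ` (closure Omega \<times> {0<..}) \<subseteq> {q. 0 < fst (snd q) \<and> 0 < snd (snd q)}"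
      using \<delta> k by (auto simp: closure_Omega add_nonneg_pos)
  qed (use \<delta> in \<open>auto intro!: continuous_intros\<close>)
qed

end

text \<open>Reduces operator-valued derivatives to scalar partial ones: \<open>Du\<close> and
  \<open>D2u\<close> become finite sums of scalar functions times fixed linear maps, and so inherit
  differentiability and continuity.\<close>

lemma classical_sol_LDD_I:
  fixes u :: "(real^'n) \<times> real \<Rightarrow> real \<Rightarrow> real"
  assumes Du: "\<And>x t. x \<in> closure Omega \<Longrightarrow> 0 < t \<Longrightarrow>
      ((\<lambda>y. u y t) has_derivative (\<lambda>v. \<Sum>b\<in>Basis. (v \<bullet> b) * g b x t)) (at x within closure Omega)"
    and Dg: "\<And>b x t. b \<in> Basis \<Longrightarrow> x \<in> closure Omega \<Longrightarrow> 0 < t \<Longrightarrow>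
      ((\<lambda>y. g b y t) has_derivative (\<lambda>v. \<Sum>c\<in>Basis. (v \<bullet> c) * h b c x t)) (at x within closure Omega)"
    and Dt: "\<And>x t. x \<in> closure Omega \<Longrightarrow> 0 < t \<Longrightarrow> ((\<lambda>s. u x s) has_real_derivative ut x t) (at t)"
    and cu: "continuous_on (closure Omega \<times> {0<..}) (\<lambda>p. u (fst p) (snd p))"
    and cg: "\<And>b. b \<in> Basis \<Longrightarrow> continuous_on (closure Omega \<times> {0<..}) (\<lambda>p. g b (fst p) (snd p))"
    and ch: "\<And>b c. b \<in> Basis \<Longrightarrow> c \<in> Basis \<Longrightarrow> continuous_on (closure Omega \<times> {0<..}) (\<lambda>p. h b c (fst p) (snd p))"
    and ct: "continuous_on (closure Omega \<times> {0<..}) (\<lambda>p. ut (fst p) (snd p))"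
    and cQ: "continuous_on Qset (\<lambda>p. u (fst p) (snd p))"
    and harmonic: "\<And>x t. x \<in> Omega \<Longrightarrow> 0 < t \<Longrightarrow> (\<Sum>b\<in>Basis. h b b x t) = 0"
    and boundary: "\<And>y t. 0 < t \<Longrightarrow> \<delta> * ut (y, 0) t - k * (\<Sum>b\<in>Basis. h (b, 0) (b, 0) (y, 0) t) - g (0, 1) (y, 0) t = 0"
    and init: "\<And>y. u (y, 0) 0 = \<psi> y"
  shows "classical_sol_LDD \<delta> k \<psi> u"
proof -
  define Du where "Du x t = (\<Sum>b\<in>Basis. g b x t *\<^sub>R blinfun_inner_right b)" for x t
  \<comment> \<open>In \<open>h b c\<close> the function is differentiated in direction b and then
    in direction c; in \<open>D2u x t v e\<close> the vector v is therefore paired with c and e with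
    b.\<close>
  define D2u where "D2u x t = (\<Sum>b\<in>Basis. \<Sum>c\<in>Basis. h b c x t *\<^sub>R (blinfun_scaleR_left (blinfun_inner_right b) o\<^sub>L blinfun_inner_right c))" for x t
  have Du_apply: "Du x t v = (\<Sum>b\<in>Basis. (v \<bullet> b) * g b x t)" for x t v
    by (simp add: Du_def blinfun.sum_left blinfun.scaleR_left inner_commute mult.commute)
  have D2u_apply: "D2u x t v = (\<Sum>b\<in>Basis. (\<Sum>c\<in>Basis. (v \<bullet> c) * h b c x t) *\<^sub>R blinfun_inner_right b)" for x t v
    by (simp add: D2u_def blinfun.sum_left blinfun.scaleR_left inner_commute mult.commute scaleR_sum_left)
  have D2u_diag: "D2u x t e e = h e e x t" if e: "e \<in> Basis" for x t e
  proof -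
    have "D2u x t e e = (\<Sum>b\<in>Basis. (\<Sum>c\<in>Basis. (e \<bullet> c) * h b c x t) * (b \<bullet> e))"
      by (simp add: D2u_apply blinfun.sum_left blinfun.scaleR_left)
    also have "\<dots> = (\<Sum>b\<in>Basis. if b = e then h e e x t else 0)"
      using e by (intro sum.cong refl) (auto simp: inner_Basis if_distrib[of "\<lambda>u. u * _"] sum.delta cong: if_cong)
    also have "\<dots> = h e e x t" using e by (simp add: sum.delta')
    finally show ?thesis .
  qed
  have Du01: "Du x t (0, 1) = g (0, 1) x t" for x t
    by (simp add: Du_apply sum_Basis_prod_real)
  have basis: "(b, 0) \<in> Basis" if "b \<in> Basis" for b :: "real^'n" using that by (simp add: Basis_prod_def)
  show ?thesis
    unfolding classical_sol_LDD_def
  proof (intro exI[of _ Du] exI[of _ D2u] exI[of _ ut] conjI ballI allI impI)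
    fix x :: "(real^'n) \<times> real" and t :: real assume xt: "x \<in> closure Omega" "0 < t"
    have "blinfun_apply (Du x t) = (\<lambda>v. \<Sum>b\<in>Basis. (v \<bullet> b) * g b x t)" by (simp add: fun_eq_iff Du_apply)
    then show "((\<lambda>y. u y t) has_derivative blinfun_apply (Du x t)) (at x within closure Omega)"
      using Du[OF xt] by simp
    have "((\<lambda>y. Du y t) has_derivative (\<lambda>v. \<Sum>b\<in>Basis. (\<Sum>c\<in>Basis. (v \<bullet> c) * h b c x t) *\<^sub>R blinfun_inner_right b)) (at x within closure Omega)"
      unfolding Du_def by (intro has_derivative_sum has_derivative_scaleR_left Dg xt)
    then show "((\<lambda>y. Du y t) has_derivative blinfun_apply (D2u x t)) (at x within closure Omega)"
      by (simp add: D2u_apply[abs_def])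
    show "((\<lambda>s. u x s) has_real_derivative ut x t) (at t)" by (rule Dt[OF xt])
  next
    show "continuous_on (closure Omega \<times> {0<..}) (\<lambda>p. Du (fst p) (snd p))"
      unfolding Du_def by (intro continuous_intros cg)
    show "continuous_on (closure Omega \<times> {0<..}) (\<lambda>p. D2u (fst p) (snd p))"
      unfolding D2u_def by (intro continuous_intros ch)
  next
    fix x :: "(real^'n) \<times> real" and t :: real assume "x \<in> Omega" "0 < t"
    then show "- (\<Sum>b\<in>Basis. D2u x t b b) = 0" using harmonic by (simp add: D2u_diag)
  next
    fix y :: "real^'n" and t :: real assume "0 < t"
    then show "\<delta> * ut (y, 0) t - k * (\<Sum>b\<in>Basis. D2u (y, 0) t (b, 0) (b, 0)) - Du (y, 0) t (0, 1) = 0"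
      using boundary by (simp add: D2u_diag basis Du01)
  qed (use cu ct cQ init in auto)
qed

section \<open>Scaling to unit size, and continuity at time 0\<close>

lemma integral_lborel_affine:
  fixes f :: "'a::euclidean_space \<Rightarrow> real" and t :: 'a and c :: real
  assumes [measurable]: "f \<in> borel_measurable borel" and "c \<noteq> 0"
  shows "(\<integral>x. f x \<partial>lborel) = \<bar>c\<bar> ^ DIM('a) * (\<integral>x. f (t + c *\<^sub>R x) \<partial>lborel)"
proof -
  have "(\<integral>x. f x \<partial>lborel) = (\<integral>x. f x \<partial>density (distr lborel borel (\<lambda>x. t + c *\<^sub>R x)) (\<lambda>_. \<bar>c\<bar> ^ DIM('a)))"
    using lborel_affine[OF \<open>c \<noteq> 0\<close>, of t] by simp
  also have "\<dots> = \<bar>c\<bar> ^ DIM('a) * (\<integral>x. f (t + c *\<^sub>R x) \<partial>lborel)"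
    by (subst integral_density) (simp_all add: integral_distr)
  finally show ?thesis .
qed

lemma heat_kernel_scale:
  fixes z :: "'a::euclidean_space"
  assumes "0 < s"
  shows "sqrt s ^ d * heat_kernel d (sqrt s *\<^sub>R z) s = heat_kernel d z 1"
proof -
  have "sqrt s ^ d = s powr (real d / 2)"
    using assms by (simp add: powr_half_sqrt[symmetric] powr_powr flip: powr_realpow)
  moreover have "s powr (real d / 2) * (4 * pi * s) powr (- (real d / 2)) = (4 * pi) powr (- (real d / 2))"
    using assms by (simp add: powr_mult powr_minus)
  moreover have "(norm (sqrt s *\<^sub>R z))\<^sup>2 / (4 * s) = (norm z)\<^sup>2 / 4"
    using assms by (simp add: power_mult_distrib)
  ultimately show ?thesis by (simp add: heat_kernel_def mult.assoc[symmetric])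
qed

lemma heat_convolution_scale:
  fixes x :: "'a::euclidean_space"
  assumes "0 < s" and [measurable]: "\<psi> \<in> borel_measurable borel"
  shows "(\<integral>y. heat_kernel DIM('a) (x - y) s * \<psi> y \<partial>lborel) = (\<integral>z. heat_kernel DIM('a) z 1 * \<psi> (x - sqrt s *\<^sub>R z) \<partial>lborel)"
proof -
  have "(\<integral>y. heat_kernel DIM('a) (x - y) s * \<psi> y \<partial>lborel)
      = \<bar>- sqrt s\<bar> ^ DIM('a) * (\<integral>z. heat_kernel DIM('a) (x - (x + (- sqrt s) *\<^sub>R z)) s * \<psi> (x + (- sqrt s) *\<^sub>R z) \<partial>lborel)"
    using assms by (intro integral_lborel_affine) auto
  also have "\<dots> = (\<integral>z. sqrt s ^ DIM('a) * heat_kernel DIM('a) (sqrt s *\<^sub>R z) s * \<psi> (x - sqrt s *\<^sub>R z) \<partial>lborel)"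
    using assms by (simp add: mult.assoc)
  finally show ?thesis using assms by (simp add: heat_kernel_scale)
qed

text \<open>Stability of index 1/2: the passage time to distance \<xi> is distributed as \<xi>^2
  times that to distance 1. The factor in front is the Jacobian of this change of variable.\<close>

lemma lev_scale:
  assumes "0 < \<xi>" "0 < \<sigma>"
  shows "\<xi>\<^sup>2 * lev \<xi> (\<xi>\<^sup>2 * \<sigma>) = lev 1 \<sigma>"
proof -
  have "(\<xi>\<^sup>2) powr (-3/2) = \<xi> powr (- 3)"
    using assms powr_powr[of \<xi> 2 "-3/2"] by (simp add: powr_numeral)
  also have "\<dots> = 1 / \<xi> ^ 3" using assms by (simp add: powr_minus_divide powr_numeral)
  finally have "\<xi>\<^sup>2 * (\<xi> * (\<xi>\<^sup>2 * \<sigma>) powr (-3/2)) = \<sigma> powr (-3/2)"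
    using assms by (simp add: powr_mult power2_eq_square power3_eq_cube)
  moreover have "\<xi>\<^sup>2 / (4 * (\<xi>\<^sup>2 * \<sigma>)) = 1 / (4 * \<sigma>)" using assms by simp
  ultimately show ?thesis using assms by (simp add: lev_eq mult_ac)
qed

lemma heat_lev_unit_integral:
  defines "G \<equiv> \<lambda>w :: (real^'n) \<times> real. indicator {0<..} (snd w) * (heat_kernel CARD('n) (fst w) 1 * lev 1 (snd w))"
  shows "integrable lborel2 G" "(\<integral>w. G w \<partial>lborel2) = 1"
proof -
  have G: "G = (\<lambda>(z, s). indicator {0<..} s * (heat_kernel CARD('n) z 1 * lev 1 s))"
    by (auto simp: G_def)
  have "(\<integral>\<^sup>+z. \<bar>indicator {0<..} s * (heat_kernel CARD('n) (z::real^'n) 1 * lev 1 s)\<bar> \<partial>lborel) = ennreal (lev 1 s) * indicator {0<..} s" for s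
    using nn_integral_heat_lev[of 1 "lev 1 s" "0::real^'n"] by (auto simp: lev_nonneg split: split_indicator)
  then have "(\<integral>\<^sup>+s. (\<integral>\<^sup>+z. \<bar>indicator {0<..} s * (heat_kernel CARD('n) (z::real^'n) 1 * lev 1 s)\<bar> \<partial>lborel) \<partial>lborel) \<le> ennreal 1"
    using nn_integral_lev[of 1] by simp
  then show I: "integrable lborel2 G"
    unfolding G by (intro integrable_kernelI[where B=1]) measurable
  have "(\<integral>w. G w \<partial>lborel2) = (\<integral>s. (\<integral>z. G (z, s) \<partial>lborel) \<partial>lborel)"
    using lborel_pair.integral_snd[of "\<lambda>z s. G (z, s)"] I by simp
  also have "\<dots> = (LBINT s:{0<..}. lev 1 s)"
    using integral_heat_kernel(2)[of 1 "0::real^'n"]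
    by (simp add: G_def set_lebesgue_integral_def mult.commute mult.left_commute)
  finally show "(\<integral>w. G w \<partial>lborel2) = 1" using lev_integral(2)[of 1] by simp
qed

text \<open>After scaling the heat kernel and the subordinator to unit size the only dependence on
  (x, t) is through the argument of \<open>\<psi>\<close>, so the formula makes sense, and is continuous, up to t = 0.\<close>

definition vk_scaled :: "real \<Rightarrow> real \<Rightarrow> (real^'n \<Rightarrow> real) \<Rightarrow> (real^'n) \<times> real \<Rightarrow> real \<Rightarrow> real" where
  "vk_scaled \<delta> k \<psi> x t = (\<integral>w. indicator {0<..} (snd w) * (heat_kernel CARD('n) (fst w) 1 * lev 1 (snd w))
      * \<psi> (fst x - sqrt (k / \<delta> * t + (snd x + t / \<delta>)\<^sup>2 * snd w) *\<^sub>R fst w) \<partial>lborel2)"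

lemma vk_scaled_integrable:
  fixes \<psi> :: "real^'n \<Rightarrow> real" and a b :: real
  assumes [measurable]: "\<psi> \<in> borel_measurable borel" and C: "\<And>y. \<bar>\<psi> y\<bar> \<le> C"
  shows "integrable lborel2 (\<lambda>w. indicator {0<..} (snd w) * (heat_kernel CARD('n) (fst w) 1 * lev 1 (snd w))
      * \<psi> (x - sqrt (a + b * snd w) *\<^sub>R fst w))"
proof (rule Bochner_Integration.integrable_bound)
  show "integrable lborel2 (\<lambda>w. indicator {0<..} (snd w) * (heat_kernel CARD('n) (fst w :: real^'n) 1 * lev 1 (snd w)) * C)"
    using heat_lev_unit_integral(1)[where 'n='n] by simp
  show "AE w in lborel2. norm (indicator {0<..} (snd w) * (heat_kernel CARD('n) (fst w) 1 * lev 1 (snd w))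
      * \<psi> (x - sqrt (a + b * snd w) *\<^sub>R fst w)) \<le> norm (indicator {0<..} (snd w) * (heat_kernel CARD('n) (fst w :: real^'n) 1 * lev 1 (snd w)) * C)"
    unfolding norm_mult using C by (intro AE_I2 mult_left_mono) (auto intro!: order_trans[OF C abs_ge_self])
qed measurable

text \<open>The order of the steps matters: the heat kernel is scaled by sqrt (a + s), which depends
  on s, so y has to be the inner variable; only afterwards is s replaced by \<xi>^2 s.\<close>

lemma vk_eq_vk_scaled:
  fixes \<psi> :: "real^'n \<Rightarrow> real"
  assumes "0 < \<delta>" "0 < k" "0 \<le> snd x" "0 < t" and \<psi>[measurable]: "\<psi> \<in> borel_measurable borel" and C: "\<And>y. \<bar>\<psi> y\<bar> \<le> C"
  shows "vk \<delta> k \<psi> x t = vk_scaled \<delta> k \<psi> x t"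
proof -
  define a \<xi> where "a = k / \<delta> * t" and "\<xi> = snd x + t / \<delta>"
  have a: "0 < a" and \<xi>: "0 < \<xi>" using assms by (auto simp: a_def \<xi>_def add_nonneg_pos)
  have gk: "gauss_kernel (heat_lev_kernel :: real^'n \<Rightarrow> _)"
    unfolding heat_lev_kernel_def[abs_def] by (intro gauss_kernel.scale gauss_kernel.xi gauss_kernel.base)
  define U where "U s = (\<integral>z. heat_kernel CARD('n) z 1 * \<psi> (fst x - sqrt s *\<^sub>R z) \<partial>lborel)" for s
  have I: "integrable lborel2 (\<lambda>(y, s). indicator {0<..} s * (heat_lev_kernel (fst x - y) (a + s) \<xi> s * \<psi> y))"
    using KI_integrable[OF gk, of "(fst x, a, \<xi>)", OF _ _ \<psi> C] a \<xi> by (simp add: case_prod_beta')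
  have "vk \<delta> k \<psi> x t = KI heat_lev_kernel \<psi> (fst x, a, \<xi>)"
    unfolding a_def \<xi>_def by (rule vk_eq_KI) fact+
  also have "\<dots> = (\<integral>(y, s). indicator {0<..} s * (heat_lev_kernel (fst x - y) (a + s) \<xi> s * \<psi> y) \<partial>lborel2)"
    by (simp add: KI_def case_prod_beta')
  also have "\<dots> = (\<integral>s. (\<integral>y. indicator {0<..} s * (heat_lev_kernel (fst x - y) (a + s) \<xi> s * \<psi> y) \<partial>lborel) \<partial>lborel)"
    by (rule lborel_pair.integral_snd[OF I, symmetric])
  also have "\<dots> = (\<integral>s. indicator {0<..} s * (lev \<xi> s * U (a + s)) \<partial>lborel)"
  proof (intro Bochner_Integration.integral_cong refl)
    fix s :: real
    show "(\<integral>y. indicator {0<..} s * (heat_lev_kernel (fst x - y) (a + s) \<xi> s * \<psi> y) \<partial>lborel) = indicator {0<..} s * (lev \<xi> s * U (a + s))"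
    proof (cases "0 < s")
      case True
      have "(\<integral>y. heat_lev_kernel (fst x - y) (a + s) \<xi> s * \<psi> y \<partial>lborel) = (\<integral>y. lev \<xi> s * (heat_kernel CARD('n) (fst x - y) (a + s) * \<psi> y) \<partial>lborel)"
        using True by (simp add: heat_lev_kernel_eq mult_ac)
      also have "\<dots> = lev \<xi> s * U (a + s)"
        using heat_convolution_scale[of "a + s" \<psi> "fst x"] True a by (simp add: U_def)
      finally show ?thesis using True by simp
    qed simp
  qed
  also have "\<dots> = \<xi>\<^sup>2 * (\<integral>s. indicator {0<..} (\<xi>\<^sup>2 * s) * (lev \<xi> (\<xi>\<^sup>2 * s) * U (a + \<xi>\<^sup>2 * s)) \<partial>lborel)"
    using lborel_integral_real_affine[of "\<xi>\<^sup>2" "\<lambda>s. indicator {0<..} s * (lev \<xi> s * U (a + s))" 0] \<xi> by simp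
  also have "\<dots> = (\<integral>s. \<xi>\<^sup>2 * (indicator {0<..} (\<xi>\<^sup>2 * s) * (lev \<xi> (\<xi>\<^sup>2 * s) * U (a + \<xi>\<^sup>2 * s))) \<partial>lborel)"
    by simp
  also have "\<dots> = (\<integral>s. (\<integral>z. indicator {0<..} s * (heat_kernel CARD('n) z 1 * lev 1 s) * \<psi> (fst x - sqrt (a + \<xi>\<^sup>2 * s) *\<^sub>R z) \<partial>lborel) \<partial>lborel)"
  proof (intro Bochner_Integration.integral_cong refl)
    fix s :: real
    show "\<xi>\<^sup>2 * (indicator {0<..} (\<xi>\<^sup>2 * s) * (lev \<xi> (\<xi>\<^sup>2 * s) * U (a + \<xi>\<^sup>2 * s)))
        = (\<integral>z. indicator {0<..} s * (heat_kernel CARD('n) z 1 * lev 1 s) * \<psi> (fst x - sqrt (a + \<xi>\<^sup>2 * s) *\<^sub>R z) \<partial>lborel)"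
    proof (cases "0 < s")
      case True
      have "(\<integral>z. indicator {0<..} s * (heat_kernel CARD('n) z 1 * lev 1 s) * \<psi> (fst x - sqrt (a + \<xi>\<^sup>2 * s) *\<^sub>R z) \<partial>lborel)
          = (\<integral>z. lev 1 s * (heat_kernel CARD('n) z 1 * \<psi> (fst x - sqrt (a + \<xi>\<^sup>2 * s) *\<^sub>R z)) \<partial>lborel)"
        using True by (simp add: mult_ac)
      also have "\<dots> = lev 1 s * U (a + \<xi>\<^sup>2 * s)" by (simp add: U_def)
      finally show ?thesis using True \<xi> lev_scale[OF \<xi> True] by (simp add: mult.assoc[symmetric])
    qed (use \<xi> in \<open>simp add: zero_less_mult_iff\<close>)
  qed
  also have "\<dots> = vk_scaled \<delta> k \<psi> x t"
    unfolding vk_scaled_def a_def[symmetric] \<xi>_def[symmetric]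
    using lborel_pair.integral_snd[of "\<lambda>z s. indicator {0<..} s * (heat_kernel CARD('n) z 1 * lev 1 s) * \<psi> (fst x - sqrt (a + \<xi>\<^sup>2 * s) *\<^sub>R z)"]
      vk_scaled_integrable[OF \<psi> C, of "fst x" a "\<xi>\<^sup>2"] by (simp add: case_prod_beta')
  finally show ?thesis .
qed

text \<open>The square root is 0 here, and the weight has total mass one.\<close>

lemma vk_scaled_initial:
  fixes \<psi> :: "real^'n \<Rightarrow> real"
  shows "vk_scaled \<delta> k \<psi> (y, 0) 0 = \<psi> y"
  using heat_lev_unit_integral(2)[where 'n='n] by (simp add: vk_scaled_def)

lemma vk_ext_eq_vk_scaled:
  fixes \<psi> :: "real^'n \<Rightarrow> real"
  assumes "0 < \<delta>" "0 < k" "(x, t) \<in> Qset" and \<psi>: "\<psi> \<in> borel_measurable borel" "\<And>y. \<bar>\<psi> y\<bar> \<le> C"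
  shows "vk_ext \<delta> k \<psi> x t = vk_scaled \<delta> k \<psi> x t"
proof (cases "0 < t")
  case True
  then show ?thesis using assms vk_eq_vk_scaled[of \<delta> k x t \<psi> C] by (auto simp: vk_ext_def Qset_def closure_Omega)
next
  case False
  have "0 \<le> snd x" using assms(3) by (auto simp: Qset_def closure_Omega)
  \<comment> \<open>At time 0 the set Q contains boundary points only, so x_N = 0.\<close>
  with False have "t = 0" "x = (fst x, 0)"
    using assms(3) by (auto simp: Qset_def Omega_def prod_eq_iff)
  then show ?thesis using vk_scaled_initial[of \<delta> k \<psi> "fst x"] by (simp add: vk_ext_def)
qed

lemma abs_mult_le: "0 \<le> a \<Longrightarrow> \<bar>b\<bar> \<le> c \<Longrightarrow> \<bar>a * b\<bar> \<le> a * (c::real)"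
  by (simp add: abs_mult mult_left_mono)

text \<open>Dominated convergence with majorant C times the unit weight, in which no parameter
  occurs. The set is arbitrary because \<open>sqrt\<close> is continuous on the whole real
  line.\<close>

lemma vk_scaled_continuous_on:
  fixes \<psi> :: "real^'n \<Rightarrow> real"
  assumes \<psi>: "continuous_on UNIV \<psi>" and C: "\<And>y. \<bar>\<psi> y\<bar> \<le> C"
  shows "continuous_on S (\<lambda>p. vk_scaled \<delta> k \<psi> (fst p) (snd p))"
proof (rule continuous_on_sequentiallyI)
  fix q :: "nat \<Rightarrow> ((real^'n) \<times> real) \<times> real" and p assume q: "q \<longlonglongrightarrow> p"
  have [measurable]: "\<psi> \<in> borel_measurable borel" using \<psi> by (rule borel_measurable_continuous_onI)
  let ?G = "\<lambda>w :: (real^'n) \<times> real. indicator {0<..} (snd w) * (heat_kernel CARD('n) (fst w) 1 * lev 1 (snd w))"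
  let ?F = "\<lambda>p w. ?G w * \<psi> (fst (fst p) - sqrt (k / \<delta> * snd p + (snd (fst p) + snd p / \<delta>)\<^sup>2 * snd w) *\<^sub>R fst w)"
  have c: "isCont \<psi> y" for y using \<psi> by (simp add: continuous_on_eq_continuous_at)
  show "(\<lambda>n. vk_scaled \<delta> k \<psi> (fst (q n)) (snd (q n))) \<longlonglongrightarrow> vk_scaled \<delta> k \<psi> (fst p) (snd p)"
    unfolding vk_scaled_def
  proof (rule integral_dominated_convergence[where w="\<lambda>w. ?G w * C"])
    show "integrable lborel2 (\<lambda>w. ?G w * C)" using heat_lev_unit_integral(1)[where 'n='n] by simp
    show "AE w in lborel2. (\<lambda>n. ?F (q n) w) \<longlonglongrightarrow> ?F p w"
    proof (rule AE_I2, rule tendsto_mult[OF tendsto_const], rule isCont_tendsto_compose[OF c])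
      fix w :: "(real^'n) \<times> real"
      have a: "(\<lambda>n. fst (fst (q n))) \<longlonglongrightarrow> fst (fst p)" "(\<lambda>n. snd (fst (q n))) \<longlonglongrightarrow> snd (fst p)" "(\<lambda>n. snd (q n)) \<longlonglongrightarrow> snd p"
        using q by (auto intro: tendsto_fst tendsto_snd)
      show "(\<lambda>n. fst (fst (q n)) - sqrt (k / \<delta> * snd (q n) + (snd (fst (q n)) + snd (q n) / \<delta>)\<^sup>2 * snd w) *\<^sub>R fst w)
          \<longlonglongrightarrow> fst (fst p) - sqrt (k / \<delta> * snd p + (snd (fst p) + snd p / \<delta>)\<^sup>2 * snd w) *\<^sub>R fst w"
        \<comment> \<open>Division by \<delta> as multiplication by a constant spares the limit
          rules a proof that \<delta> is nonzero.\<close>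
        unfolding divide_inverse by (intro tendsto_intros a)
    qed
    show "AE w in lborel2. norm (?F (q n) w) \<le> ?G w * C" for n
    proof (rule AE_I2)
      fix w :: "(real^'n) \<times> real"
      have "0 \<le> ?G w" by (auto simp: lev_nonneg split: split_indicator)
      then show "norm (?F (q n) w) \<le> ?G w * C" unfolding real_norm_def using C by (rule abs_mult_le)
    qed
  qed measurable
qed

lemma vk_ext_continuous_on:
  assumes "0 < \<delta>" "0 < k" "continuous_on UNIV \<psi>" "\<And>y. \<bar>\<psi> y\<bar> \<le> C"
  shows "continuous_on Qset (\<lambda>p. vk_ext \<delta> k \<psi> (fst p) (snd p))"
proof -
  have "vk_ext \<delta> k \<psi> (fst p) (snd p) = vk_scaled \<delta> k \<psi> (fst p) (snd p)" if "p \<in> Qset" for p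
    using that assms by (intro vk_ext_eq_vk_scaled[of \<delta> k _ _ \<psi> C]) (auto intro: borel_measurable_continuous_onI)
  then show ?thesis
    using vk_scaled_continuous_on[OF assms(3,4)] by (simp cong: continuous_on_cong)
qed

lemma vk_ext_bounded:
  fixes \<psi> :: "real^'n \<Rightarrow> real"
  assumes "0 < \<delta>" "0 < k" "continuous_on UNIV \<psi>" and C: "\<And>y. \<bar>\<psi> y\<bar> \<le> C"
  shows "\<forall>x\<in>closure Omega. \<forall>t\<ge>0. \<bar>vk_ext \<delta> k \<psi> x t\<bar> \<le> C"
proof (intro ballI allI impI)
  fix x :: "(real^'n) \<times> real" and t :: real assume x: "x \<in> closure Omega" and t: "0 \<le> t"
  have [measurable]: "\<psi> \<in> borel_measurable borel" using assms(3) by (rule borel_measurable_continuous_onI)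
  show "\<bar>vk_ext \<delta> k \<psi> x t\<bar> \<le> C"
  proof (cases "0 < t")
    case True
    let ?G = "\<lambda>w :: (real^'n) \<times> real. indicator {0<..} (snd w) * (heat_kernel CARD('n) (fst w) 1 * lev 1 (snd w))"
    have G: "0 \<le> ?G w" for w by (auto simp: lev_nonneg split: split_indicator)
    have "\<bar>vk_scaled \<delta> k \<psi> x t\<bar> \<le> (\<integral>w. ?G w * C \<partial>lborel2)"
      unfolding vk_scaled_def
    proof (rule order_trans[OF integral_abs_bound], rule integral_mono)
      show "integrable lborel2 (\<lambda>w. \<bar>?G w * \<psi> (fst x - sqrt (k / \<delta> * t + (snd x + t / \<delta>)\<^sup>2 * snd w) *\<^sub>R fst w)\<bar>)"
        by (intro integrable_abs vk_scaled_integrable[OF _ C]) measurable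
      show "integrable lborel2 (\<lambda>w. ?G w * C)" using heat_lev_unit_integral(1)[where 'n='n] by simp
      show "\<bar>?G w * \<psi> (fst x - sqrt (k / \<delta> * t + (snd x + t / \<delta>)\<^sup>2 * snd w) *\<^sub>R fst w)\<bar> \<le> ?G w * C" for w
        using G C by (rule abs_mult_le)
    qed
    also have "\<dots> = C" using heat_lev_unit_integral(2)[where 'n='n] by simp
    finally show ?thesis
      using True x assms vk_eq_vk_scaled[of \<delta> k x t \<psi> C] by (simp add: vk_ext_def closure_Omega)
  qed (use C t in \<open>simp add: vk_ext_def\<close>)
qed

section \<open>Verification of the equations\<close>

lemma vk_ext_classical_sol:
  fixes \<psi> :: "real^'n \<Rightarrow> real"
  assumes \<delta>: "0 < \<delta>" and k: "0 < k" and \<psi>: "continuous_on UNIV \<psi>" and C: "\<And>y. \<bar>\<psi> y\<bar> \<le> C"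
  shows "classical_sol_LDD \<delta> k \<psi> (vk_ext \<delta> k \<psi>)"
proof -
  have \<psi>m: "\<psi> \<in> borel_measurable borel" using \<psi> by (rule borel_measurable_continuous_onI)
  let ?K0 = "heat_lev_kernel :: (real^'n \<Rightarrow> real \<Rightarrow> real \<Rightarrow> real \<Rightarrow> real)"
  obtain Kz Ks Kx Kzz Kzs Kzx Kxz Kxs Kxx where
    k0: "kernel_derivs ?K0 Kz Ks Kx" and
    kz: "\<And>i. i \<in> Basis \<Longrightarrow> kernel_derivs (Kz i) (Kzz i) (Kzs i) (Kzx i)" and
    kx: "kernel_derivs Kx Kxz Kxs Kxx" and
    Ks: "\<And>z s \<xi> \<tau>. 0 < s \<Longrightarrow> 0 < \<tau> \<Longrightarrow> Ks z s \<xi> \<tau> = ((norm z)\<^sup>2 / (4 * s\<^sup>2) - real CARD('n) / (2 * s)) * ?K0 z s \<xi> \<tau>" and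
    Kzz: "\<And>z s \<xi> \<tau>. 0 < s \<Longrightarrow> 0 < \<tau> \<Longrightarrow> (\<Sum>i\<in>Basis. Kzz i i z s \<xi> \<tau>) = ((norm z)\<^sup>2 / (4 * s\<^sup>2) - real CARD('n) / (2 * s)) * ?K0 z s \<xi> \<tau>" and
    Kxx: "\<And>z s \<xi> \<tau>. 0 < s \<Longrightarrow> 0 < \<tau> \<Longrightarrow> Kxx z s \<xi> \<tau> = (\<xi>\<^sup>2 / (4 * \<tau>\<^sup>2) - 3 / (2 * \<tau>)) * ?K0 z s \<xi> \<tau>"
    apply (rule heat_lev_kernel_derivs[where 'n='n])
    apply (rule that)
         apply assumption
        apply assumption
       apply assumption
      apply blast
     apply blast
    apply assumption
    done
  have gk: "gauss_kernel ?K0" "gauss_kernel Ks" "gauss_kernel Kx" "gauss_kernel Kxx"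
    "\<And>i. i \<in> Basis \<Longrightarrow> gauss_kernel (Kz i)" "\<And>i. i \<in> Basis \<Longrightarrow> gauss_kernel (Kzx i)" "\<And>i. i \<in> Basis \<Longrightarrow> gauss_kernel (Kxz i)"
    "\<And>i j. i \<in> Basis \<Longrightarrow> j \<in> Basis \<Longrightarrow> gauss_kernel (Kzz i j)"
    using k0 kz kx unfolding kernel_derivs_def by blast+
  define I where "I K x t = KI K \<psi> (fst x, k / \<delta> * t, snd x + t / \<delta>)" for K x t
  define g where "g b = I (if snd b = 0 then Kz (fst b) else Kx)" for b :: "(real^'n) \<times> real"
  \<comment> \<open>The index b selects the kernel of the first derivative and c the direction in
    which that kernel is differentiated; mixed pairs use \<open>Kzx\<close> for tangential b and
    \<open>Kxz\<close> for tangential c.\<close>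
  define h where "h b c = I (if snd c = 0 then if snd b = 0 then Kzz (fst b) (fst c) else Kxz (fst c)
      else if snd b = 0 then Kzx (fst b) else Kxx)" for b c :: "(real^'n) \<times> real"
  define ut where "ut x t = k / \<delta> * I Ks x t + 1 / \<delta> * I Kx x t" for x t
  have ue: "vk_ext \<delta> k \<psi> x t = I ?K0 x t" if "x \<in> closure Omega" "0 < t" for x t
    using that vk_eq_KI[OF \<delta> k _ _ \<psi>m C] by (simp add: vk_ext_def I_def closure_Omega)
  have basis: "(\<exists>i\<in>Basis. b = (i, 0)) \<or> b = (0, 1)" if "b \<in> Basis" for b :: "(real^'n) \<times> real"
    using that by (auto simp: Basis_prod_def)
  have D: "((\<lambda>y. I K y t) has_derivative (\<lambda>v. \<Sum>b\<in>Basis. (v \<bullet> b) * I (if snd b = 0 then Lz (fst b) else Lx) x t)) (at x within closure Omega)"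
    if "kernel_derivs K Lz Ls Lx" "x \<in> closure Omega" "0 < t" for K Lz Ls Lx x t
  proof -
    have "0 \<le> snd x" using that(2) by (simp add: closure_Omega)
    from KI_space_derivative[OF \<delta> k \<psi>m C that(1) this that(3)] show ?thesis
      unfolding I_def by (rule has_derivative_at_withinI)
  qed
  have c: "continuous_on (closure Omega \<times> {0<..}) (\<lambda>p. I K (fst p) (snd p))" if "gauss_kernel K" for K
    unfolding I_def by (rule KI_continuous_on[OF \<delta> k \<psi>m C that])
  \<comment> \<open>The two kernels have the same closed form for positive s and \<tau>, which is
    all that the integral sees.\<close>
  have laplace: "(\<Sum>i\<in>Basis. I (Kzz i i) x t) = I Ks x t" if "0 \<le> snd x" "0 < t" for x t
  proof -
    have p: "0 < k / \<delta> * t" "0 < snd x + t / \<delta>" using that \<delta> k by (auto simp: add_nonneg_pos)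
    have "(\<Sum>i\<in>Basis. I (Kzz i i) x t) = I (\<lambda>z s \<xi> \<tau>. \<Sum>i\<in>Basis. Kzz i i z s \<xi> \<tau>) x t"
      unfolding I_def by (intro KI_sum[symmetric, where C=C] gk \<psi>m C) (use p in auto)
    also have "\<dots> = I Ks x t"
      unfolding I_def using p by (intro KI_cong) (auto simp: Ks Kzz)
    finally show ?thesis .
  qed
  show ?thesis
  proof (rule classical_sol_LDD_I[where g=g and h=h and ut=ut])
    fix x :: "(real^'n) \<times> real" and t :: real assume xt: "x \<in> closure Omega" "0 < t"
    \<comment> \<open>The representation of \<open>vk_ext\<close> by \<open>I ?K0\<close> is
      available on the closed half space, so the derivative is transferred within that set.\<close>
    show "((\<lambda>y. vk_ext \<delta> k \<psi> y t) has_derivative (\<lambda>v. \<Sum>b\<in>Basis. (v \<bullet> b) * g b x t)) (at x within closure Omega)"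
      unfolding g_def by (rule has_derivative_transform[OF xt(1) _ D[OF k0 xt]]) (simp add: ue xt)
    show "((\<lambda>s. vk_ext \<delta> k \<psi> x s) has_real_derivative ut x t) (at t)"
    proof (rule has_field_derivative_transform_within_open)
      show "((\<lambda>s. I ?K0 x s) has_real_derivative ut x t) (at t)"
        unfolding ut_def I_def using xt by (intro KI_time_derivative[OF \<delta> k \<psi>m C k0]) (auto simp: closure_Omega)
      show "open {0::real<..}" by simp
    qed (use xt ue in auto)
  next
    fix b x :: "(real^'n) \<times> real" and t :: real assume b: "b \<in> Basis" and xt: "x \<in> closure Omega" "0 < t"
    show "((\<lambda>y. g b y t) has_derivative (\<lambda>v. \<Sum>c\<in>Basis. (v \<bullet> c) * h b c x t)) (at x within closure Omega)"
      using basis[OF b]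
    proof
      assume "\<exists>i\<in>Basis. b = (i, 0)"
      then obtain i where i: "i \<in> Basis" "b = (i, 0)" by blast
      show ?thesis using D[OF kz[OF i(1)] xt] by (simp add: g_def h_def i cong: if_cong)
    next
      assume "b = (0, 1)"
      then show ?thesis using D[OF kx xt] by (simp add: g_def h_def cong: if_cong)
    qed
  next
    show "continuous_on (closure Omega \<times> {0<..}) (\<lambda>p. vk_ext \<delta> k \<psi> (fst p) (snd p))"
      using c[OF gk(1)] by (rule continuous_on_eq) (auto simp: ue)
    show "continuous_on (closure Omega \<times> {0<..}) (\<lambda>p. ut (fst p) (snd p))"
      unfolding ut_def by (intro continuous_intros c gk)
    show "continuous_on Qset (\<lambda>p. vk_ext \<delta> k \<psi> (fst p) (snd p))"
      by (rule vk_ext_continuous_on[OF \<delta> k \<psi> C])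
  next
    fix b :: "(real^'n) \<times> real" assume "b \<in> Basis"
    from basis[OF this] show "continuous_on (closure Omega \<times> {0<..}) (\<lambda>p. g b (fst p) (snd p))"
      unfolding g_def by (intro c) (auto simp: gk)
  next
    fix b b' :: "(real^'n) \<times> real" assume "b \<in> Basis" "b' \<in> Basis"
    from basis[OF this(1)] basis[OF this(2)]
    show "continuous_on (closure Omega \<times> {0<..}) (\<lambda>p. h b b' (fst p) (snd p))"
      unfolding h_def by (intro c) (auto simp: gk)
  next
    fix x :: "(real^'n) \<times> real" and t :: real assume "x \<in> Omega" "0 < t"
    then have xt: "0 \<le> snd x" "0 < t" by (auto simp: Omega_def)
    \<comment> \<open>The tangential directions together give the derivative in a, the normal one
      the second derivative in \<xi>; these two cancel.\<close>
    have "(\<Sum>b\<in>Basis. h b b x t) = I Ks x t + I Kxx x t"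
      using laplace[OF xt] by (simp add: sum_Basis_prod_real h_def)
    also have "\<dots> = 0"
      unfolding I_def using xt \<delta> k by (intro KI_harmonic[OF gk(2,4) Ks Kxx _ _ \<psi>m C]) (auto simp: add_nonneg_pos)
    finally show "(\<Sum>b\<in>Basis. h b b x t) = 0" .
  next
    fix y :: "real^'n" and t :: real assume t: "0 < t"
    show "\<delta> * ut (y, 0) t - k * (\<Sum>b\<in>Basis. h (b, 0) (b, 0) (y, 0) t) - g (0, 1) (y, 0) t = 0"
      using laplace[of "(y, 0)" t] t \<delta> by (simp add: h_def g_def ut_def distrib_left)
  next
    show "vk_ext \<delta> k \<psi> (y, 0) 0 = \<psi> y" for y by (simp add: vk_ext_def)
  qed
qed

theorem theorem4p1:
  fixes \<delta> :: real and \<phi> :: "(real^'n) \<times> real \<Rightarrow> real" and \<psi> :: "real^'n \<Rightarrow> real"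
  assumes "0 < \<delta>"
    and "set_borel_measurable lebesgue Omega \<phi>"
    and "\<exists>C. AE y in lebesgue. y \<in> Omega \<longrightarrow> \<bar>\<phi> y\<bar> \<le> C"
    and "\<psi> \<in> borel_measurable lebesgue"
    and "\<exists>C. AE y in lebesgue. \<bar>\<psi> y\<bar> \<le> C"
  shows
    "(\<forall>k>0. \<forall>L>0. \<forall>I. compact I \<and> I \<subseteq> {0<..} \<longrightarrow>
        (\<exists>C. \<forall>\<^sub>F \<epsilon> in at_right 0. \<forall>x\<in>OmegaL L. \<forall>t\<in>I.
            \<bar>sol \<epsilon> \<delta> k \<phi> \<psi> x t - vk \<delta> k \<psi> x t\<bar> \<le> C * sqrt \<epsilon>))
   \<and> (\<forall>L>0. \<forall>I. compact I \<and> I \<subseteq> {0<..} \<longrightarrow>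
        (\<exists>C. \<forall>\<^sub>F \<epsilon> in at_right 0. \<forall>x\<in>OmegaL L. \<forall>t\<in>I.
            \<bar>sol \<epsilon> \<delta> 0 \<phi> \<psi> x t - v0 \<delta> \<psi> x t\<bar> \<le> C * sqrt \<epsilon>))
   \<and> (bounded (range \<psi>) \<and> continuous_on UNIV \<psi> \<longrightarrow>
        (\<forall>k>0. continuous_on Qset (\<lambda>p. vk_ext \<delta> k \<psi> (fst p) (snd p))
             \<and> classical_sol_LDD \<delta> k \<psi> (vk_ext \<delta> k \<psi>)
             \<and> (\<exists>C. \<forall>x\<in>closure Omega. \<forall>t\<ge>0. \<bar>vk_ext \<delta> k \<psi> x t\<bar> \<le> C)))
   \<and> (\<forall>T>0. \<forall>R>0. \<exists>C. \<forall>\<^sub>F k in at_right 0. \<forall>x\<in>closure Omega. \<forall>t\<in>{0<..T}.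
        R \<le> snd x + t / \<delta> \<longrightarrow> \<bar>vk \<delta> k \<psi> x t - v0 \<delta> \<psi> x t\<bar> \<le> C * k)"
proof (intro conjI allI impI)
  fix k L :: real and I :: "real set"
  assume "0 < k" "0 < L" "compact I \<and> I \<subseteq> {0<..}"
  then show "\<exists>C. \<forall>\<^sub>F \<epsilon> in at_right 0. \<forall>x\<in>OmegaL L. \<forall>t\<in>I. \<bar>sol \<epsilon> \<delta> k \<phi> \<psi> x t - vk \<delta> k \<psi> x t\<bar> \<le> C * sqrt \<epsilon>"
    using assms sol_minus_vk_rate[of \<delta> k L I \<psi> _ \<phi>] by auto
next
  fix L :: real and I :: "real set"
  assume *: "0 < L" "compact I \<and> I \<subseteq> {0<..}"
  \<comment> \<open>The second rate is the case \<kappa> = 0 of the first, once v_0 is rewritten as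
    \<open>vk\<close> with k = 0 on the set in question.\<close>
  have "v0 \<delta> \<psi> x t = vk \<delta> 0 \<psi> x t" if "x \<in> OmegaL L" "t \<in> I" for x t
    using that * assms(1) by (intro v0_eq_vk) (auto simp: OmegaL_def)
  then show "\<exists>C. \<forall>\<^sub>F \<epsilon> in at_right 0. \<forall>x\<in>OmegaL L. \<forall>t\<in>I. \<bar>sol \<epsilon> \<delta> 0 \<phi> \<psi> x t - v0 \<delta> \<psi> x t\<bar> \<le> C * sqrt \<epsilon>"
    using assms * sol_minus_vk_rate[of \<delta> 0 L I \<psi> _ \<phi>] by (auto cong: ball_cong)
next
  fix T R :: real
  assume "0 < T" "0 < R"
  then show "\<exists>C. \<forall>\<^sub>F k in at_right 0. \<forall>x\<in>closure Omega. \<forall>t\<in>{0<..T}.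
      R \<le> snd x + t / \<delta> \<longrightarrow> \<bar>vk \<delta> k \<psi> x t - v0 \<delta> \<psi> x t\<bar> \<le> C * k"
    using assms vk_minus_v0_rate[of \<delta> T R \<psi>] by blast
next
  assume *: "bounded (range \<psi>) \<and> continuous_on UNIV \<psi>"
  fix k :: real
  assume k: "0 < k"
  obtain C where C: "\<And>y. \<bar>\<psi> y\<bar> \<le> C" using * by (auto simp: bounded_iff)
  show "continuous_on Qset (\<lambda>p. vk_ext \<delta> k \<psi> (fst p) (snd p))"
    using vk_ext_continuous_on[of \<delta> k \<psi> C] assms(1) k * C by blast
  show "classical_sol_LDD \<delta> k \<psi> (vk_ext \<delta> k \<psi>)"
    using vk_ext_classical_sol[of \<delta> k \<psi> C] assms(1) k * C by blast
  show "\<exists>C. \<forall>x\<in>closure Omega. \<forall>t\<ge>0. \<bar>vk_ext \<delta> k \<psi> x t\<bar> \<le> C"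
    using vk_ext_bounded[of \<delta> k \<psi> C] assms(1) k * C by blast
qed

end
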